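(* Let $V$ be a $C_2$-cofinite vertex operator algebra of CFT-type. For $i=1,2,3$ let $M^i$ be a $g_i$-twisted admissible $V$-module, where $g_1,g_2,g_3$ are automorphisms of $V$ such that $g_1g_2=g_3$ and they generate a cyclic group of order $T$. Suppose $M^2$ and $M^3$ are lowest-weight modules, and $M^2$ and the contragredient module $(M^3)'$ are the generalized Verma modules of their bottom levels. Assume further that one of the following conditions holds: (1) $g_1=\mathrm{id}$ and $M^1$ is finitely generated; (2) $g_1,g_2,g_3$ have the same order $T$, and $M^1$ is a lowest-weight module that is the generalized Verma module of its bottom level. Then the fusion rule among twisted modules $$N\binom{M^3}{M^1\ M^2}:=\dim\mathfrak I\binom{M^3}{M^1\ M^2}$$ is finite, where $\mathfrak I\binom{M^3}{M^1\,M^2}$ is the space of twisted intertwining operators of type $\binom{M^3}{M^1\,M^2}$.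
   Context: Everything is over $\mathbb C$; $\mathbb N=\{0,1,2,\dots\}$. VOAs and twisted modules. A vertex operator algebra $V=\bigoplus_{k\in\mathbb N}V_k$ is $\mathbb N$-graded with $\dim V_k<\infty$, has vertex operators $Y(a,z)=\sum_{n\in\mathbb Z}a_{(n)}z^{-n-1}$, vacuum $\mathbf 1\in V_0$, conformal vector $\omega\in V_2$ with $Y(\omega,z)=\sum L_nz^{-n-2}$, and satisfies the usual axioms; $\mathrm{wt}\,a=k$ for $a\in V_k$. $V$ is of CFT-type if $V_0=\mathbb C\mathbf 1$, and $C_2$-cofinite if $V/\mathrm{span}\{a_{(-2)}b\}$ is finite-dimensional. Automorphisms are linear automorphisms $g$ fixing $\mathbf 1,\omega$ with $gY(a,z)g^{-1}=Y(ga,z)$; if $g^T=1$, $V_g^r=\{a: ga=e^{2\pi ir/T}a\}$, $0\le r\le T-1$. A weak $g$-twisted $V$-module has $Y_M(a,z)=\sum_{n\in\frac1T\mathbb Z}a_{(n)}z^{-n-1}$ with truncation, $Y_M(\mathbf 1,z)=\mathrm{id}$, only $n\in\frac rT+\mathbb Z$ for $a\in V_g^r$, and the usual twisted Jacobi identity; it is admissible if $M=\bigoplus_{n\in\frac1T\mathbb N}M(n)$ with $a_{(m)}M(n)\subset M(\mathrm{wt}\,a-m-1+n)$; $M(0)$ is the bottom level; it has conformal weight $h$ if $L_0=h+n$ on $M(n)$. The contragredient of an admissible $g$-twisted module $M$ is the admissible $g^{-1}$-twisted module $M'=\bigoplus_nM(n)^*$ with $\langle a_{(n)}u',u\rangle=\big\langle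 u',\sum_{j\ge0}\frac{(-1)^{\mathrm{wt}\,a}}{j!}(L_1^ja)_{(2\mathrm{wt}\,a-n-j-2)}u\big\rangle$. $\mathcal L_g(V)=\big(\bigoplus_rV_g^r\otimes z^{r/T}\mathbb C[z^{\pm1}]\big)/\mathrm{Im}(L_{-1}\otimes1+1\otimes\partial_z)$, with $a_{[n]}$ the class of $a\otimes z^n$, bracket $[a_{[m]},b_{[n]}]=\sum_{j\ge0}\binom mj(a_{(j)}b)_{[m+n-j]}$ and $\deg a_{[n]}=\mathrm{wt}\,a-n-1$; it acts on weak $g$-twisted modules by $a_{[n]}\mapsto a_{(n)}$. $g$-twisted Zhu's algebra: $A_g(V)=V/O_g(V)$, with $O_g(V)$ spanned by $\mathrm{Res}_z\frac{(1+z)^{\mathrm{wt}\,a-1+\delta(r)+r/T}}{z^{1+\delta(r)}}Y(a,z)b$ for homogeneous $a\in V_g^r$, $b\in V$, $\delta(0)=1$, $\delta(r)=0$ for $r\ne0$; product $[a]*_g[b]=[\mathrm{Res}_zY(a,z)b\frac{(1+z)^{\mathrm{wt}\,a}}z]$ for $a\in V_g^0$, and $0$ for $a\in V_g^r$, $r\ne0$. $M(0)$ is an $A_g(V)$-module via $[a]\mapsto a_{(\mathrm{wt}\,a-1)}$. For an $A_g(V)$-module $U$, the generalized Verma module is $\mathsf M(U)=\mathscr U_g(V)\otimes_{\mathscr U_g(V)_{\le0}}U$, where $\mathscr U_g(V)$ is the graded completed enveloping algebra of $\mathcal L_g(V)$ modulo the twisted Jacobi relations, degree-zero elements act on $U$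 through $a_{[\mathrm{wt}\,a-1]}\mapsto[a]$, and negative-degree elements act by $0$; equivalently it is the universal admissible $g$-twisted module generated by $U$ in degree $0$. A weak $g$-twisted module $M$ is a lowest-weight module if for some $L_0$-eigenvalue $h$ the eigenspace $M_h$ is an irreducible $\mathcal L_g(V)_0$-module ($\mathcal L_g(V)_0$ the degree-zero part) and $M$ is a quotient of $\mathsf M(M_h)$; then $M(0)=M_h$. Twisted intertwining operators. Each $M^i$ has a conformal weight $h_i$; $h=h_1+h_2-h_3$. In case (1) put $\epsilon=0$; in case (2) $g_1,g_2,g_3$ generate the same cyclic group and $g_1=g_2^\epsilon$. Put $V^r=V_{g_2}^r$. A twisted intertwining operator of type $\binom{M^3}{M^1\,M^2}$ is a linear map $I(\cdot,w)\colon M^1\to w^{-h}\mathrm{Hom}(M^2,M^3)[[w^{\pm1/T}]]$, $I(v,w)=\sum_{n\in\frac1T\mathbb Z}v_{(n)}w^{-n-h-1}$, such that: for $v\in M^1,v_2\in M^2$, $v_{(n)}v_2=0$ for $n\gg0$; for $a\in V^r$, $v\in M^1$ and every $F(z,w)\in z^{r/T}(z-w)^{\epsilon r/T}\mathbb C[z^{\pm1},(z-w)^{\pm1}]$, $$\mathrm{Res}_zY_{M^3}(a,z)I(v,w)\iota_{z^{-1}}F-\mathrm{Res}_zI(v,w)Y_{M^2}(a,z)\iota_zF=\mathrm{Res}_{z-w}I(Y_{M^1}(a,z-w)v,w)\iota_{z-w}F,$$ where $\iota_{z^{-1}},\iota_z,\iota_{z-w}$ are the expansions in $|z|>|w|$,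 $|z|<|w|$, $|z-w|<|w|$ (with a fixed choice of $(-w)^{1/T}$); and $I(L_{-1}v,w)=\partial_wI(v,w)$. *)

theory Defs
  imports
    Complex_Main
    "HOL-Library.Function_Algebras"
    "HOL-Library.Groups_Big_Fun"
    "HOL-Library.Extended_Nat"
    "HOL-Algebra.Elementary_Groups"
    "HOL-Algebra.Multiplicative_Group"
begin

section \<open>Complex vector spaces\<close>

class complex_vector = ab_group_add +
  fixes scaleC :: "complex \<Rightarrow> 'a \<Rightarrow> 'a"  (infixr \<open>*\<^sub>C\<close> 75)
  assumes scaleC_add_right: "c *\<^sub>C (x + y) = c *\<^sub>C x + c *\<^sub>C y"
    and scaleC_add_left: "(c + d) *\<^sub>C x = c *\<^sub>C x + d *\<^sub>C x"
    and scaleC_scaleC: "c *\<^sub>C d *\<^sub>C x = (c * d) *\<^sub>C x"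
    and scaleC_one: "1 *\<^sub>C x = x"

interpretation complex_vector: vector_space "scaleC :: complex \<Rightarrow> 'a \<Rightarrow> 'a::complex_vector"
  by unfold_locales
    (simp_all add: scaleC_add_right scaleC_add_left scaleC_scaleC scaleC_one)

instantiation complex :: complex_vector
begin
definition scaleC_complex :: "complex \<Rightarrow> complex \<Rightarrow> complex" where
  "scaleC_complex c x = c * x"
instance by standard (simp_all add: scaleC_complex_def algebra_simps)
end

instantiation "fun" :: (type, complex_vector) complex_vector
begin
definition scaleC_fun :: "complex \<Rightarrow> ('a \<Rightarrow> 'b) \<Rightarrow> 'a \<Rightarrow> 'b" where
  "scaleC_fun c f = (\<lambda>x. c *\<^sub>C f x)"
instance
  by standard
    (simp_all add: scaleC_fun_def fun_eq_iff scaleC_add_right scaleC_add_left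
      scaleC_scaleC scaleC_one)
end

definition finite_dim :: "'a::complex_vector set \<Rightarrow> bool" where
  "finite_dim W \<longleftrightarrow> (\<exists>B. finite B \<and> W \<subseteq> complex_vector.span B)"

text \<open>The library dimension is 0 on infinite-dimensional spaces, so the value infinity is
  split off.\<close>

definition edim :: "'a::complex_vector set \<Rightarrow> enat" where
  "edim W = (if finite_dim W then enat (complex_vector.dim W) else \<infinity>)"

definition decomposition :: "('i \<Rightarrow> 'a::complex_vector set) \<Rightarrow> 'a \<Rightarrow> ('i \<Rightarrow> 'a) \<Rightarrow> bool" where
  "decomposition G x f \<longleftrightarrow> (\<forall>i. f i \<in> G i) \<and> finite {i. f i \<noteq> 0} \<and> x = Sum_any f"

definition direct_sum :: "('i \<Rightarrow> 'a::complex_vector set) \<Rightarrow> 'a set \<Rightarrow> bool" where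
  "direct_sum G W \<longleftrightarrow>
     complex_vector.subspace W \<and>
     (\<forall>i. complex_vector.subspace (G i) \<and> G i \<subseteq> W) \<and>
     (\<forall>x\<in>W. \<exists>!f. decomposition G x f)"

definition hcomp :: "('i \<Rightarrow> 'a::complex_vector set) \<Rightarrow> 'a \<Rightarrow> 'i \<Rightarrow> 'a" where
  "hcomp G x = (THE f. decomposition G x f)"


section \<open>Vertex operator algebras\<close>

text \<open>\<open>VY V a n b\<close> is \<open>a\<^sub>(\<^sub>n\<^sub>) b\<close>.\<close>

record 'v voa =
  VY :: "'v \<Rightarrow> int \<Rightarrow> 'v \<Rightarrow> 'v"
  vac :: 'v
  conf :: 'v
  VGr :: "nat \<Rightarrow> 'v set"

definition Vir :: "'v voa \<Rightarrow> int \<Rightarrow> 'v \<Rightarrow> 'v" where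
  "Vir V n = VY V (conf V) (n + 1)"

text \<open>The Jacobi identity is given in components, as Borcherds' identity. All \<open>Sum_any\<close> over
  modes below have finite support because of truncation.\<close>

locale vertex_operator_algebra =
  fixes V :: "'v::complex_vector voa"
  assumes grading: "direct_sum (VGr V) UNIV"
    and finite_dim_VGr: "finite_dim (VGr V k)"
    and VY_add_left: "VY V (a + b) n c = VY V a n c + VY V b n c"
    and VY_scale_left: "VY V (x *\<^sub>C a) n c = x *\<^sub>C VY V a n c"
    and VY_add_right: "VY V a n (b + c) = VY V a n b + VY V a n c"
    and VY_scale_right: "VY V a n (x *\<^sub>C b) = x *\<^sub>C VY V a n b"
    and truncation: "\<exists>N. \<forall>n\<ge>N. VY V a n b = 0"
    and vac_VGr: "vac V \<in> VGr V 0"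
    and vacuum: "VY V (vac V) n b = (if n = -1 then b else 0)"
    and creation: "VY V a (-1) (vac V) = a" "n \<ge> 0 \<Longrightarrow> VY V a n (vac V) = 0"
    and Borcherds:
      "Sum_any (\<lambda>j. ((of_int m :: complex) gchoose j) *\<^sub>C
          VY V (VY V a (n + int j) b) (m + k - int j) c)
       = Sum_any (\<lambda>j. ((-1) ^ j * ((of_int n :: complex) gchoose j)) *\<^sub>C
          VY V a (m + n - int j) (VY V b (k + int j) c))
       - ((-1) powi n) *\<^sub>C
         Sum_any (\<lambda>j. ((-1) ^ j * ((of_int n :: complex) gchoose j)) *\<^sub>C
          VY V b (n + k - int j) (VY V a (m + int j) c))"
    and conf_VGr: "conf V \<in> VGr V 2"
    and Virasoro:
      "\<exists>c::complex. \<forall>m n b. Vir V m (Vir V n b) - Vir V n (Vir V m b)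
         = of_int (m - n) *\<^sub>C Vir V (m + n) b
           + (if m + n = 0 then (of_int (m ^ 3 - m) / 12 * c) *\<^sub>C b else 0)"
    and L0_VGr: "b \<in> VGr V k \<Longrightarrow> Vir V 0 b = of_nat k *\<^sub>C b"
    and L_minus1_derivative: "VY V (Vir V (-1) a) n b = (- of_int n) *\<^sub>C VY V a (n - 1) b"

definition CFT_type :: "'v::complex_vector voa \<Rightarrow> bool" where
  "CFT_type V \<longleftrightarrow> VGr V 0 = complex_vector.span {vac V}"

text \<open>\<open>V / C\<^sub>2(V)\<close> is finite-dimensional iff finitely many vectors together with \<open>C\<^sub>2(V)\<close>
  span \<open>V\<close>.\<close>

definition C2_cofinite :: "'v::complex_vector voa \<Rightarrow> bool" where
  "C2_cofinite V \<longleftrightarrow>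
     (\<exists>B. finite B \<and> complex_vector.span (B \<union> {VY V a (-2) b | a b. True}) = UNIV)"

definition voa_automorphism :: "'v::complex_vector voa \<Rightarrow> ('v \<Rightarrow> 'v) \<Rightarrow> bool" where
  "voa_automorphism V g \<longleftrightarrow>
     Vector_Spaces.linear scaleC scaleC g \<and> bij g \<and>
     g (vac V) = vac V \<and> g (conf V) = conf V \<and>
     (\<forall>a n b. g (VY V a n b) = VY V (g a) n (g b))"

definition aut_group :: "'v::complex_vector voa \<Rightarrow> ('v \<Rightarrow> 'v) monoid" where
  "aut_group V = \<lparr>carrier = {g. voa_automorphism V g}, mult = (\<circ>), one = id\<rparr>"

lemma group_aut_group: "group (aut_group V)"
proof (rule groupI)
  fix f assume "f \<in> carrier (aut_group V)"
  then have f: "voa_automorphism V f" by (simp add: aut_group_def)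
  then have b: "bij f" and l: "Vector_Spaces.linear scaleC scaleC f"
    by (simp_all add: voa_automorphism_def)
  define g where "g = inv_into UNIV f"
  have fg: "f (g x) = x" and gf: "g (f x) = x" for x
    using b by (simp_all add: g_def bij_is_surj surj_f_inv_f bij_is_inj)
  have eq: "g y = x \<longleftrightarrow> y = f x" for x y
    using fg gf by metis
  have "Vector_Spaces.linear scaleC scaleC g"
    by (intro Vector_Spaces.linear_iff[THEN iffD2] conjI allI complex_vector.vector_space_axioms)
      (use Vector_Spaces.linear_iff[THEN iffD1, OF l] in \<open>simp_all add: eq fg\<close>)
  moreover have "bij g" using b by (simp add: g_def bij_imp_bij_inv)
  ultimately have "voa_automorphism V g"
    using f by (simp add: voa_automorphism_def eq fg)
  then show "\<exists>g\<in>carrier (aut_group V). g \<otimes>\<^bsub>aut_group V\<^esub> f = \<one>\<^bsub>aut_group V\<^esub>"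
    by (auto simp: aut_group_def fun_eq_iff gf intro!: bexI[of _ g])
qed (auto simp: aut_group_def voa_automorphism_def o_assoc bij_comp complex_vector.linear_id
       intro: Vector_Spaces.linear_compose)

text \<open>The eigenspace \<open>V\<^sub>g\<^sup>r\<close>; \<open>T\<close> is any positive period of \<open>g\<close>, not necessarily its order.\<close>

definition sector :: "('v \<Rightarrow> 'v) \<Rightarrow> nat \<Rightarrow> nat \<Rightarrow> 'v::complex_vector set" where
  "sector g T r = {a. g a = exp (2 * of_real pi * \<i> * of_nat r / of_nat T) *\<^sub>C a}"


section \<open>Twisted modules\<close>

text \<open>A module lives on a subspace \<open>mcar\<close> of its type (needed for contragredients).
  \<open>mode M a n u\<close> is \<open>a\<^sub>(\<^sub>n\<^sub>) u\<close>; \<open>mgr M n\<close> is \<open>M(n)\<close>. Operators are only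
  constrained on \<open>mcar\<close>.\<close>

record ('v, 'm) vmod =
  mcar :: "'m set"
  mgr :: "rat \<Rightarrow> 'm set"
  mode :: "'v \<Rightarrow> rat \<Rightarrow> 'm \<Rightarrow> 'm"

definition weak_twisted_module ::
  "'v::complex_vector voa \<Rightarrow> ('v \<Rightarrow> 'v) \<Rightarrow> nat \<Rightarrow> ('v, 'm::complex_vector) vmod \<Rightarrow> bool" where
  "weak_twisted_module V g T M \<longleftrightarrow>
     complex_vector.subspace (mcar M) \<and>
     (\<forall>a n. \<forall>u\<in>mcar M. mode M a n u \<in> mcar M) \<and>
     (\<forall>a b n. \<forall>u\<in>mcar M. mode M (a + b) n u = mode M a n u + mode M b n u) \<and>
     (\<forall>c a n. \<forall>u\<in>mcar M. mode M (c *\<^sub>C a) n u = c *\<^sub>C mode M a n u) \<and>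
     (\<forall>a n. \<forall>u\<in>mcar M. \<forall>u'\<in>mcar M. mode M a n (u + u') = mode M a n u + mode M a n u') \<and>
     (\<forall>c a n. \<forall>u\<in>mcar M. mode M a n (c *\<^sub>C u) = c *\<^sub>C mode M a n u) \<and>
     (\<forall>a. \<forall>u\<in>mcar M. \<exists>N. \<forall>n\<ge>N. mode M a n u = 0) \<and>
     (\<forall>n. \<forall>u\<in>mcar M. mode M (vac V) n u = (if n = -1 then u else 0)) \<and>
     (\<forall>r<T. \<forall>a\<in>sector g T r. \<forall>n. n - of_nat r / of_nat T \<notin> \<int> \<longrightarrow>
        (\<forall>u\<in>mcar M. mode M a n u = 0)) \<and>
     (\<forall>r<T. \<forall>a\<in>sector g T r. \<forall>s<T. \<forall>b\<in>sector g T s. \<forall>u\<in>mcar M. \<forall>m n k.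
        m - of_nat r / of_nat T \<in> \<int> \<longrightarrow> k - of_nat s / of_nat T \<in> \<int> \<longrightarrow>
        Sum_any (\<lambda>j. ((of_rat m :: complex) gchoose j) *\<^sub>C
           mode M (VY V a (n + int j) b) (m + k - of_nat j) u)
        = Sum_any (\<lambda>j. ((-1) ^ j * ((of_int n :: complex) gchoose j)) *\<^sub>C
           mode M a (m + of_int n - of_nat j) (mode M b (k + of_nat j) u))
        - ((-1) powi n) *\<^sub>C
          Sum_any (\<lambda>j. ((-1) ^ j * ((of_int n :: complex) gchoose j)) *\<^sub>C
           mode M b (of_int n + k - of_nat j) (mode M a (m + of_nat j) u)))"

definition admissible_twisted_module ::
  "'v::complex_vector voa \<Rightarrow> ('v \<Rightarrow> 'v) \<Rightarrow> nat \<Rightarrow> ('v, 'm::complex_vector) vmod \<Rightarrow> bool" where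
  "admissible_twisted_module V g T M \<longleftrightarrow>
     weak_twisted_module V g T M \<and>
     direct_sum (mgr M) (mcar M) \<and>
     (\<forall>n. n \<notin> {of_nat i / of_nat T | i :: nat. True} \<longrightarrow> mgr M n = {0}) \<and>
     (\<forall>k. \<forall>a\<in>VGr V k. \<forall>m n. \<forall>u\<in>mgr M n. mode M a m u \<in> mgr M (of_nat k - m - 1 + n))"

definition conformal_weight ::
  "'v voa \<Rightarrow> ('v, 'm::complex_vector) vmod \<Rightarrow> complex \<Rightarrow> bool" where
  "conformal_weight V M h \<longleftrightarrow>
     (\<forall>n. \<forall>u\<in>mgr M n. mode M (conf V) 1 u = (h + of_rat n) *\<^sub>C u)"

definition finitely_generated :: "('v, 'm::complex_vector) vmod \<Rightarrow> bool" where
  "finitely_generated M \<longleftrightarrow>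
     (\<exists>S. finite S \<and> S \<subseteq> mcar M \<and>
        (\<forall>N. complex_vector.subspace N \<and> S \<subseteq> N \<and> N \<subseteq> mcar M \<and>
             (\<forall>a n. \<forall>u\<in>N. mode M a n u \<in> N) \<longrightarrow> N = mcar M))"

text \<open>\<open>M(n)\<^sup>*\<close> is realised inside the functionals on \<open>M\<close> that vanish on every other graded
  piece. Functionals are extended by 0 outside \<open>mcar M\<close>. The formula for homogeneous \<open>a\<close> is
  extended linearly through the weight components of \<open>a\<close>.\<close>

definition contragredient ::
  "'v::complex_vector voa \<Rightarrow> ('v, 'm::complex_vector) vmod \<Rightarrow> ('v, 'm \<Rightarrow> complex) vmod" where
  "contragredient V M =
    (let C = {f. (\<forall>u\<in>mcar M. \<forall>u'\<in>mcar M. f (u + u') = f u + f u') \<and>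
                 (\<forall>c. \<forall>u\<in>mcar M. f (c *\<^sub>C u) = c * f u) \<and>
                 (\<forall>u. u \<notin> mcar M \<longrightarrow> f u = 0) \<and>
                 finite {n. \<exists>u\<in>mgr M n. f u \<noteq> 0}}
     in \<lparr>mcar = C,
         mgr = (\<lambda>n. {f \<in> C. \<forall>k. k \<noteq> n \<longrightarrow> (\<forall>u\<in>mgr M k. f u = 0)}),
         mode = (\<lambda>a n f u. if u \<in> mcar M then
            Sum_any (\<lambda>k. f (Sum_any (\<lambda>j. ((-1) ^ k / fact j) *\<^sub>C
              mode M ((Vir V 1 ^^ j) (hcomp (VGr V) a k))
                (2 * of_nat k - n - of_nat j - 2) u)))
            else 0)\<rparr>)"


section \<open>Twisted Zhu algebra and its modules\<close>

definition Zhu_O :: "'v::complex_vector voa \<Rightarrow> ('v \<Rightarrow> 'v) \<Rightarrow> nat \<Rightarrow> 'v set" where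
  "Zhu_O V g T = complex_vector.span
     {Sum_any (\<lambda>j. ((of_nat k - 1 + of_nat \<delta> + of_nat r / of_nat T :: complex) gchoose j) *\<^sub>C
        VY V a (int j - 1 - int \<delta>) b) | k r \<delta> a b.
        r < T \<and> a \<in> VGr V k \<inter> sector g T r \<and> \<delta> = (if r = 0 then 1 else 0)}"

definition Zhu_prod :: "'v::complex_vector voa \<Rightarrow> nat \<Rightarrow> 'v \<Rightarrow> 'v \<Rightarrow> 'v" where
  "Zhu_prod V k a b = Sum_any (\<lambda>j. of_nat (k choose j) *\<^sub>C VY V a (int j - 1) b)"

text \<open>A module over \<open>A\<^sub>g(V) = V / O\<^sub>g(V)\<close> on the subspace \<open>U\<close>: \<open>act a u\<close> is \<open>[a] u\<close>.\<close>

definition Zhu_module ::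
  "'v::complex_vector voa \<Rightarrow> ('v \<Rightarrow> 'v) \<Rightarrow> nat \<Rightarrow> 'm::complex_vector set \<Rightarrow> ('v \<Rightarrow> 'm \<Rightarrow> 'm) \<Rightarrow> bool" where
  "Zhu_module V g T U act \<longleftrightarrow>
     complex_vector.subspace U \<and>
     (\<forall>a. \<forall>u\<in>U. act a u \<in> U) \<and>
     (\<forall>a b. \<forall>u\<in>U. act (a + b) u = act a u + act b u) \<and>
     (\<forall>c a. \<forall>u\<in>U. act (c *\<^sub>C a) u = c *\<^sub>C act a u) \<and>
     (\<forall>a. \<forall>u\<in>U. \<forall>u'\<in>U. act a (u + u') = act a u + act a u') \<and>
     (\<forall>c a. \<forall>u\<in>U. act a (c *\<^sub>C u) = c *\<^sub>C act a u) \<and>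
     (\<forall>a\<in>Zhu_O V g T. \<forall>u\<in>U. act a u = 0) \<and>
     (\<forall>u\<in>U. act (vac V) u = u) \<and>
     (\<forall>k. \<forall>a\<in>VGr V k \<inter> sector g T 0. \<forall>b. \<forall>u\<in>U. act (Zhu_prod V k a b) u = act a (act b u)) \<and>
     (\<forall>r. 0 < r \<longrightarrow> r < T \<longrightarrow>
        (\<forall>a\<in>sector g T r. \<forall>b. \<forall>u\<in>U. act a (act b u) = 0))"

text \<open>\<open>a\<^sub>(\<^sub>w\<^sub>t \<^sub>a \<^sub>- \<^sub>1\<^sub>)\<close>, extended linearly in \<open>a\<close>.\<close>

definition zero_mode ::
  "'v::complex_vector voa \<Rightarrow> ('v, 'm::complex_vector) vmod \<Rightarrow> 'v \<Rightarrow> 'm \<Rightarrow> 'm" where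
  "zero_mode V M a u = Sum_any (\<lambda>k. mode M (hcomp (VGr V) a k) (of_nat k - 1) u)"


section \<open>Generalized Verma modules\<close>

text \<open>
  \<open>\<M>(U)\<close> is constructed as the quotient \<open>F / K\<close> of the vector space \<open>F\<close> with basis the
  symbols \<open>a\<^sub>1[n\<^sub>1] \<dots> a\<^sub>l[n\<^sub>l] \<otimes> u\<close>, \<open>u \<in> U\<close> (a word paired with \<open>u\<close>), by the span \<open>K\<close> of the relators
  of the tensor product of the enveloping algebra with \<open>U\<close> over its part of degree \<open>\<le> 0\<close>.

  The enveloping algebra is completed only to give a meaning to the infinite sums in
  the Jacobi relations. Applied to a homogeneous word of degree \<open>d\<close>, all but finitely many
  of their terms end in a word of negative degree, which annihilates \<open>U\<close>;
  the Jacobi relators are therefore cut off at such an \<open>N\<close>, and no completion is needed.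
\<close>

type_synonym 'v word = "('v \<times> rat) list"

definition tens :: "'v word \<Rightarrow> 'm \<Rightarrow> 'v word \<times> 'm \<Rightarrow> complex" where
  "tens w u = (\<lambda>x. if x = (w, u) then 1 else 0)"

definition free_words :: "'m set \<Rightarrow> ('v word \<times> 'm \<Rightarrow> complex) set" where
  "free_words U = complex_vector.span {tens w u | w u. u \<in> U}"

text \<open>The degrees of a word with homogeneous letters (a set, since \<open>0\<close> has every weight; empty
  if some letter is not homogeneous).\<close>

primrec word_deg :: "'v voa \<Rightarrow> 'v word \<Rightarrow> rat set" where
  "word_deg V [] = {0}"
| "word_deg V (x # w) =
     {of_nat k - snd x - 1 + d | k d. fst x \<in> VGr V k \<and> d \<in> word_deg V w}"

text \<open>A letter \<open>(a, n)\<close> is admitted for every \<open>a \<in> V\<close> and \<open>n\<close>; the relators \<open>sector\<close> remove those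
  which are not in \<open>V\<^sub>g\<^sup>r \<otimes> z\<^sup>r\<^sup>/\<^sup>T \<complex>[z, 1/z]\<close>. The prefix \<open>p\<close> makes \<open>K\<close> stable
  under the left action.\<close>

inductive_set Verma_relators ::
  "'v::complex_vector voa \<Rightarrow> ('v \<Rightarrow> 'v) \<Rightarrow> nat \<Rightarrow> 'm::complex_vector set \<Rightarrow> ('v \<Rightarrow> 'm \<Rightarrow> 'm)
     \<Rightarrow> ('v word \<times> 'm \<Rightarrow> complex) set"
  for V g T U act
  where
    vector_add: "u \<in> U \<Longrightarrow> u' \<in> U \<Longrightarrow>
      tens p (u + u') - tens p u - tens p u' \<in> Verma_relators V g T U act"
  | vector_scale: "u \<in> U \<Longrightarrow>
      tens p (c *\<^sub>C u) - c *\<^sub>C tens p u \<in> Verma_relators V g T U act"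
  | letter_add: "u \<in> U \<Longrightarrow>
      tens (p @ (a + b, n) # w) u - tens (p @ (a, n) # w) u - tens (p @ (b, n) # w) u
        \<in> Verma_relators V g T U act"
  | letter_scale: "u \<in> U \<Longrightarrow>
      tens (p @ (c *\<^sub>C a, n) # w) u - c *\<^sub>C tens (p @ (a, n) # w) u \<in> Verma_relators V g T U act"
  | sector: "u \<in> U \<Longrightarrow> r < T \<Longrightarrow> a \<in> sector g T r \<Longrightarrow> n - of_nat r / of_nat T \<notin> \<int> \<Longrightarrow>
      tens (p @ (a, n) # w) u \<in> Verma_relators V g T U act"
  | derivative: "u \<in> U \<Longrightarrow>
      tens (p @ (Vir V (-1) a, n) # w) u + of_rat n *\<^sub>C tens (p @ (a, n - 1) # w) u
        \<in> Verma_relators V g T U act"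
  | bracket: "u \<in> U \<Longrightarrow> r < T \<Longrightarrow> s < T \<Longrightarrow> a \<in> sector g T r \<Longrightarrow> b \<in> sector g T s \<Longrightarrow>
      m - of_nat r / of_nat T \<in> \<int> \<Longrightarrow> n - of_nat s / of_nat T \<in> \<int> \<Longrightarrow>
      (\<And>j. j \<ge> N \<Longrightarrow> VY V a (int j) b = 0) \<Longrightarrow>
      tens (p @ (a, m) # (b, n) # w) u - tens (p @ (b, n) # (a, m) # w) u
        - (\<Sum>j<N. ((of_rat m :: complex) gchoose j) *\<^sub>C
             tens (p @ (VY V a (int j) b, m + n - of_nat j) # w) u)
        \<in> Verma_relators V g T U act"
  | Jacobi: "u \<in> U \<Longrightarrow> r < T \<Longrightarrow> s < T \<Longrightarrow>
      a \<in> VGr V i \<inter> sector g T r \<Longrightarrow> b \<in> VGr V l \<inter> sector g T s \<Longrightarrow>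
      m - of_nat r / of_nat T \<in> \<int> \<Longrightarrow> k - of_nat s / of_nat T \<in> \<int> \<Longrightarrow>
      d \<in> word_deg V w \<Longrightarrow>
      (\<And>j. j \<ge> N \<Longrightarrow> VY V a (n + int j) b = 0) \<Longrightarrow>
      of_nat l - (k + of_nat N) - 1 + d < 0 \<Longrightarrow>
      of_nat i - (m + of_nat N) - 1 + d < 0 \<Longrightarrow>
      (\<Sum>j<N. ((of_rat m :: complex) gchoose j) *\<^sub>C
             tens (p @ (VY V a (n + int j) b, m + k - of_nat j) # w) u)
        - (\<Sum>j<N. ((-1) ^ j * ((of_int n :: complex) gchoose j)) *\<^sub>C
             (tens (p @ (a, m + of_int n - of_nat j) # (b, k + of_nat j) # w) u
              - ((-1) powi n) *\<^sub>C
                tens (p @ (b, of_int n + k - of_nat j) # (a, m + of_nat j) # w) u))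
        \<in> Verma_relators V g T U act"
  | negative_degree: "u \<in> U \<Longrightarrow> d \<in> word_deg V w \<Longrightarrow> d < 0 \<Longrightarrow>
      tens (p @ w) u \<in> Verma_relators V g T U act"
  | degree_zero: "u \<in> U \<Longrightarrow> a \<in> VGr V k \<Longrightarrow>
      tens (p @ [(a, of_nat k - 1)]) u - tens p (act a u) \<in> Verma_relators V g T U act"

definition Verma_kernel ::
  "'v::complex_vector voa \<Rightarrow> ('v \<Rightarrow> 'v) \<Rightarrow> nat \<Rightarrow> 'm::complex_vector set \<Rightarrow> ('v \<Rightarrow> 'm \<Rightarrow> 'm)
     \<Rightarrow> ('v word \<times> 'm \<Rightarrow> complex) set" where
  "Verma_kernel V g T U act = complex_vector.span (Verma_relators V g T U act)"

definition word_act :: "('v, 'm) vmod \<Rightarrow> 'v word \<Rightarrow> 'm \<Rightarrow> 'm" where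
  "word_act M w u = foldr (\<lambda>(a, n). mode M a n) w u"

definition Verma_map ::
  "('v, 'm::complex_vector) vmod \<Rightarrow> ('v word \<times> 'm \<Rightarrow> complex) \<Rightarrow> 'm" where
  "Verma_map M x = Sum_any (\<lambda>(w, u). x (w, u) *\<^sub>C word_act M w u)"

text \<open>For a subspace \<open>U\<close> of \<open>M\<close> on which \<open>A\<^sub>g(V)\<close> acts by zero modes, \<open>M\<close> is a quotient
  of \<open>\<M>(U) = F / K\<close> if the canonical map \<open>F / K \<rightarrow> M\<close> is well defined and onto, and it is \<open>\<M>(U)\<close>
  if this map is moreover injective.\<close>

definition quotient_of_Verma ::
  "'v::complex_vector voa \<Rightarrow> ('v \<Rightarrow> 'v) \<Rightarrow> nat \<Rightarrow> ('v, 'm::complex_vector) vmod \<Rightarrow> 'm set \<Rightarrow> bool" where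
  "quotient_of_Verma V g T M U \<longleftrightarrow>
     U \<subseteq> mcar M \<and>
     Zhu_module V g T U (zero_mode V M) \<and>
     (\<forall>x\<in>Verma_kernel V g T U (zero_mode V M). Verma_map M x = 0) \<and>
     Verma_map M ` free_words U = mcar M"

definition is_Verma_of ::
  "'v::complex_vector voa \<Rightarrow> ('v \<Rightarrow> 'v) \<Rightarrow> nat \<Rightarrow> ('v, 'm::complex_vector) vmod \<Rightarrow> 'm set \<Rightarrow> bool" where
  "is_Verma_of V g T M U \<longleftrightarrow>
     quotient_of_Verma V g T M U \<and>
     {x \<in> free_words U. Verma_map M x = 0} = Verma_kernel V g T U (zero_mode V M)"

definition Verma_of_bottom_level ::
  "'v::complex_vector voa \<Rightarrow> ('v \<Rightarrow> 'v) \<Rightarrow> nat \<Rightarrow> ('v, 'm::complex_vector) vmod \<Rightarrow> bool" where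
  "Verma_of_bottom_level V g T M \<longleftrightarrow> is_Verma_of V g T M (mgr M 0)"

text \<open>The degree-zero part of \<open>\<L>\<^sub>g(V)\<close> is spanned by the \<open>a[wt a - 1]\<close>.\<close>

definition irreducible_degree_zero ::
  "'v::complex_vector voa \<Rightarrow> ('v, 'm::complex_vector) vmod \<Rightarrow> 'm set \<Rightarrow> bool" where
  "irreducible_degree_zero V M U \<longleftrightarrow>
     U \<noteq> {0} \<and>
     (\<forall>k. \<forall>a\<in>VGr V k. \<forall>u\<in>U. mode M a (of_nat k - 1) u \<in> U) \<and>
     (\<forall>N. complex_vector.subspace N \<and> N \<subseteq> U \<and>
          (\<forall>k. \<forall>a\<in>VGr V k. \<forall>u\<in>N. mode M a (of_nat k - 1) u \<in> N) \<longrightarrow> N = {0} \<or> N = U)"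

text \<open>A lowest-weight module carries the grading with bottom level \<open>M\<^sub>h\<close>.\<close>

definition lowest_weight_module ::
  "'v::complex_vector voa \<Rightarrow> ('v \<Rightarrow> 'v) \<Rightarrow> nat \<Rightarrow> ('v, 'm::complex_vector) vmod \<Rightarrow> bool" where
  "lowest_weight_module V g T M \<longleftrightarrow>
     weak_twisted_module V g T M \<and>
     (\<exists>h. let M\<^sub>h = {u \<in> mcar M. mode M (conf V) 1 u = h *\<^sub>C u} in
        irreducible_degree_zero V M M\<^sub>h \<and> quotient_of_Verma V g T M M\<^sub>h \<and> mgr M 0 = M\<^sub>h)"


section \<open>Twisted intertwining operators\<close>

text \<open>
  \<open>I v n u\<close> is \<open>v\<^sub>(\<^sub>n\<^sub>) u\<close>, the coefficient of \<open>w\<^sup>-\<^sup>n\<^sup>-\<^sup>h\<^sup>-\<^sup>1\<close> in \<open>I(v, w) u\<close>, set to 0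
  outside \<open>M\<^sup>1\<close>, \<open>(1/T) \<int>\<close>, \<open>M\<^sup>2\<close>. The choice of \<open>(-w)\<^sup>1\<^sup>/\<^sup>T\<close> is \<open>\<zeta> w\<^sup>1\<^sup>/\<^sup>T\<close> with
  \<open>\<zeta>\<^sup>T = -1\<close>, so that \<open>(-w)\<^sup>x = \<zeta>\<^sup>T\<^sup>x w\<^sup>x\<close> for \<open>x \<in> (1/T) \<int>\<close>.

  The functions \<open>F\<close> in the residue identity are spanned by \<open>F = z\<^sup>\<alpha> (z - w)\<^sup>\<beta>\<close> with \<open>\<alpha> \<in> r/T + \<int>\<close>,
  \<open>\<beta> \<in> \<epsilon> r/T + \<int>\<close>, with expansions

  \<^item> \<open>\<Sum>j. (\<beta> gchoose j) (-1)\<^sup>j w\<^sup>j z\<^sup>\<alpha>\<^sup>+\<^sup>\<beta>\<^sup>-\<^sup>j\<close> in \<open>|z| > |w|\<close>,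
  \<^item> \<open>\<Sum>j. (\<beta> gchoose j) (-w)\<^sup>\<beta>\<^sup>-\<^sup>j z\<^sup>\<alpha>\<^sup>+\<^sup>j\<close> in \<open>|z| < |w|\<close>,
  \<^item> \<open>\<Sum>j. (\<alpha> gchoose j) w\<^sup>\<alpha>\<^sup>-\<^sup>j (z - w)\<^sup>\<beta>\<^sup>+\<^sup>j\<close> in \<open>|z - w| < |w|\<close>.

  The Jacobi identity below is the coefficient of \<open>w\<^sup>-\<^sup>k\<^sup>-\<^sup>h\<^sup>-\<^sup>1\<close> of the residue identity.
\<close>

definition intertwining_operators ::
  "'v::complex_vector voa \<Rightarrow> ('v \<Rightarrow> 'v) \<Rightarrow> nat \<Rightarrow> int \<Rightarrow> complex \<Rightarrow> complex \<Rightarrow>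
   ('v, 'm1::complex_vector) vmod \<Rightarrow> ('v, 'm2::complex_vector) vmod \<Rightarrow>
   ('v, 'm3::complex_vector) vmod \<Rightarrow> ('m1 \<Rightarrow> rat \<Rightarrow> 'm2 \<Rightarrow> 'm3) set" where
  "intertwining_operators V g\<^sub>2 T \<epsilon> \<zeta> h M1 M2 M3 = {I.
     (\<forall>v n u. v \<notin> mcar M1 \<or> of_nat T * n \<notin> \<int> \<or> u \<notin> mcar M2 \<longrightarrow> I v n u = 0) \<and>
     (\<forall>v\<in>mcar M1. \<forall>n. \<forall>u\<in>mcar M2. I v n u \<in> mcar M3) \<and>
     (\<forall>v\<in>mcar M1. \<forall>v'\<in>mcar M1. \<forall>n. \<forall>u\<in>mcar M2. I (v + v') n u = I v n u + I v' n u) \<and>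
     (\<forall>c. \<forall>v\<in>mcar M1. \<forall>n. \<forall>u\<in>mcar M2. I (c *\<^sub>C v) n u = c *\<^sub>C I v n u) \<and>
     (\<forall>v\<in>mcar M1. \<forall>n. \<forall>u\<in>mcar M2. \<forall>u'\<in>mcar M2. I v n (u + u') = I v n u + I v n u') \<and>
     (\<forall>c. \<forall>v\<in>mcar M1. \<forall>n. \<forall>u\<in>mcar M2. I v n (c *\<^sub>C u) = c *\<^sub>C I v n u) \<and>
     (\<forall>v\<in>mcar M1. \<forall>u\<in>mcar M2. \<exists>N. \<forall>n\<ge>N. I v n u = 0) \<and>
     (\<forall>r<T. \<forall>a\<in>sector g\<^sub>2 T r. \<forall>v\<in>mcar M1. \<forall>u\<in>mcar M2. \<forall>\<alpha> \<beta> k.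
        \<alpha> - of_nat r / of_nat T \<in> \<int> \<longrightarrow> \<beta> - of_int \<epsilon> * of_nat r / of_nat T \<in> \<int> \<longrightarrow>
        Sum_any (\<lambda>j. ((-1) ^ j * ((of_rat \<beta> :: complex) gchoose j)) *\<^sub>C
          mode M3 a (\<alpha> + \<beta> - of_nat j) (I v (k + of_nat j) u))
        - Sum_any (\<lambda>j. (\<zeta> powi \<lfloor>of_nat T * (\<beta> - of_nat j)\<rfloor> * ((of_rat \<beta> :: complex) gchoose j)) *\<^sub>C
          I v (k + \<beta> - of_nat j) (mode M2 a (\<alpha> + of_nat j) u))
        = Sum_any (\<lambda>j. ((of_rat \<alpha> :: complex) gchoose j) *\<^sub>C
          I (mode M1 a (\<beta> + of_nat j) v) (k + \<alpha> - of_nat j) u)) \<and>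
     (\<forall>v\<in>mcar M1. \<forall>n. \<forall>u\<in>mcar M2.
        I (mode M1 (conf V) 0 v) n u = (- of_rat n - h) *\<^sub>C I v (n - 1) u)}"

definition fusion_rule ::
  "'v::complex_vector voa \<Rightarrow> ('v \<Rightarrow> 'v) \<Rightarrow> nat \<Rightarrow> int \<Rightarrow> complex \<Rightarrow> complex \<Rightarrow>
   ('v, 'm1::complex_vector) vmod \<Rightarrow> ('v, 'm2::complex_vector) vmod \<Rightarrow>
   ('v, 'm3::complex_vector) vmod \<Rightarrow> enat" where
  "fusion_rule V g\<^sub>2 T \<epsilon> \<zeta> h M1 M2 M3 = edim (intertwining_operators V g\<^sub>2 T \<epsilon> \<zeta> h M1 M2 M3)"

end

theory Submission
  imports Defs
begin

text \<open>
  Both cases satisfy \<open>g\<^sub>1 = g\<^sub>2\<^sup>\<epsilon>\<close> with \<open>M\<^sup>1\<close> finitely generated, and this is all the proof needs. An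
  intertwining operator \<open>I\<close> is determined by the \<open>M\<^sup>3(0)\<close>-components of \<open>v\<^sub>(\<^sub>k\<^sub>) u\<close> for \<open>u\<close> in the
  finite-dimensional space \<open>M\<^sup>2(0)\<close> and \<open>v\<close> in a finite subset of \<open>M\<^sup>1\<close>.

  Indeed, suppose these components vanish. As \<open>V\<close> is \<open>C\<^sub>2\<close>-cofinite, \<open>M\<^sup>1\<close> is spanned by finitely many
  vectors and the \<open>a\<^sub>(\<^sub>\<beta>\<^sub>) x\<close> with \<open>\<beta> < -1\<close>, and the residue identity trades the latter for vectors of lower
  degree; so the components vanish for all \<open>v \<in> M\<^sup>1\<close>. As \<open>M\<^sup>2\<close> is generated by \<open>M\<^sup>2(0)\<close>, they then
  vanish for all \<open>u \<in> M\<^sup>2\<close>. Hence the span of all \<open>v\<^sub>(\<^sub>k\<^sub>) u\<close> is a submodule of \<open>M\<^sup>3\<close> that is annihilated by the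
  bottom level of the contragredient module, thus by all of it, and is therefore zero.

  The spanning set of \<open>M\<^sup>1\<close> comes from the filtration of a finitely generated module by the total weight
  of words in modes. On the associated graded space modes commute and \<open>V\<close> acts through
  \<open>V / C\<^sub>2(V)\<close>, and two letters of equal index can be replaced by shorter words and by words whose
  indices are further spread out, so only boundedly long words with bounded indices remain.
\<close>

text \<open>The proof exploits the freedom in the test functions z^\<alpha> (z - w)^\<beta>, whose
  exponents run through cosets of the integers. To isolate a_(\<beta>) on \<open>M1\<close>, the
  modes of \<open>a\<close> on the other two modules must not reach the bottom: \<alpha> > wt a - 1
  kills M2(0), and \<alpha> + \<beta> < wt a - 1 raises degrees in \<open>M3\<close>. This window
  for \<alpha> has length -\<beta>, so it meets every coset once \<beta> < -1. Hence the threshold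
  -1 in the spanning set of \<open>M1\<close>. Finitely many pairs v, u suffice although each has
  infinitely many modes: the conformal weights make v_(k) u homogeneous of a degree that moves with
  k, so a single k reaches M3(0). That M2(0) and M3(0) are finite-dimensional has to be proved. Over
  the zero modes they are irreducible, hence cyclic, and composites of zero modes are zero modes of
  Zhu products; C_2-cofiniteness then leaves finitely many zero modes of one vector. Throughout,
  vectors of \<open>V\<close> must be homogeneous and eigenvectors of an automorphism at once. The
  residue identity uses g2 while \<open>M1\<close> is twisted by g1, and g1 = g2^\<epsilon>
  translates between the two.\<close>

abbreviation cspan :: "'a::complex_vector set \<Rightarrow> 'a set" where
  "cspan \<equiv> complex_vector.span"

abbreviation csubspace :: "'a::complex_vector set \<Rightarrow> bool" where
  "csubspace \<equiv> complex_vector.subspace"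

lemmas csubspace_0 = complex_vector.subspace_0
lemmas csubspace_add = complex_vector.subspace_add
lemmas csubspace_diff = complex_vector.subspace_diff
lemmas csubspace_scale = complex_vector.subspace_scale
lemmas csubspace_sum = complex_vector.subspace_sum

lemma csubspace_Sum_any:
  assumes "csubspace W" "\<And>i. f i \<in> W"
  shows "Sum_any f \<in> W"
  unfolding Sum_any.expand_set using assms by (intro csubspace_sum) auto

lemma csubspace_minus_iff: "csubspace W \<Longrightarrow> - x \<in> W \<longleftrightarrow> x \<in> W"
  using complex_vector.subspace_neg by fastforce

lemma csubspace_scale_iff: "csubspace W \<Longrightarrow> c \<noteq> 0 \<Longrightarrow> c *\<^sub>C x \<in> W \<longleftrightarrow> x \<in> W"
  using csubspace_scale[of W "c *\<^sub>C x" "inverse c"] csubspace_scale[of W x c]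
  by (auto simp: scaleC_scaleC scaleC_one)

section \<open>Finitely supported sums, and linear algebra on subspaces\<close>

lemma Sum_any_nat:
  fixes f :: "nat \<Rightarrow> 'a::comm_monoid_add"
  assumes "\<And>j. j \<ge> N \<Longrightarrow> f j = 0"
  shows "Sum_any f = sum f {..<N}"
proof (rule Sum_any.expand_superset)
  show "{j. f j \<noteq> 0} \<subseteq> {..<N}" using assms by (metis (mono_tags, lifting) lessThan_iff mem_Collect_eq not_le subsetI)
qed simp

lemma Sum_any_nat_split:
  fixes f :: "nat \<Rightarrow> 'a::ab_group_add"
  assumes "\<And>j. j \<ge> N \<Longrightarrow> f j = 0"
  shows "Sum_any f = f 0 + Sum_any (\<lambda>j. f (Suc j))"
proof -
  have "Sum_any f = sum f {..<Suc N}"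
    using assms by (intro Sum_any_nat) simp
  moreover have "Sum_any (\<lambda>j. f (Suc j)) = sum (\<lambda>j. f (Suc j)) {..<N}"
    using assms by (intro Sum_any_nat) simp
  ultimately show ?thesis
    by (simp add: sum.lessThan_Suc_shift del: sum.lessThan_Suc)
qed

lemma Sum_any_single:
  assumes "\<And>j. j \<noteq> i \<Longrightarrow> f j = 0"
  shows "Sum_any f = f i"
  using Sum_any.expand_superset[of "{i}" f] assms by auto

lemma finite_nat_support: "(\<And>j. j \<ge> N \<Longrightarrow> f j = 0) \<Longrightarrow> finite {j::nat. f j \<noteq> 0}"
  by (rule finite_subset[of _ "{..<N}"]) (use not_less in auto)

lemma finite_subset_span:
  fixes Y :: "'w::complex_vector set"
  assumes "finite X" "X \<subseteq> cspan Y"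
  obtains Y' where "finite Y'" "Y' \<subseteq> Y" "X \<subseteq> cspan Y'"
proof -
  have "\<exists>Y'. finite Y' \<and> Y' \<subseteq> Y \<and> X \<subseteq> cspan Y'" using assms
  proof (induction X rule: finite_induct)
    case (insert x X)
    then obtain Y' where Y': "finite Y'" "Y' \<subseteq> Y" "X \<subseteq> cspan Y'" by auto
    from insert.prems have "x \<in> cspan Y" by simp
    then obtain t r where t: "finite t" "t \<subseteq> Y" "x = (\<Sum>a\<in>t. r a *\<^sub>C a)"
      unfolding complex_vector.span_explicit by auto
    then have "x \<in> cspan t"
      by (auto intro: complex_vector.span_sum complex_vector.span_scale complex_vector.span_base)
    with Y' t show ?case
      using complex_vector.span_mono[of t "Y' \<union> t"] complex_vector.span_mono[of Y' "Y' \<union> t"]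
      by (intro exI[of _ "Y' \<union> t"]) auto
  qed auto
  with that show ?thesis by blast
qed

text \<open>Linearity is asked only on \<open>D\<close> because the operators of a module are
  constrained only on its carrier.\<close>

definition clinear_on :: "'a::complex_vector set \<Rightarrow> ('a \<Rightarrow> 'b::complex_vector) \<Rightarrow> bool" where
  "clinear_on D f \<longleftrightarrow> (\<forall>x\<in>D. \<forall>y\<in>D. f (x + y) = f x + f y) \<and> (\<forall>c. \<forall>x\<in>D. f (c *\<^sub>C x) = c *\<^sub>C f x)"

lemma clinear_on_add: "clinear_on D f \<Longrightarrow> x \<in> D \<Longrightarrow> y \<in> D \<Longrightarrow> f (x + y) = f x + f y"
  and clinear_on_scale: "clinear_on D f \<Longrightarrow> x \<in> D \<Longrightarrow> f (c *\<^sub>C x) = c *\<^sub>C f x"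
  by (auto simp: clinear_on_def)

lemma clinear_on_0: "clinear_on D f \<Longrightarrow> csubspace D \<Longrightarrow> f 0 = 0"
  using clinear_on_scale[of D f 0 0] csubspace_0 by fastforce

lemma clinear_on_minus: "clinear_on D f \<Longrightarrow> x \<in> D \<Longrightarrow> f (- x) = - f x"
  using clinear_on_scale[of D f x "-1"] by (simp add: scaleC_one)

lemma clinear_on_diff: "clinear_on D f \<Longrightarrow> csubspace D \<Longrightarrow> x \<in> D \<Longrightarrow> y \<in> D \<Longrightarrow> f (x - y) = f x - f y"
  using clinear_on_add[of D f x "- y"] clinear_on_minus[of D f y] complex_vector.subspace_neg[of D y]
  by simp

lemma clinear_on_sum:
  assumes "clinear_on D f" "csubspace D" "\<And>i. i \<in> A \<Longrightarrow> g i \<in> D"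
  shows "f (sum g A) = (\<Sum>i\<in>A. f (g i))"
  using assms(3)
  by (induction A rule: infinite_finite_induct)
    (simp_all add: clinear_on_0[OF assms(1,2)] clinear_on_add[OF assms(1)] csubspace_sum[OF assms(2)])

lemma clinear_on_Sum_any:
  assumes "clinear_on D f" "csubspace D" "\<And>i. g i \<in> D" "finite {i. g i \<noteq> 0}"
  shows "f (Sum_any g) = Sum_any (\<lambda>i. f (g i))"
proof -
  have "Sum_any (\<lambda>i. f (g i)) = (\<Sum>i | g i \<noteq> 0. f (g i))"
    using assms(4) by (intro Sum_any.expand_superset) (auto intro: clinear_on_0[OF assms(1,2)])
  then show ?thesis
    unfolding Sum_any.expand_set[of g]
    using clinear_on_sum[OF assms(1,2), of "{i. g i \<noteq> 0}" g] assms(3) by metis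
qed

text \<open>This replaces arguments in quotient spaces: a congruence is stated as membership in a
  subspace \<open>W\<close> and checked on generators.\<close>

lemma clinear_on_span:
  assumes "clinear_on D f" "csubspace D" "Y \<subseteq> D" "csubspace W"
    and "\<And>y. y \<in> Y \<Longrightarrow> f y \<in> W" and "x \<in> cspan Y"
  shows "f x \<in> W"
proof -
  have "x \<in> D \<and> f x \<in> W" using assms(6)
  proof (induction rule: complex_vector.span_induct_alt)
    case base
    then show ?case using assms by (simp add: clinear_on_0 csubspace_0)
  next
    case (step c y z)
    then have "y \<in> D" "f y \<in> W" using assms(3,5) by auto
    with step assms(1,2,4) show ?case
      by (simp add: clinear_on_add clinear_on_scale csubspace_scale csubspace_add)
  qed
  then show ?thesis ..
qed

lemma finite_dim_mono: "finite_dim W \<Longrightarrow> W' \<subseteq> W \<Longrightarrow> finite_dim W'"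
  unfolding finite_dim_def by blast

text \<open>Preimages \<open>C\<close> of a finite basis of the image and a spanning set
  \<open>K\<close> of the kernel span \<open>W\<close>: a vector minus a suitable combination of
  \<open>C\<close> lies in the kernel.\<close>

lemma finite_dim_kernel_image:
  assumes W: "csubspace W" and f: "clinear_on W f"
    and fin: "finite_dim (f ` W)" and ker: "finite_dim {x \<in> W. f x = 0}"
  shows "finite_dim W"
proof -
  obtain B where B: "B \<subseteq> f ` W" "complex_vector.independent B" "f ` W \<subseteq> cspan B"
    using complex_vector.maximal_independent_subset[of "f ` W"] by blast
  obtain B' where B': "finite B'" "f ` W \<subseteq> cspan B'"
    using fin unfolding finite_dim_def by blast
  have finB: "finite B"
    using complex_vector.independent_span_bound[OF B'(1) B(2)] B(1) B'(2) by blast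
  obtain C where C: "C \<subseteq> W" "f ` C = B" "finite C"
    using finite_subset_image[OF finB B(1)] by metis
  obtain K where K: "finite K" "{x \<in> W. f x = 0} \<subseteq> cspan K"
    using ker unfolding finite_dim_def by blast
  have CW: "cspan C \<subseteq> W" using C(1) W by (rule complex_vector.span_minimal)
  have im: "f y \<in> f ` cspan C" if "y \<in> W" for y
  proof -
    have "f y \<in> cspan B" using B(3) that by blast
    then show ?thesis
    proof (induction rule: complex_vector.span_induct_alt)
      case base
      then show ?case using clinear_on_0[OF f W] complex_vector.span_zero by (metis imageI)
    next
      case (step c x y)
      then obtain a b where "a \<in> C" "x = f a" "b \<in> cspan C" "y = f b" using C(2) by blast
      then have "c *\<^sub>C x + y = f (c *\<^sub>C a + b)" and "c *\<^sub>C a + b \<in> cspan C"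
        using C(1) CW W f
        by (auto simp: clinear_on_add clinear_on_scale csubspace_scale subset_iff
            complex_vector.span_add complex_vector.span_scale complex_vector.span_base)
      then show ?case by blast
    qed
  qed
  have "W \<subseteq> cspan (C \<union> K)"
  proof
    fix y assume y: "y \<in> W"
    then obtain z where z: "z \<in> cspan C" "f y = f z" using im by blast
    then have "y - z \<in> cspan K"
      using K(2) y CW W f by (auto simp: clinear_on_diff csubspace_diff subset_iff)
    then have "z + (y - z) \<in> cspan (C \<union> K)"
      using z(1) complex_vector.span_mono[of C "C \<union> K"] complex_vector.span_mono[of K "C \<union> K"]
      by (intro complex_vector.span_add) auto
    then show "y \<in> cspan (C \<union> K)" by simp
  qed
  then show ?thesis
    using C(3) K(1) unfolding finite_dim_def by blast
qed

text \<open>Passing to one kernel after the other costs a finite dimension each time, and nothing is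
  left at the end. The maps will be evaluations of an intertwining operator at finitely many pairs
  of vectors.\<close>

lemma finite_dim_of_maps:
  assumes "finite P" "csubspace W" "\<And>p. p \<in> P \<Longrightarrow> clinear_on W (f p)"
    and "\<And>p. p \<in> P \<Longrightarrow> finite_dim (f p ` W)"
    and "\<And>x. x \<in> W \<Longrightarrow> (\<And>p. p \<in> P \<Longrightarrow> f p x = 0) \<Longrightarrow> x = 0"
  shows "finite_dim W"
  using assms
proof (induction P arbitrary: W rule: finite_induct)
  case empty
  then have "W \<subseteq> cspan {}" by auto
  then show ?case unfolding finite_dim_def by blast
next
  case (insert p P)
  let ?K = "{x \<in> W. f p x = 0}"
  have fp: "clinear_on W (f p)" using insert.prems by simp
  have K: "csubspace ?K"
    unfolding complex_vector.subspace_def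
    using insert.prems(1) clinear_on_0[OF fp] clinear_on_add[OF fp] clinear_on_scale[OF fp]
    by (auto simp: csubspace_0 csubspace_add csubspace_scale)
  have "finite_dim ?K"
  proof (rule insert.IH[OF K])
    fix q assume "q \<in> P"
    then show "clinear_on ?K (f q)" and "finite_dim (f q ` ?K)"
      using insert.prems(2,3)[of q] by (auto simp: clinear_on_def intro: finite_dim_mono)
  qed (use insert.prems(4) in auto)
  then show ?case
    using finite_dim_kernel_image[OF insert.prems(1) fp] insert.prems(3) by blast
qed

text \<open>Take the coordinate of \<open>x\<close> in a basis that extends
  \<open>{x}\<close>.\<close>

lemma nonzero_functional:
  fixes x :: "'a::complex_vector"
  assumes "x \<noteq> 0"
  obtains f :: "'a \<Rightarrow> complex" where "\<And>y z. f (y + z) = f y + f z" "\<And>c y. f (c *\<^sub>C y) = c * f y"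
    "f x = 1"
proof -
  have ind: "complex_vector.independent {x}" using assms by simp
  let ?B = "complex_vector.extend_basis {x}"
  have B: "complex_vector.independent ?B" "{x} \<subseteq> ?B" "\<And>y. y \<in> cspan ?B"
    using complex_vector.extend_basis_superset[OF ind] complex_vector.independent_extend_basis[OF ind]
      complex_vector.span_extend_basis[OF ind] by auto
  show ?thesis
    by (rule that[of "\<lambda>y. complex_vector.representation ?B y x"])
      (use B in \<open>auto simp: complex_vector.representation_add complex_vector.representation_scale
        complex_vector.representation_basis\<close>)
qed

section \<open>Graded vector spaces\<close>

context
  fixes G :: "'i \<Rightarrow> 'a::complex_vector set" and W :: "'a set"
  assumes G: "direct_sum G W"
begin

lemma graded_subspace: "csubspace W" and graded_piece_subspace: "csubspace (G i)"
  and graded_piece_subset: "G i \<subseteq> W"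
  using G by (auto simp: direct_sum_def)

lemma decomposition_hcomp: "x \<in> W \<Longrightarrow> decomposition G x (hcomp G x)"
  unfolding hcomp_def using G theI'[of "decomposition G x"] by (auto simp: direct_sum_def)

lemma hcomp_unique:
  assumes "decomposition G x f"
  shows "hcomp G x = f"
proof -
  have "x \<in> W"
    using assms csubspace_Sum_any[OF graded_subspace, of f] graded_piece_subset
    by (auto simp: decomposition_def)
  then show ?thesis
    using assms decomposition_hcomp[of x] G by (auto simp: direct_sum_def)
qed

lemma hcomp_in: "x \<in> W \<Longrightarrow> hcomp G x i \<in> G i"
  and finite_hcomp: "x \<in> W \<Longrightarrow> finite {i. hcomp G x i \<noteq> 0}"
  and Sum_any_hcomp: "x \<in> W \<Longrightarrow> Sum_any (hcomp G x) = x"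
  using decomposition_hcomp[of x] by (auto simp: decomposition_def)

lemma hcomp_homogeneous:
  assumes "x \<in> G i"
  shows "hcomp G x j = (if j = i then x else 0)"
proof -
  have "decomposition G x (\<lambda>j. if j = i then x else 0)"
    using assms csubspace_0[OF graded_piece_subspace]
    by (auto simp: decomposition_def)
  then show ?thesis using hcomp_unique by simp
qed

lemma hcomp_add:
  assumes "x \<in> W" "y \<in> W"
  shows "hcomp G (x + y) i = hcomp G x i + hcomp G y i"
proof -
  have "decomposition G (x + y) (\<lambda>i. hcomp G x i + hcomp G y i)"
    unfolding decomposition_def
  proof (intro conjI allI)
    show "finite {i. hcomp G x i + hcomp G y i \<noteq> 0}"
      by (rule finite_subset[OF _ finite_UnI[OF finite_hcomp[OF assms(1)] finite_hcomp[OF assms(2)]]])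
        auto
  qed (use assms in \<open>simp_all add: hcomp_in csubspace_add[OF graded_piece_subspace] finite_hcomp
      Sum_any_hcomp Sum_any.distrib\<close>)
  then show ?thesis using hcomp_unique by simp
qed

lemma hcomp_scale:
  assumes "x \<in> W"
  shows "hcomp G (c *\<^sub>C x) i = c *\<^sub>C hcomp G x i"
proof -
  have "clinear_on UNIV (\<lambda>x::'a. c *\<^sub>C x)"
    by (auto simp: clinear_on_def scaleC_add_right scaleC_scaleC mult.commute)
  from clinear_on_Sum_any[OF this, of "hcomp G x"] assms
  have "Sum_any (\<lambda>i. c *\<^sub>C hcomp G x i) = c *\<^sub>C x"
    by (simp add: Sum_any_hcomp finite_hcomp)
  moreover have "finite {i. c *\<^sub>C hcomp G x i \<noteq> 0}"
    by (rule finite_subset[OF _ finite_hcomp[OF assms]]) auto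
  ultimately have "decomposition G (c *\<^sub>C x) (\<lambda>i. c *\<^sub>C hcomp G x i)"
    using assms by (simp add: decomposition_def hcomp_in csubspace_scale[OF graded_piece_subspace])
  then show ?thesis using hcomp_unique by simp
qed

lemma clinear_on_hcomp: "clinear_on W (\<lambda>x. hcomp G x i)"
  by (simp add: clinear_on_def hcomp_add hcomp_scale)

lemma hcomp_concentrated:
  assumes "x \<in> W" "\<And>j. j \<noteq> i \<Longrightarrow> hcomp G x j = 0"
  shows "x = hcomp G x i"
  using Sum_any_hcomp[OF assms(1)] Sum_any_single[of i "hcomp G x"] assms(2) by simp

text \<open>On a homogeneous generator the projection is the identity or 0.\<close>

lemma hcomp_span:
  assumes "x \<in> cspan Y" "Y \<subseteq> (\<Union>i. G i)"
  shows "hcomp G x i \<in> cspan (Y \<inter> G i)"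
proof (rule clinear_on_span[OF clinear_on_hcomp graded_subspace _ _ _ assms(1)])
  show "Y \<subseteq> W" using assms(2) graded_piece_subset by blast
next
  fix y assume y: "y \<in> Y"
  then obtain j where "y \<in> G j" using assms(2) by blast
  then show "hcomp G y i \<in> cspan (Y \<inter> G i)"
    using y hcomp_homogeneous[of y j i]
    by (auto intro: complex_vector.span_base complex_vector.span_zero)
qed (rule complex_vector.subspace_span)

text \<open>Applying \<open>A\<close> piecewise to the decomposition of \<open>x\<close> yields a
  decomposition of \<open>c *\<^sub>C x\<close>, and uniqueness compares the two. With
  \<open>A\<close> equal to L_0 this turns eigenvalues into weights in \<open>V\<close> and into
  degrees in \<open>M3\<close>.\<close>

lemma hcomp_eigenvector:
  fixes ev :: "'i \<Rightarrow> complex"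
  assumes A: "clinear_on W A" and eig: "\<And>j y. y \<in> G j \<Longrightarrow> A y = ev j *\<^sub>C y"
    and x: "x \<in> W" "A x = c *\<^sub>C x" and "ev i \<noteq> c"
  shows "hcomp G x i = 0"
proof -
  have hW: "hcomp G x j \<in> W" for j using hcomp_in[OF x(1)] graded_piece_subset by blast
  have "A (Sum_any (hcomp G x)) = Sum_any (\<lambda>j. A (hcomp G x j))"
    using hW finite_hcomp[OF x(1)] by (intro clinear_on_Sum_any[OF A graded_subspace]) auto
  then have "A x = Sum_any (\<lambda>j. ev j *\<^sub>C hcomp G x j)"
    using x eig[OF hcomp_in] by (simp add: Sum_any_hcomp)
  moreover have "finite {j. ev j *\<^sub>C hcomp G x j \<noteq> 0}"
    by (rule finite_subset[OF _ finite_hcomp[OF x(1)]]) auto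
  ultimately have "decomposition G (c *\<^sub>C x) (\<lambda>j. ev j *\<^sub>C hcomp G x j)"
    using x by (simp add: decomposition_def hcomp_in csubspace_scale[OF graded_piece_subspace])
  from hcomp_unique[OF this] hcomp_scale[OF x(1)]
  have "c *\<^sub>C hcomp G x i = ev i *\<^sub>C hcomp G x i" by metis
  then show ?thesis using assms(5) by (auto simp: complex_vector.scale_cancel_right)
qed

end

section \<open>Weights and sectors\<close>

lemma one_gchoose: "j \<ge> 2 \<Longrightarrow> ((1::complex) gchoose j) = 0"
  using binomial_gbinomial[of 1 j, where 'a=complex] by (simp add: binomial_eq_0)

lemma zero_gchoose: "((0::complex) gchoose j) = (if j = 0 then 1 else 0)"
  by (cases j) auto

lemma Sum_any_one_gchoose:
  fixes f :: "nat \<Rightarrow> 'a::complex_vector"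
  shows "Sum_any (\<lambda>j. ((1::complex) gchoose j) *\<^sub>C f j) = f 0 + f 1"
proof -
  have "Sum_any (\<lambda>j. ((1::complex) gchoose j) *\<^sub>C f j) = (\<Sum>j\<in>{0,1}. ((1::complex) gchoose j) *\<^sub>C f j)"
  proof (rule Sum_any.expand_superset)
    have "a \<in> {0, 1}" if "((1::complex) gchoose a) *\<^sub>C f a \<noteq> 0" for a
      using that one_gchoose[of a] by (cases "a \<ge> 2") auto
    then show "{a. ((1::complex) gchoose a) *\<^sub>C f a \<noteq> 0} \<subseteq> {0, 1}" by blast
  qed auto
  then show ?thesis by (simp add: scaleC_one)
qed

lemma Sum_any_zero_gchoose:
  fixes f :: "nat \<Rightarrow> 'a::complex_vector"
  shows "Sum_any (\<lambda>j. ((-1) ^ j * ((0::complex) gchoose j)) *\<^sub>C f j) = f 0"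
  by (subst Sum_any_single[of 0]) (auto simp: zero_gchoose scaleC_one)

section \<open>Weights of products, from the commutator with L_0\<close>

context vertex_operator_algebra
begin

lemma VY_0_left [simp]: "VY V 0 n c = 0" and VY_0_right [simp]: "VY V a n 0 = 0"
  using VY_scale_left[of 0 0 n c] VY_scale_right[of a n 0 0] by auto

lemma clinear_on_VY: "clinear_on UNIV (VY V a n)"
  by (simp add: clinear_on_def VY_add_right VY_scale_right)

lemma conf_1_VY_nonneg:
  assumes "n \<ge> 0"
  shows "VY V (conf V) 1 (VY V a n b)
    = VY V a n (VY V (conf V) 1 b) + VY V (Vir V (-1) a) (n + 1) b + VY V (Vir V 0 a) n b"
proof -
  have "VY V (VY V (conf V) 0 a) (1 + n) b + VY V (VY V (conf V) 1 a) n b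
    = VY V (conf V) 1 (VY V a n b) - VY V a n (VY V (conf V) 1 b)"
    using Borcherds[where m = 1 and a = "conf V" and n = 0 and b = a and k = "nat n" and c = b] assms
    by (simp add: Sum_any_one_gchoose Sum_any_zero_gchoose scaleC_one)
  then show ?thesis
    by (simp add: Vir_def algebra_simps)
qed

text \<open>The axiom \<open>Borcherds\<close> is stated for \<open>k \<ge> 0\<close> only (there \<open>k\<close> is a natural number), so the
  commutator of \<open>L\<^sub>0\<close> with \<open>a\<^sub>(\<^sub>-\<^sub>1\<^sub>)\<close> is obtained with the roles of \<open>a\<close> and the conformal vector
  exchanged, and skew symmetry turns \<open>a\<^sub>(\<^sub>j\<^sub>) \<omega>\<close> back into \<open>\<omega>\<^sub>(\<^sub>j\<^sub>) a\<close>.\<close>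

lemma VY_creation_negative:
  "VY V (VY V y (- 1 - int i) (vac V)) p c = ((-1) ^ i * ((of_int p :: complex) gchoose i)) *\<^sub>C VY V y (p - int i) c"
proof (induction i arbitrary: y)
  case 0
  then show ?case by (simp add: creation scaleC_one)
next
  case (Suc i)
  let ?y = "VY V y (- 1 - int (Suc i)) (vac V)"
  \<comment> \<open>The vector y_(-1-i) vac is the divided power L_(-1)^i y / i!, so the derivative
    axiom lowers the index by one at each step.\<close>
  have "VY V (Vir V (-1) y) (- 1 - int i) (vac V) = of_nat (Suc i) *\<^sub>C ?y"
    unfolding L_minus1_derivative by (simp add: algebra_simps)
  then have "of_nat (Suc i) *\<^sub>C VY V ?y p c
    = VY V (VY V (Vir V (-1) y) (- 1 - int i) (vac V)) p c"
    by (simp only: VY_scale_left)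
  also have "\<dots> = ((-1) ^ i * (of_int p gchoose i) * (- of_int (p - int i))) *\<^sub>C VY V y (p - int (Suc i)) c"
    by (subst Suc.IH) (simp add: L_minus1_derivative scaleC_scaleC algebra_simps)
  also have "(-1) ^ i * (of_int p gchoose i) * (- of_int (p - int i))
      = (of_nat (Suc i) :: complex) * ((-1) ^ Suc i * (of_int p gchoose Suc i))"
  proof -
    have "(of_int p - of_nat i :: complex) * (of_int p gchoose i) = of_nat (Suc i) * (of_int p gchoose Suc i)"
      using gbinomial_mult_1[of "of_int p :: complex" i] by (simp add: algebra_simps)
    moreover have "(-1) ^ i * (of_int p gchoose i) * (- of_int (p - int i))
      = - ((-1) ^ i * ((of_int p - of_nat i :: complex) * (of_int p gchoose i)))" by (simp add: algebra_simps)
    ultimately show ?thesis by simp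
  qed
  finally have "of_nat (Suc i) *\<^sub>C VY V ?y p c
    = of_nat (Suc i) *\<^sub>C (((-1) ^ Suc i * (of_int p gchoose Suc i)) *\<^sub>C VY V y (p - int (Suc i)) c)"
    by (simp add: scaleC_scaleC)
  then show ?case
    by (metis complex_vector.scale_left_imp_eq of_nat_neq_0)
qed

text \<open>In Borcherds' identity for m = -1, k = 0 on the vacuum, creation kills one family of
  double products and leaves only b_(n) a of the other. As y_(-1-i) vac is L_(-1)^i y / i!, this is
  skew symmetry with the exponential of z L_(-1) written out.\<close>

lemma skew_symmetry_vac:
  "VY V b (int n) a = - ((-1) ^ n) *\<^sub>C
    Sum_any (\<lambda>i. (-1) ^ i *\<^sub>C VY V (VY V a (int (n + i)) b) (- 1 - int i) (vac V))"
proof -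
  have m1: "((-1::complex) gchoose i) = (-1) ^ i" for i
    using gbinomial_minus[of "1::complex" i] gbinomial_of_nat_symmetric[of i i, where 'a=complex]
    by (simp add: binomial_gbinomial[symmetric])
  have "Sum_any (\<lambda>j. ((-1) ^ j * ((of_int (int n) :: complex) gchoose j)) *\<^sub>C
          VY V b (int n - int j) (VY V a (-1 + int j) (vac V))) = VY V b (int n) a"
  proof (subst Sum_any_single[of 0])
    fix j :: nat assume "j \<noteq> 0"
    then show "((-1) ^ j * ((of_int (int n) :: complex) gchoose j)) *\<^sub>C
          VY V b (int n - int j) (VY V a (-1 + int j) (vac V)) = 0"
      by (simp add: creation)
  qed (simp add: creation scaleC_one)
  then have "Sum_any (\<lambda>i. (-1) ^ i *\<^sub>C VY V (VY V a (int (n + i)) b) (- 1 - int i) (vac V))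
     = - ((-1) ^ n *\<^sub>C VY V b (int n) a)"
    using Borcherds[where m = "-1" and a = a and n = "int n" and b = b and k = 0 and c = "vac V"]
    by (simp add: m1 creation(2))
  then show ?thesis
    by (simp add: scaleC_scaleC power_mult_distrib[symmetric] scaleC_one)
qed

lemma skew_symmetry:
  assumes "\<And>j. j \<ge> N \<Longrightarrow> VY V a (int j) b = 0"
  shows "VY V (VY V b (int n) a) p c = - ((-1) ^ n) *\<^sub>C
    (\<Sum>i<N - n. ((of_int p :: complex) gchoose i) *\<^sub>C VY V (VY V a (int (n + i)) b) (p - int i) c)"
proof -
  have "Sum_any (\<lambda>i. (-1) ^ i *\<^sub>C VY V (VY V a (int (n + i)) b) (- 1 - int i) (vac V))
    = (\<Sum>i<N - n. (-1) ^ i *\<^sub>C VY V (VY V a (int (n + i)) b) (- 1 - int i) (vac V))"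
    using assms by (intro Sum_any_nat) (simp del: of_nat_add)
  then have eq: "VY V b (int n) a = - ((-1) ^ n) *\<^sub>C
    (\<Sum>i<N - n. (-1) ^ i *\<^sub>C VY V (VY V a (int (n + i)) b) (- 1 - int i) (vac V))"
    using skew_symmetry_vac[of b n a] by simp
  have lin: "clinear_on UNIV (\<lambda>x. VY V x p c)"
    by (simp add: clinear_on_def VY_add_left VY_scale_left)
  show ?thesis
    unfolding eq VY_scale_left clinear_on_sum[OF lin, OF complex_vector.subspace_UNIV UNIV_I]
      VY_creation_negative scaleC_scaleC
    by (simp add: mult.assoc[symmetric] power_mult_distrib[symmetric])
qed

text \<open>The value is the binomial coefficient of 1 over \<open>s\<close>. The sum is the
  coefficient of (\<omega>_(s) a)_(-s) after every a_(j) \<omega> has been rewritten by skew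
  symmetry, and the commutator formula for L_0 = \<omega>_(1) predicts this value. Reflecting the
  upper index turns the sum into an alternating row of Pascal's triangle.\<close>

lemma gbinomial_triangle_sum:
  "(\<Sum>j\<le>s. (of_int (- int j) :: complex) gchoose (s - j)) = (if s \<le> 1 then 1 else 0)"
proof (cases "s = 0")
  case False
  have "(\<Sum>j\<le>s. (of_int (- int j) :: complex) gchoose (s - j))
    = (\<Sum>j\<le>s. (-1) ^ (s - j) * of_nat ((s - 1) choose (s - j)))"
  proof (rule sum.cong)
    fix j assume "j \<in> {..s}"
    then have "(of_nat j + of_nat (s - j) - 1 :: complex) = of_nat (s - 1)"
      using False by (simp add: of_nat_diff)
    then show "((of_int (- int j) :: complex) gchoose (s - j)) = (-1) ^ (s - j) * of_nat ((s - 1) choose (s - j))"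
      using gbinomial_minus[of "of_nat j :: complex" "s - j"] by (simp add: binomial_gbinomial)
  qed simp
  also have "\<dots> = (\<Sum>t\<le>s. (-1) ^ t * of_nat ((s - 1) choose t))"
    by (rule sum.reindex_bij_witness[of _ "\<lambda>t. s - t" "\<lambda>t. s - t"]) auto
  also have "\<dots> = (\<Sum>t\<le>s - 1. (-1) ^ t * of_nat ((s - 1) choose t))"
    using False by (cases s) auto
  also have "\<dots> = (if s \<le> 1 then 1 else 0)"
    using choose_alternating_sum[of "s - 1", where 'a=complex] by (cases "s = 1") auto
  finally show ?thesis .
qed simp

lemma conf_1_VY_minus1:
  "VY V (conf V) 1 (VY V a (-1) b)
   = VY V a (-1) (VY V (conf V) 1 b) + VY V (Vir V (-1) a) 0 b + VY V (Vir V 0 a) (-1) b"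
proof -
  let ?\<omega> = "conf V"
  obtain N0 where N0: "\<And>n. n \<ge> N0 \<Longrightarrow> VY V ?\<omega> n a = 0" using truncation by blast
  obtain N1 where N1: "\<And>n. n \<ge> N1 \<Longrightarrow> VY V a n ?\<omega> = 0" using truncation by blast
  define N where "N = nat (max (max N0 N1) 2)"
  have N: "VY V ?\<omega> (int j) a = 0" "VY V a (int j) ?\<omega> = 0" if "j \<ge> N" for j
    using that N0[of "int j"] N1[of "int j"] by (auto simp: N_def)
  have N2: "2 \<le> N" by (simp add: N_def)
  have m1: "((-1::complex) gchoose i) = (-1) ^ i" for i
    using gbinomial_minus[of "1::complex" i] by (simp add: binomial_gbinomial[symmetric])
  let ?t = "\<lambda>s. VY V (VY V ?\<omega> (int s) a) (- int s) b"
  have "VY V a (-1) (VY V ?\<omega> 1 b) - VY V ?\<omega> 1 (VY V a (-1) b)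
    = Sum_any (\<lambda>j. (-1) ^ j *\<^sub>C VY V (VY V a (int j) ?\<omega>) (- int j) b)"
    using Borcherds[where m = "-1" and a = a and n = 0 and b = ?\<omega> and k = 1 and c = b]
    by (simp add: Sum_any_zero_gchoose scaleC_one m1)
  also have "\<dots> = (\<Sum>j<N. (-1) ^ j *\<^sub>C VY V (VY V a (int j) ?\<omega>) (- int j) b)"
    by (rule Sum_any_nat) (simp add: N)
  also have "\<dots> = (\<Sum>j<N. - (\<Sum>i<N - j. ((of_int (- int j) :: complex) gchoose i) *\<^sub>C ?t (j + i)))"
  proof (rule sum.cong)
    fix j assume "j \<in> {..<N}"
    have "VY V (VY V a (int j) ?\<omega>) (- int j) b = - ((-1) ^ j) *\<^sub>C
      (\<Sum>i<N - j. ((of_int (- int j) :: complex) gchoose i) *\<^sub>C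
        VY V (VY V ?\<omega> (int (j + i)) a) (- int j - int i) b)"
      by (rule skew_symmetry) (rule N(1))
    moreover have "- int j - int i = - int (j + i)" for i by simp
    ultimately have "VY V (VY V a (int j) ?\<omega>) (- int j) b = - ((-1) ^ j) *\<^sub>C
      (\<Sum>i<N - j. ((of_int (- int j) :: complex) gchoose i) *\<^sub>C ?t (j + i))"
      by (simp only:)
    then show "(-1) ^ j *\<^sub>C VY V (VY V a (int j) ?\<omega>) (- int j) b
      = - (\<Sum>i<N - j. ((of_int (- int j) :: complex) gchoose i) *\<^sub>C ?t (j + i))"
      by (simp add: scaleC_scaleC power_mult_distrib[symmetric] scaleC_one del: of_nat_add)
  qed simp
  also have "\<dots> = - (\<Sum>(j, i)\<in>Sigma {..<N} (\<lambda>j. {..<N - j}). ((of_int (- int j) :: complex) gchoose i) *\<^sub>C ?t (j + i))"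
    by (simp add: sum_negf sum.Sigma)
  \<comment> \<open>Regrouping by s = j + i collects all multiples of the same \<omega>_(s)
    a.\<close>
  also have "Sigma {..<N} (\<lambda>j. {..<N - j}) = {(j, i). j + i < N}" by auto
  also have "(\<Sum>(j, i)\<in>{(j, i). j + i < N}. ((of_int (- int j) :: complex) gchoose i) *\<^sub>C ?t (j + i))
     = (\<Sum>s<N. (\<Sum>j\<le>s. (of_int (- int j) :: complex) gchoose (s - j)) *\<^sub>C ?t s)"
    unfolding sum.triangle_reindex complex_vector.scale_sum_left by (intro sum.cong) auto
  also have "\<dots> = (\<Sum>s<N. if s \<le> 1 then ?t s else 0)"
    unfolding gbinomial_triangle_sum by (intro sum.cong) (auto simp: scaleC_one)
  also have "\<dots> = (\<Sum>s\<in>{0,1}. ?t s)"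
    using N2 by (intro sum.mono_neutral_cong_right) (auto simp: le_Suc_eq)
  finally show ?thesis
    by (simp add: Vir_def algebra_simps)
qed

lemma conf_1_VY:
  assumes "n \<ge> -1"
  shows "VY V (conf V) 1 (VY V a n b)
    = VY V a n (VY V (conf V) 1 b) + VY V (Vir V (-1) a) (n + 1) b + VY V (Vir V 0 a) n b"
  using conf_1_VY_nonneg[of n a b] conf_1_VY_minus1[of a b] assms by (cases "n = -1") auto

lemma conf_1_VGr: "a \<in> VGr V k \<Longrightarrow> VY V (conf V) 1 a = of_nat k *\<^sub>C a"
  using L0_VGr[of a k] by (simp add: Vir_def)

lemma conf_1_VY_homogeneous:
  assumes "n \<ge> -1" "a \<in> VGr V k" "b \<in> VGr V l"
  shows "VY V (conf V) 1 (VY V a n b) = of_int (int k + int l - n - 1) *\<^sub>C VY V a n b"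
proof -
  have "VY V (conf V) 1 (VY V a n b)
    = of_nat l *\<^sub>C VY V a n b + (- of_int (n + 1)) *\<^sub>C VY V a n b + of_nat k *\<^sub>C VY V a n b"
    unfolding conf_1_VY[OF assms(1)] conf_1_VGr[OF assms(3)] L0_VGr[OF assms(2)] VY_scale_left VY_scale_right
      L_minus1_derivative by simp
  also have "\<dots> = (of_nat l + (- of_int (n + 1)) + of_nat k) *\<^sub>C VY V a n b"
    by (simp only: scaleC_add_left)
  also have "(of_nat l + (- of_int (n + 1)) + of_nat k :: complex) = of_int (int k + int l - n - 1)"
    by simp
  finally show ?thesis .
qed

lemma L0_eigenvector:
  assumes "VY V (conf V) 1 x = c *\<^sub>C x" "c \<noteq> of_nat i"
  shows "hcomp (VGr V) x i = 0"
  using hcomp_eigenvector[where ev = of_nat, OF grading clinear_on_VY conf_1_VGr _ assms(1)] assms(2)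
  by (metis UNIV_I)

lemma VGr_subspace: "csubspace (VGr V k)"
  using graded_piece_subspace[OF grading] .

lemma VY_VGr_aux:
  assumes "n \<ge> -1" "a \<in> VGr V k" "b \<in> VGr V l" "int i = int k + int l - n - 1"
  shows "VY V a n b \<in> VGr V i"
proof -
  have "hcomp (VGr V) (VY V a n b) j = 0" if "j \<noteq> i" for j
    by (rule L0_eigenvector[OF conf_1_VY_homogeneous[OF assms(1-3)]])
      (use that assms(4) in \<open>metis of_int_eq_iff of_int_of_nat_eq of_nat_eq_iff\<close>)
  then have "VY V a n b = hcomp (VGr V) (VY V a n b) i"
    by (intro hcomp_concentrated[OF grading]) auto
  then show ?thesis using hcomp_in[OF grading] by (metis UNIV_I)
qed

lemma VY_VGr:
  assumes "n \<ge> -2" "a \<in> VGr V k" "b \<in> VGr V l" "int i = int k + int l - n - 1"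
  shows "VY V a n b \<in> VGr V i"
proof (cases "n = -2")
  case True
  \<comment> \<open>By the derivative axiom a_(-2) is (L_(-1) a)_(-1). This extends the range by the
    one index that C_2(V) requires.\<close>
  have "Vir V (-1) a \<in> VGr V (Suc k)"
    unfolding Vir_def using VY_VGr_aux[OF _ conf_VGr assms(2)] by simp
  then have "VY V (Vir V (-1) a) (-1) b \<in> VGr V i"
    using VY_VGr_aux[of "-1" _ "Suc k" b l i] assms True by simp
  then show ?thesis
    using True by (simp add: L_minus1_derivative scaleC_one)
qed (use VY_VGr_aux[OF _ assms(2-4)] assms(1) in auto)

text \<open>The product would be an L_0-eigenvector whose eigenvalue is a negative integer, and no
  such weight occurs.\<close>

lemma VY_negative_weight:
  assumes "a \<in> VGr V k" "b \<in> VGr V l" "int k + int l - n - 1 < 0"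
  shows "VY V a n b = 0"
proof -
  have n: "n \<ge> -1" using assms(3) by simp
  have "hcomp (VGr V) (VY V a n b) j = 0" for j
  proof (rule L0_eigenvector[OF conf_1_VY_homogeneous[OF n assms(1,2)]])
    have "int k + int l - n - 1 \<noteq> int j" using assms(3) by simp
    then show "(of_int (int k + int l - n - 1) :: complex) \<noteq> of_nat j"
      by (metis of_int_eq_iff of_int_of_nat_eq)
  qed
  then show ?thesis
    using Sum_any_hcomp[OF grading, of "VY V a n b"] by simp
qed

lemma VGr_unique: "a \<in> VGr V k \<Longrightarrow> a \<in> VGr V l \<Longrightarrow> a \<noteq> 0 \<Longrightarrow> k = l"
  using hcomp_homogeneous[OF grading, of a k l] hcomp_homogeneous[OF grading, of a l l]
  by (auto split: if_splits)

end

section \<open>Roots of unity, and simultaneous eigenvectors of L_0 and the automorphism\<close>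

definition root_exp :: "nat \<Rightarrow> nat \<Rightarrow> complex" where
  "root_exp T r = exp (2 * of_real pi * \<i> * of_nat r / of_nat T)"

lemma sector_root_exp: "a \<in> sector g T r \<longleftrightarrow> g a = root_exp T r *\<^sub>C a"
  by (simp add: sector_def root_exp_def)

lemma root_exp_add: "root_exp T (r + s) = root_exp T r * root_exp T s"
  unfolding root_exp_def exp_add[symmetric] by (simp add: distrib_left add_divide_distrib)

lemma root_exp_power: "root_exp T (n * r) = root_exp T r ^ n"
  by (induction n) (simp_all add: root_exp_add, simp add: root_exp_def)

lemma root_exp_self [simp]: "root_exp T T = 1"
  by (cases "T = 0") (simp_all add: root_exp_def)

lemma root_exp_mod: "root_exp T (r mod T) = root_exp T r"
proof -
  have "root_exp T r = root_exp T (r div T * T + r mod T)" by simp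
  also have "\<dots> = root_exp T (r mod T)"
    unfolding root_exp_add root_exp_power by simp
  finally show ?thesis by simp
qed

lemma root_exp_pow_T: "root_exp T r ^ T = 1"
  using root_exp_power[of T r T] root_exp_power[of T T r] by (simp add: mult.commute)

lemma root_exp_nonzero [simp]: "root_exp T r \<noteq> 0"
  by (simp add: root_exp_def)

lemma root_exp_cis: "root_exp T r = cis (2 * pi * real r / real T)"
  by (simp add: root_exp_def cis_conv_exp mult.commute mult.left_commute)

lemma root_exp_neq_1: "0 < i \<Longrightarrow> i < T \<Longrightarrow> root_exp T i \<noteq> 1"
  using bij_betw_roots_unity[of T] unfolding bij_betw_def inj_on_def root_exp_cis
  by (metis (no_types, lifting) cis_zero div_0 lessThan_iff mult_zero_right neq0_conv of_nat_0 order_less_trans)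

lemma root_exp_sum:
  assumes "0 < i" "i < T"
  shows "(\<Sum>r<T. root_exp T r ^ i) = 0"
proof -
  have "(\<Sum>r<T. root_exp T r ^ i) = (\<Sum>r<T. root_exp T i ^ r)"
    by (simp add: root_exp_power[symmetric] mult.commute)
  also have "\<dots> = 0"
    using geometric_sum[OF root_exp_neq_1[OF assms]] by (simp add: root_exp_pow_T)
  finally show ?thesis .
qed

locale twisted_voa = vertex_operator_algebra V
  for V :: "'v::complex_vector voa" +
  fixes g :: "'v \<Rightarrow> 'v" and T :: nat
  assumes aut: "voa_automorphism V g" and T_pos: "0 < T" and period: "g ^^ T = id"
begin

lemma clinear_on_g: "clinear_on UNIV g"
  using aut by (auto simp: voa_automorphism_def Vector_Spaces.linear_iff clinear_on_def)

lemma g_VY: "g (VY V a n b) = VY V (g a) n (g b)" and g_conf: "g (conf V) = conf V"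
  using aut by (auto simp: voa_automorphism_def)

lemma g_scale: "g (c *\<^sub>C a) = c *\<^sub>C g a" and g_0 [simp]: "g 0 = 0"
  using clinear_on_scale[OF clinear_on_g] clinear_on_0[OF clinear_on_g] by auto

text \<open>Since \<open>g\<close> fixes the conformal vector it commutes with L_0.\<close>

lemma g_VGr:
  assumes "a \<in> VGr V k"
  shows "g a \<in> VGr V k"
proof -
  have "VY V (conf V) 1 (g a) = of_nat k *\<^sub>C g a"
    using g_VY[of "conf V" 1 a] conf_1_VGr[OF assms] by (simp add: g_conf g_scale)
  from L0_eigenvector[OF this] have "hcomp (VGr V) (g a) i = 0" if "i \<noteq> k" for i
    using that by simp
  then have "g a = hcomp (VGr V) (g a) k"
    by (intro hcomp_concentrated[OF grading]) auto
  then show ?thesis using hcomp_in[OF grading] by (metis UNIV_I)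
qed

lemma VY_sector:
  assumes "a \<in> sector g T r" "b \<in> sector g T s"
  shows "VY V a n b \<in> sector g T ((r + s) mod T)"
  using assms unfolding sector_root_exp
  by (simp add: g_VY VY_scale_left VY_scale_right scaleC_scaleC root_exp_mod root_exp_add)

text \<open>Both kinds of homogeneity are needed at once: the twisted identities are stated for
  sectors, whereas the filtration and the degrees count weights.\<close>

definition homs :: "nat \<Rightarrow> 'v set" where
  "homs k = {a \<in> VGr V k. \<exists>r<T. a \<in> sector g T r}"

lemma homs_VGr: "a \<in> homs k \<Longrightarrow> a \<in> VGr V k"
  by (simp add: homs_def)

lemma VY_homs:
  assumes "n \<ge> -2" "a \<in> homs k" "b \<in> homs l" "int i = int k + int l - n - 1"
  shows "VY V a n b \<in> homs i"
  using assms VY_VGr[of n a k b l i] VY_sector T_pos unfolding homs_def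
  by (blast intro: mod_less_divisor)

text \<open>This is a discrete Fourier transform. \<open>P r\<close> is \<open>T\<close> times the
  projection of \<open>a\<close> to the sector \<open>r\<close>, and orthogonality of roots of unity
  leaves only the term i = 0 in the sum over all \<open>r\<close>.\<close>

lemma VGr_span_homs:
  assumes a: "a \<in> VGr V k"
  shows "a \<in> cspan (homs k)"
proof -
  have gi: "(g ^^ i) a \<in> VGr V k" for i
    by (induction i) (simp_all add: a g_VGr)
  define P where "P r = (\<Sum>i<T. inverse (root_exp T r) ^ i *\<^sub>C (g ^^ i) a)" for r
  have P_sector: "P r \<in> sector g T r" for r
  proof -
    let ?\<omega> = "root_exp T r"
    have "g (P r) = (\<Sum>i<T. inverse ?\<omega> ^ i *\<^sub>C (g ^^ Suc i) a)"
      unfolding P_def using clinear_on_sum[OF clinear_on_g, of "{..<T}"]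
      by (simp add: g_scale)
    also have "\<dots> = ?\<omega> *\<^sub>C (\<Sum>i<T. inverse ?\<omega> ^ Suc i *\<^sub>C (g ^^ Suc i) a)"
      by (simp add: complex_vector.scale_sum_right scaleC_scaleC mult.assoc[symmetric])
    also have "(\<Sum>i<T. inverse ?\<omega> ^ Suc i *\<^sub>C (g ^^ Suc i) a) = P r"
    proof -
      have "inverse ?\<omega> ^ T *\<^sub>C (g ^^ T) a = a"
        using root_exp_pow_T[of T r] period by (simp add: power_inverse scaleC_one)
      then have "(\<Sum>i<Suc T. inverse ?\<omega> ^ i *\<^sub>C (g ^^ i) a) = P r + a"
        by (simp add: P_def)
      moreover have "(\<Sum>i<Suc T. inverse ?\<omega> ^ i *\<^sub>C (g ^^ i) a)
          = a + (\<Sum>i<T. inverse ?\<omega> ^ Suc i *\<^sub>C (g ^^ Suc i) a)"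
        by (subst sum.lessThan_Suc_shift) (simp add: scaleC_one)
      ultimately show ?thesis by simp
    qed
    finally show ?thesis by (simp add: sector_root_exp)
  qed
  have "P r \<in> VGr V k" for r
    unfolding P_def using gi by (intro csubspace_sum VGr_subspace csubspace_scale) auto
  then have P_homs: "P r \<in> cspan (homs k)" if "r < T" for r
    using that P_sector[of r] by (auto simp: homs_def intro: complex_vector.span_base)
  have inv: "(\<Sum>r<T. inverse (root_exp T r) ^ i) = (if i = 0 then of_nat T else 0)" if "i < T" for i
  proof (cases "i = 0")
    case False
    have "inverse (root_exp T r) ^ i = root_exp T r ^ (T - i)" for r
      using root_exp_pow_T[of T r] that
        by (metis (no_types, lifting) inverse_unique less_imp_le_nat
          power_add power_inverse add_diff_inverse_nat not_le)
    then show ?thesis using root_exp_sum[of "T - i" T] that False by simp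
  qed simp
  have "(\<Sum>r<T. P r) = (\<Sum>i<T. (\<Sum>r<T. inverse (root_exp T r) ^ i) *\<^sub>C (g ^^ i) a)"
    unfolding P_def by (subst sum.swap) (simp add: complex_vector.scale_sum_left)
  also have "\<dots> = (\<Sum>i<T. if i = 0 then of_nat T *\<^sub>C a else 0)"
    by (rule sum.cong) (auto simp: inv)
  also have "\<dots> = of_nat T *\<^sub>C a" using T_pos by simp
  finally have "of_nat T *\<^sub>C a \<in> cspan (homs k)"
    using P_homs by (metis (no_types, lifting) complex_vector.span_sum lessThan_iff)
  then show ?thesis
    using T_pos csubspace_scale_iff[OF complex_vector.subspace_span, of "of_nat T" a] by simp
qed

lemma span_homs: "a \<in> cspan (\<Union>k. homs k)"
proof -
  have "hcomp (VGr V) a k \<in> cspan (\<Union>k. homs k)" for k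
    using VGr_span_homs[OF hcomp_in[OF grading, of a k]]
      complex_vector.span_mono[of "homs k" "\<Union>k. homs k"] by auto
  then show ?thesis
    using csubspace_Sum_any[OF complex_vector.subspace_span] Sum_any_hcomp[OF grading, of a]
    by (metis UNIV_I)
qed

lemma homs_linear_induct:
  assumes "clinear_on UNIV f" "csubspace W" "\<And>k b. b \<in> homs k \<Longrightarrow> f b \<in> W"
  shows "f a \<in> W"
  using clinear_on_span[OF assms(1) _ _ assms(2) _ span_homs, of a] assms(3) by auto

text \<open>The part of weight \<open>k\<close> of the usual generators of C_2(V), since c_(-2) d
  has weight i + l + 1.\<close>

definition C2_gens :: "nat \<Rightarrow> 'v set" where
  "C2_gens k = {VY V c (-2) d | c d i l. c \<in> homs i \<and> d \<in> homs l \<and> i + l + 1 = k}"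

text \<open>A finite complement of C_2(V) can be taken homogeneous, and projecting to weight
  \<open>k\<close> discards all generators of other weights. The pairs in \<open>B\<close> remember
  the weight for which a vector is used.\<close>

lemma homogeneous_C2_spanning:
  assumes "C2_cofinite V"
  obtains B where "finite B" "\<And>k b. (k, b) \<in> B \<Longrightarrow> b \<in> homs k"
    "\<And>k a. a \<in> homs k \<Longrightarrow> a \<in> cspan ({b. (k, b) \<in> B} \<union> C2_gens k)"
proof -
  obtain B0 where B0: "finite B0" "cspan (B0 \<union> {VY V a (-2) b | a b. True}) = UNIV"
    using assms unfolding C2_cofinite_def by blast
  have "B0 \<subseteq> cspan (\<Union>k. homs k)" using span_homs by blast
  from finite_subset_span[OF B0(1) this] obtain B1
    where B1: "finite B1" "B1 \<subseteq> (\<Union>k. homs k)" "B0 \<subseteq> cspan B1" .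
  define Y where "Y = B1 \<union> (\<Union>k. C2_gens k)"
  have C2: "VY V a (-2) b \<in> cspan Y" for a b
  proof (rule homs_linear_induct[where f = "\<lambda>a. VY V a (-2) b"])
    fix k c assume c: "c \<in> homs k"
    show "VY V c (-2) b \<in> cspan Y"
    proof (rule homs_linear_induct[where f = "VY V c (-2)"])
      fix l d assume "d \<in> homs l"
      then have "VY V c (-2) d \<in> Y" using c unfolding Y_def C2_gens_def by blast
      then show "VY V c (-2) d \<in> cspan Y" by (rule complex_vector.span_base)
    qed (auto simp: clinear_on_VY)
  qed (auto simp: clinear_on_def VY_add_left VY_scale_left)
  have "B0 \<subseteq> cspan Y"
    using B1(3) complex_vector.span_mono[of B1 Y] by (auto simp: Y_def)
  with C2 have "B0 \<union> {VY V a (-2) b | a b. True} \<subseteq> cspan Y" by blast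
  from complex_vector.span_minimal[OF this complex_vector.subspace_span] B0(2)
  have Y: "x \<in> cspan Y" for x by auto
  have C2_VGr: "C2_gens k \<subseteq> VGr V k" for k
  proof
    fix x assume "x \<in> C2_gens k"
    then obtain c d i l where "x = VY V c (-2) d" "c \<in> homs i" "d \<in> homs l" "i + l + 1 = k"
      unfolding C2_gens_def by blast
    then show "x \<in> VGr V k" using VY_VGr[of "-2" c i d l k] homs_VGr[of c i] homs_VGr[of d l] by simp
  qed
  have Y_hom: "Y \<subseteq> (\<Union>k. VGr V k)"
  proof
    fix y assume "y \<in> Y"
    then consider "y \<in> B1" | l where "y \<in> C2_gens l" unfolding Y_def by blast
    then have "\<exists>k. y \<in> VGr V k"
      by cases (use B1(2) homs_VGr C2_VGr in \<open>auto dest!: subsetD\<close>)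
    then show "y \<in> (\<Union>k. VGr V k)" by blast
  qed
  \<comment> \<open>The zero vector lies in every \<open>homs k\<close>, so it has to be left out
    for \<open>B\<close> to be finite.\<close>
  define B where "B = {(k, b). b \<in> B1 \<and> b \<noteq> 0 \<and> b \<in> homs k}"
  show ?thesis
  proof (rule that)
    have "inj_on snd B"
    proof (rule inj_onI, clarsimp simp: B_def)
      fix k l b assume "b \<noteq> 0" "b \<in> homs k" "b \<in> homs l"
      then show "k = l" using VGr_unique homs_VGr by metis
    qed
    moreover have "snd ` B \<subseteq> B1" by (auto simp: B_def)
    ultimately show "finite B" using B1(1) inj_on_finite by blast
    show "b \<in> homs k" if "(k, b) \<in> B" for k b using that by (simp add: B_def)
    fix k a assume "a \<in> homs k"
    then have "hcomp (VGr V) a k = a" using hcomp_homogeneous[OF grading homs_VGr] by simp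
    then have a: "a \<in> cspan (Y \<inter> VGr V k)"
      using hcomp_span[OF grading Y[of a] Y_hom, of k] by simp
    have "Y \<inter> VGr V k \<subseteq> insert 0 ({b. (k, b) \<in> B} \<union> C2_gens k)"
    proof
      fix y assume y: "y \<in> Y \<inter> VGr V k"
      show "y \<in> insert 0 ({b. (k, b) \<in> B} \<union> C2_gens k)"
      proof (cases "y = 0")
        case False
        have "y \<in> homs k" if "y \<in> homs l" for l
          using that y VGr_unique[of y k l] False homs_VGr[of y l] by simp
        then have "y \<in> homs k" if "y \<in> B1"
          using that B1(2) by blast
        moreover have "y \<in> C2_gens k" if "y \<in> C2_gens l" for l
          using that y VGr_unique[of y k l] False C2_VGr[of l] by auto
        ultimately show ?thesis using y False by (auto simp: Y_def B_def)
      qed simp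
    qed
    from complex_vector.span_mono[OF this] a
    show "a \<in> cspan ({b. (k, b) \<in> B} \<union> C2_gens k)"
      by (auto simp: complex_vector.span_insert_0)
  qed
qed

end

section \<open>Spanning sets of twisted modules\<close>

locale twisted_module = twisted_voa V g T
  for V :: "'v::complex_vector voa" and g T +
  fixes M :: "('v, 'm::complex_vector) vmod"
  assumes weak: "weak_twisted_module V g T M"
begin

lemmas weak_conjs = weak[unfolded weak_twisted_module_def]

lemma mcar_subspace: "csubspace (mcar M)"
  using weak_conjs by (elim conjE)

lemma mode_in: "u \<in> mcar M \<Longrightarrow> mode M a n u \<in> mcar M"
  using weak_conjs by (elim conjE) simp

lemma mode_add_left: "u \<in> mcar M \<Longrightarrow> mode M (a + b) n u = mode M a n u + mode M b n u"
  using weak_conjs by (elim conjE) simp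

lemma mode_scale_left: "u \<in> mcar M \<Longrightarrow> mode M (c *\<^sub>C a) n u = c *\<^sub>C mode M a n u"
  using weak_conjs by (elim conjE) simp

lemma clinear_on_mode: "clinear_on (mcar M) (mode M a n)"
  unfolding clinear_on_def using weak_conjs by (elim conjE) simp

lemma mode_truncation: "u \<in> mcar M \<Longrightarrow> \<exists>N. \<forall>n\<ge>N. mode M a n u = 0"
  using weak_conjs by (elim conjE) simp

lemma mode_vac: "u \<in> mcar M \<Longrightarrow> mode M (vac V) n u = (if n = -1 then u else 0)"
  using weak_conjs by (elim conjE) simp

lemma mode_sector:
  "r < T \<Longrightarrow> a \<in> sector g T r \<Longrightarrow> n - of_nat r / of_nat T \<notin> \<int> \<Longrightarrow> u \<in> mcar M \<Longrightarrow> mode M a n u = 0"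
  using weak_conjs by (elim conjE) simp

lemma mode_Borcherds:
  assumes "r < T" "a \<in> sector g T r" "s < T" "b \<in> sector g T s" "u \<in> mcar M"
    "m - of_nat r / of_nat T \<in> \<int>" "k - of_nat s / of_nat T \<in> \<int>"
  shows "Sum_any (\<lambda>j. ((of_rat m :: complex) gchoose j) *\<^sub>C
           mode M (VY V a (n + int j) b) (m + k - of_nat j) u)
        = Sum_any (\<lambda>j. ((-1) ^ j * ((of_int n :: complex) gchoose j)) *\<^sub>C
           mode M a (m + of_int n - of_nat j) (mode M b (k + of_nat j) u))
        - ((-1) powi n) *\<^sub>C
          Sum_any (\<lambda>j. ((-1) ^ j * ((of_int n :: complex) gchoose j)) *\<^sub>C
           mode M b (of_int n + k - of_nat j) (mode M a (m + of_nat j) u))"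
  by (rule weak_conjs[THEN conjunct2, THEN conjunct2, THEN conjunct2, THEN conjunct2, THEN conjunct2, THEN conjunct2, THEN conjunct2, THEN conjunct2, THEN conjunct2, rule_format, OF assms])

lemma mode_0_right [simp]: "mode M a n 0 = 0"
  using clinear_on_0[OF clinear_on_mode mcar_subspace] .

lemma clinear_on_mode_left: "u \<in> mcar M \<Longrightarrow> clinear_on UNIV (\<lambda>a. mode M a n u)"
  by (simp add: clinear_on_def mode_add_left mode_scale_left)

lemma mode_0_left [simp]: "u \<in> mcar M \<Longrightarrow> mode M 0 n u = 0"
  using clinear_on_0[OF clinear_on_mode_left] by simp

lemma mode_truncation_nat:
  assumes "u \<in> mcar M"
  shows "\<exists>N::nat. \<forall>j\<ge>N. mode M a (k + of_nat j) u = 0"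
proof -
  obtain N where N: "\<And>n. n \<ge> N \<Longrightarrow> mode M a n u = 0"
    using mode_truncation[OF assms] by blast
  obtain j0 :: nat where j0: "N - k \<le> of_nat j0" using real_arch_simple by blast
  have "mode M a (k + of_nat j) u = 0" if "j \<ge> j0" for j
  proof (rule N)
    have "(of_nat j0 :: rat) \<le> of_nat j" using that by simp
    then show "N \<le> k + of_nat j" using j0 by linarith
  qed
  then show ?thesis by blast
qed

lemma VY_truncation_nat: "\<exists>N::nat. \<forall>j\<ge>N. VY V a (n + int j) b = 0"
proof -
  obtain N where "\<And>n. n \<ge> N \<Longrightarrow> VY V a n b = 0" using truncation by blast
  then have "VY V a (n + int j) b = 0" if "j \<ge> nat (N - n)" for j
    using that by (simp add: nat_le_iff)
  then show ?thesis by blast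
qed

text \<open>Borcherds' identity for n = 0. Indices outside the right cosets are harmless because
  both products vanish there.\<close>

lemma mode_commutator_in:
  assumes ab: "r < T" "a \<in> sector g T r" "s < T" "b \<in> sector g T s" and u: "u \<in> mcar M"
    and W: "csubspace W" and prods: "\<And>j n. mode M (VY V a (int j) b) n u \<in> W"
  shows "mode M a m (mode M b k u) - mode M b k (mode M a m u) \<in> W"
proof (cases "m - of_nat r / of_nat T \<in> \<int> \<and> k - of_nat s / of_nat T \<in> \<int>")
  case True
  have "Sum_any (\<lambda>j. ((of_rat m :: complex) gchoose j) *\<^sub>C
           mode M (VY V a (0 + int j) b) (m + k - of_nat j) u) \<in> W"
    using prods by (intro csubspace_Sum_any[OF W] csubspace_scale[OF W]) simp
  then show ?thesis
    unfolding mode_Borcherds[OF ab u conjunct1[OF True] conjunct2[OF True]]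
    by (simp add: Sum_any_zero_gchoose scaleC_one)
next
  case False
  then have "mode M a m (mode M b k u) - mode M b k (mode M a m u) = 0"
    using mode_sector[OF ab(1,2)] mode_sector[OF ab(3,4)] u by (auto simp: mode_in)
  then show ?thesis using csubspace_0[OF W] by simp
qed

text \<open>Borcherds' identity is solved for its term j = 0. It trades a mode of a_(n) b for
  two-letter words and for modes of products with higher index, which have lower weight.\<close>

lemma mode_product_in:
  assumes ab: "r < T" "a \<in> sector g T r" "s < T" "b \<in> sector g T s" and u: "u \<in> mcar M"
    and W: "csubspace W" and prods: "\<And>j p. mode M (VY V a (n + int (Suc j)) b) p u \<in> W"
    and words: "\<And>p q. mode M a p (mode M b q u) \<in> W" "\<And>p q. mode M b p (mode M a q u) \<in> W"
  shows "mode M (VY V a n b) p u \<in> W"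
proof (cases "p - of_nat ((r + s) mod T) / of_nat T \<in> \<int>")
  case True
  \<comment> \<open>Any \<open>m\<close> in r/T + \<int> would do; \<open>k\<close> is its
    complement, so that the term j = 0 has index m + k = p.\<close>
  define m k where "m = (of_nat r / of_nat T :: rat)" and "k = p - m"
  have m: "m - of_nat r / of_nat T \<in> \<int>" by (simp add: m_def)
  have "of_nat (r + s) / of_nat T
      = (of_nat ((r + s) div T) :: rat) + of_nat ((r + s) mod T) / of_nat T"
    using T_pos by (simp add: field_simps flip: of_nat_add of_nat_mult)
  then have "k - of_nat s / of_nat T
      = (p - of_nat ((r + s) mod T) / of_nat T) - of_nat ((r + s) div T)"
    by (simp add: k_def m_def add_divide_distrib)
  with True have k: "k - of_nat s / of_nat T \<in> \<int>" by simp
  let ?f = "\<lambda>j. ((of_rat m :: complex) gchoose j) *\<^sub>C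
           mode M (VY V a (n + int j) b) (m + k - of_nat j) u"
  obtain N where N: "\<And>j. j \<ge> N \<Longrightarrow> VY V a (n + int j) b = 0"
    using VY_truncation_nat by blast
  have "Sum_any ?f \<in> W"
    unfolding mode_Borcherds[OF ab u m k]
    using words by (intro csubspace_diff[OF W] csubspace_scale[OF W] csubspace_Sum_any[OF W])
  moreover have "Sum_any ?f = ?f 0 + Sum_any (\<lambda>j. ?f (Suc j))"
    by (rule Sum_any_nat_split[of N]) (simp add: N u)
  moreover have "Sum_any (\<lambda>j. ?f (Suc j)) \<in> W"
    using prods by (intro csubspace_scale[OF W] csubspace_Sum_any[OF W])
  ultimately have "?f 0 \<in> W" using csubspace_diff[OF W] by fastforce
  then show ?thesis by (simp add: k_def scaleC_one)
next
  case False
  then have "mode M (VY V a n b) p u = 0"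
    using mode_sector[OF _ VY_sector[OF ab(2,4)] _ u] T_pos by simp
  then show ?thesis using csubspace_0[OF W] by simp
qed

text \<open>The relation that exhibits \<open>a\<^sub>(\<^sub>p\<^sub>) b\<^sub>(\<^sub>p\<^sub>)\<close> through the modes of \<open>a\<^sub>(\<^sub>-\<^sub>1\<^sub>) b\<close> and through
  products whose indices lie further apart.\<close>

lemma mode_equal_index_in:
  assumes ab: "r < T" "a \<in> sector g T r" "s < T" "b \<in> sector g T s" and u: "u \<in> mcar M"
    and W: "csubspace W" and prods: "\<And>j p. mode M (VY V a (int j) b) p u \<in> W"
    "mode M (VY V a (-1) b) (p + 1 + p) u \<in> W"
    and words: "\<And>j::nat. mode M a (p - 1 - of_nat j) (mode M b (p + 1 + of_nat j) u) \<in> W"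
      "\<And>j::nat. mode M b (p - 1 - of_nat j) (mode M a (p + 1 + of_nat j) u) \<in> W"
  shows "mode M a p (mode M b p u) \<in> W"
proof (cases "p - of_nat r / of_nat T \<in> \<int> \<and> p - of_nat s / of_nat T \<in> \<int>")
  case True
  have m: "p + 1 - of_nat r / of_nat T \<in> \<int>"
    using True Ints_add[of "p - of_nat r / of_nat T" 1] by (simp add: algebra_simps)
  \<comment> \<open>The identity is read at n = -1, m = p + 1, k = p. The first sum starts with the
    wanted product; its remaining terms and the whole second sum have the index pairs p - 1 - j, p +
    1 + j.\<close>
  let ?c = "\<lambda>j. (-1) ^ j * ((of_int (-1) :: complex) gchoose j)"
  let ?f = "\<lambda>j. ?c j *\<^sub>C mode M a (p + 1 + of_int (-1) - of_nat j) (mode M b (p + of_nat j) u)"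
  let ?h = "\<lambda>j. ?c j *\<^sub>C mode M b (of_int (-1) + p - of_nat j) (mode M a (p + 1 + of_nat j) u)"
  let ?l = "\<lambda>j. ((of_rat (p + 1) :: complex) gchoose j) *\<^sub>C
           mode M (VY V a (-1 + int j) b) (p + 1 + p - of_nat j) u"
  have "mode M (VY V a (-1 + int j) b) (p + 1 + p - of_nat j) u \<in> W" for j
    using prods by (cases j) simp_all
  then have l: "Sum_any ?l \<in> W"
    by (intro csubspace_scale[OF W] csubspace_Sum_any[OF W])
  have "of_int (-1) + p - of_nat j = p - 1 - of_nat j" for j :: nat by simp
  then have h: "Sum_any ?h \<in> W"
    using words by (intro csubspace_scale[OF W] csubspace_Sum_any[OF W]) (simp only:)
  have "p + 1 + of_int (-1) - of_nat (Suc j) = p - 1 - of_nat j"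
    "p + of_nat (Suc j) = p + 1 + of_nat j" for j :: nat by simp_all
  then have f: "Sum_any (\<lambda>j. ?f (Suc j)) \<in> W"
    using words by (intro csubspace_scale[OF W] csubspace_Sum_any[OF W]) (simp only:)
  obtain N where "\<And>j. j \<ge> N \<Longrightarrow> mode M b (p + of_nat j) u = 0"
    using mode_truncation_nat[OF u] by blast
  then have "Sum_any ?f = ?f 0 + Sum_any (\<lambda>j. ?f (Suc j))"
    by (intro Sum_any_nat_split[of N]) simp
  moreover have "Sum_any ?f = Sum_any ?l + ((-1) powi (-1)) *\<^sub>C Sum_any ?h"
    using mode_Borcherds[OF ab u m conjunct2[OF True], of "-1"] by (simp add: algebra_simps)
  ultimately have "?f 0 = Sum_any ?l + ((-1) powi (-1)) *\<^sub>C Sum_any ?h - Sum_any (\<lambda>j. ?f (Suc j))"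
    by (simp add: algebra_simps)
  also have "\<dots> \<in> W"
    using l h f by (intro csubspace_diff[OF W] csubspace_add[OF W] csubspace_scale[OF W])
  finally show ?thesis by (simp add: scaleC_one)
next
  case False
  then have "mode M a p (mode M b p u) = 0"
    using mode_sector[OF ab(1,2)] mode_sector[OF ab(3,4)] u by (auto simp: mode_in)
  then show ?thesis using csubspace_0[OF W] by simp
qed

section \<open>Words in modes and their filtration by weight\<close>

text \<open>A letter \<open>(k, a, n)\<close> stands for the mode \<open>a\<^sub>(\<^sub>n\<^sub>)\<close> of a vector \<open>a\<close> of weight \<open>k\<close>.\<close>

definition wact :: "(nat \<times> 'v \<times> rat) list \<Rightarrow> 'm \<Rightarrow> 'm" where
  "wact w s = foldr (\<lambda>(k, a, n). mode M a n) w s"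

definition wwt :: "(nat \<times> 'v \<times> rat) list \<Rightarrow> nat" where
  "wwt w = sum_list (map fst w)"

text \<open>Letters of weight 0 are left out: for \<open>V\<close> of CFT-type they are multiples of
  the vacuum, so their modes act as scalars.\<close>

definition good :: "(nat \<times> 'v \<times> rat) list \<Rightarrow> bool" where
  "good w \<longleftrightarrow> list_all (\<lambda>(k, a, n). 0 < k \<and> a \<in> homs k) w"

lemma wact_simps [simp]: "wact [] s = s" "wact ((k, a, n) # w) s = mode M a n (wact w s)"
  "wact (w @ w') s = wact w (wact w' s)"
  by (simp_all add: wact_def)

lemma wwt_simps [simp]: "wwt [] = 0" "wwt (x # w) = fst x + wwt w" "wwt (w @ w') = wwt w + wwt w'"
  by (simp_all add: wwt_def)

lemma good_simps [simp]: "good []" "good ((k, a, n) # w) \<longleftrightarrow> 0 < k \<and> a \<in> homs k \<and> good w"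
  "good (w @ w') \<longleftrightarrow> good w \<and> good w'"
  by (simp_all add: good_def)

lemma wact_in: "s \<in> mcar M \<Longrightarrow> wact w s \<in> mcar M"
  by (induction w) (auto simp: mode_in)

lemma wact_0 [simp]: "wact w 0 = 0"
  by (induction w) auto

text \<open>With the strict bound, working modulo step \<open>N\<close> means working in the
  associated graded piece of the words of weight \<open>N\<close>, and step 0 is the zero
  space.\<close>

definition weight_filtration :: "'m set \<Rightarrow> nat \<Rightarrow> 'm set" where
  "weight_filtration S N = cspan {wact w s | w s. s \<in> S \<and> good w \<and> wwt w < N}"

definition Bword :: "(nat \<times> 'v) set \<Rightarrow> (nat \<times> 'v \<times> rat) list \<Rightarrow> bool" where
  "Bword B w \<longleftrightarrow> list_all (\<lambda>(k, b, n). 0 < k \<and> (k, b) \<in> B) w"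

lemma Bword_simps [simp]: "Bword B []" "Bword B ((k, b, n) # w) \<longleftrightarrow> 0 < k \<and> (k, b) \<in> B \<and> Bword B w"
  "Bword B (w @ w') \<longleftrightarrow> Bword B w \<and> Bword B w'"
  by (simp_all add: Bword_def)

definition top_words :: "'m set \<Rightarrow> (nat \<times> 'v) set \<Rightarrow> nat \<Rightarrow> 'm set" where
  "top_words S B N = {wact w s | w s. s \<in> S \<and> Bword B w \<and> wwt w = N}"

text \<open>The potential that makes the rewriting of words terminate: replacing the indices n, n by
  n - 1 - j, n + 1 + j increases it by 2 (1 + j)^2.\<close>

definition wsq :: "(nat \<times> 'v \<times> rat) list \<Rightarrow> rat" where
  "wsq w = sum_list (map (\<lambda>(k, b, n). n ^ 2) w)"

lemma wsq_simps [simp]: "wsq [] = 0" "wsq ((k, b, n) # w) = n ^ 2 + wsq w"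
  "wsq (w @ w') = wsq w + wsq w'"
  by (simp_all add: wsq_def)

text \<open>The indices that cannot be disposed of directly: outside (1/T) \<int> a mode is 0, below
  -1 its values belong to the target space, and \<open>L\<close> will be a bound from which on the
  letters kill the generators.\<close>

definition indices :: "rat \<Rightarrow> rat set" where
  "indices L = {n. of_nat T * n \<in> \<int> \<and> -1 \<le> n \<and> n \<le> L}"

lemma finite_indices: "finite (indices L)"
proof (rule finite_subset)
  show "indices L \<subseteq> (\<lambda>i. of_int i / of_nat T) ` {- int T..\<lceil>of_nat T * L\<rceil>}"
  proof
    fix n assume "n \<in> indices L"
    then obtain i where i: "of_nat T * n = of_int i" and n: "-1 \<le> n" "n \<le> L"
      unfolding indices_def Ints_def by blast
    have "of_int i \<le> of_nat T * L" and "- of_nat T \<le> (of_int i :: rat)"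
      unfolding i[symmetric] using n mult_left_mono[of "-1" n "of_nat T"] by (auto intro: mult_left_mono)
    then have "i \<in> {- int T..\<lceil>of_nat T * L\<rceil>}"
      by (simp add: le_ceiling_iff)
    moreover have "n = of_int i / of_nat T" using i T_pos by (simp add: field_simps)
    ultimately show "n \<in> (\<lambda>i. of_int i / of_nat T) ` {- int T..\<lceil>of_nat T * L\<rceil>}" by blast
  qed
qed simp

lemma wsq_bound:
  assumes "\<And>k b n. (k, b, n) \<in> set w \<Longrightarrow> n \<in> indices L"
  shows "wsq w \<le> of_nat (length w) * (L ^ 2 + 1)"
  using assms
proof (induction w)
  case (Cons x w)
  obtain k b n where x: "x = (k, b, n)" by (cases x) auto
  have n: "-1 \<le> n" "n \<le> L" using Cons.prems[of k b n] by (auto simp: x indices_def)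
  \<comment> \<open>The summand 1 is for negative indices, which have absolute value at most 1 but
    may have a square above L^2.\<close>
  have "n ^ 2 \<le> L ^ 2 + 1"
  proof (cases "n \<ge> 0")
    case True
    then have "n ^ 2 \<le> L ^ 2" using n by (intro power_mono) auto
    then show ?thesis by simp
  next
    case False
    then have "(- n) ^ 2 \<le> 1 ^ 2" using n by (intro power_mono) auto
    then show ?thesis using zero_le_power2[of L] by (simp add: add_increasing)
  qed
  with Cons show ?case by (fastforce simp: x algebra_simps)
qed simp

context
  fixes S :: "'m set" and B :: "(nat \<times> 'v) set"
  assumes S: "S \<subseteq> mcar M" and cft: "CFT_type V"
    and B_homs: "\<And>k b. (k, b) \<in> B \<Longrightarrow> b \<in> homs k"
    and B_span: "\<And>k a. a \<in> homs k \<Longrightarrow> a \<in> cspan ({b. (k, b) \<in> B} \<union> C2_gens k)"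
begin

abbreviation "E \<equiv> weight_filtration S"

lemma E_subspace: "csubspace (E N)"
  unfolding weight_filtration_def by (rule complex_vector.subspace_span)

lemma E_gen: "s \<in> S \<Longrightarrow> good w \<Longrightarrow> wwt w < N \<Longrightarrow> wact w s \<in> E N"
  unfolding weight_filtration_def by (rule complex_vector.span_base) blast

lemma E_gens_mcar: "{wact w s | w s. s \<in> S \<and> good w \<and> wwt w < N} \<subseteq> mcar M"
  using S wact_in by blast

lemma E_mcar: "E N \<subseteq> mcar M"
  unfolding weight_filtration_def
  using E_gens_mcar mcar_subspace by (rule complex_vector.span_minimal)

lemma E_mcarD: "x \<in> E N \<Longrightarrow> x \<in> mcar M"
  using E_mcar by blast

lemma E_mono: "N \<le> N' \<Longrightarrow> E N \<subseteq> E N'"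
  unfolding weight_filtration_def using less_le_trans by (intro complex_vector.span_mono) blast

lemma mode_weight_0:
  assumes "a \<in> VGr V 0" "u \<in> mcar M" "csubspace W" "u \<in> W"
  shows "mode M a n u \<in> W"
proof -
  obtain c where "a = c *\<^sub>C vac V"
    using assms(1) cft unfolding CFT_type_def complex_vector.span_singleton by auto
  then show ?thesis
    using assms by (auto simp: mode_scale_left mode_vac csubspace_0 csubspace_scale)
qed

lemma mode_E:
  assumes "a \<in> homs k" "x \<in> E N"
  shows "mode M a n x \<in> E (N + k)"
proof (cases "k = 0")
  case True
  then show ?thesis
    using mode_weight_0[OF homs_VGr E_mcarD[OF assms(2)] E_subspace assms(2)] assms(1) by simp
next
  case False
  show ?thesis
  proof (rule clinear_on_span[OF clinear_on_mode mcar_subspace E_gens_mcar E_subspace])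
    show "x \<in> cspan {wact w s | w s. s \<in> S \<and> good w \<and> wwt w < N}"
      using assms(2) by (simp add: weight_filtration_def)
    fix y assume "y \<in> {wact w s | w s. s \<in> S \<and> good w \<and> wwt w < N}"
    then obtain w s where y: "y = wact w s" "s \<in> S" "good w" "wwt w < N" by blast
    then show "mode M a n y \<in> E (N + k)"
      using E_gen[of s "(k, a, n) # w" "N + k"] assms(1) False by simp
  qed
qed

lemma mode_product_E:
  assumes "a \<in> homs k" "b \<in> homs l" "j \<ge> -2" "x \<in> E N" "int N + int k + int l - j - 1 \<le> int N'"
  shows "mode M (VY V a j b) p x \<in> E N'"
proof (cases "int k + int l - j - 1 < 0")
  case True
  then have "VY V a j b = 0"
    using VY_negative_weight[OF homs_VGr[OF assms(1)] homs_VGr[OF assms(2)]] by simp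
  then show ?thesis using E_mcarD[OF assms(4)] csubspace_0[OF E_subspace] by simp
next
  case False
  define i where "i = nat (int k + int l - j - 1)"
  then have i: "int i = int k + int l - j - 1" using False by simp
  from mode_E[OF VY_homs[OF assms(3,1,2) i] assms(4)]
  have "mode M (VY V a j b) p x \<in> E (N + i)" .
  moreover have "N + i \<le> N'" using i assms(5) by simp
  ultimately show ?thesis using E_mono by blast
qed

text \<open>For j \<ge> 0 the vector a_(j) b has weight at most k + l - 1, so an exchange of two
  letters loses a unit of weight. Hence modes commute on the associated graded space.\<close>

lemma mode_commutator_E:
  assumes a: "a \<in> homs k" and b: "b \<in> homs l" and x: "x \<in> E (Suc N)"
  shows "mode M a m (mode M b n x) - mode M b n (mode M a m x) \<in> E (N + k + l)"
proof -
  obtain r s where rs: "r < T" "a \<in> sector g T r" "s < T" "b \<in> sector g T s"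
    using a b by (auto simp: homs_def)
  show ?thesis
    by (rule mode_commutator_in[OF rs E_mcarD[OF x] E_subspace])
      (rule mode_product_E[OF a b _ x], simp_all)
qed

text \<open>The vector c_(-2) d has weight i + l + 1, but its modes are expressed by words in
  \<open>c\<close> and \<open>d\<close> of weight i + l and by modes of vectors of weight at most i
  + l. Hence C_2(V) acts as 0 on the associated graded space.\<close>

lemma mode_C2_E:
  assumes a: "a \<in> C2_gens k" and x: "x \<in> E (Suc N)"
  shows "mode M a p x \<in> E (N + k)"
proof -
  obtain c d i l where a: "a = VY V c (-2) d" and c: "c \<in> homs i" and d: "d \<in> homs l"
    and k: "k = i + l + 1"
    using a unfolding C2_gens_def by blast
  obtain r s where rs: "r < T" "c \<in> sector g T r" "s < T" "d \<in> sector g T s"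
    using c d by (auto simp: homs_def)
  have "mode M (VY V c (-2 + int (Suc j)) d) q x \<in> E (N + k)" for j q
    by (rule mode_product_E[OF c d _ x]) (simp_all add: k)
  moreover have "mode M c q (mode M d q' x) \<in> E (N + k)" for q q'
    using mode_E[OF c mode_E[OF d x]] by (simp add: k algebra_simps)
  moreover have "mode M d q (mode M c q' x) \<in> E (N + k)" for q q'
    using mode_E[OF d mode_E[OF c x]] by (simp add: k algebra_simps)
  ultimately show ?thesis
    unfolding a by (rule mode_product_in[OF rs E_mcarD[OF x] E_subspace])
qed

lemma mode_B_step:
  assumes a: "a \<in> homs k" and x: "x \<in> E (Suc N)" and W: "csubspace W" "E (N + k) \<subseteq> W"
    and B: "\<And>b. (k, b) \<in> B \<Longrightarrow> mode M b n x \<in> W"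
  shows "mode M a n x \<in> W"
proof (rule clinear_on_span[OF clinear_on_mode_left _ _ W(1) _ B_span[OF a]])
  show "x \<in> mcar M" using x by (rule E_mcarD)
  fix y assume "y \<in> {b. (k, b) \<in> B} \<union> C2_gens k"
  then show "mode M y n x \<in> W"
  proof
    assume "y \<in> C2_gens k"
    from mode_C2_E[OF this x] show ?thesis using W(2) by blast
  qed (simp add: B)
qed simp_all

lemma Bword_good: "Bword B w \<Longrightarrow> good w"
  by (induction w) (auto dest: B_homs)

text \<open>The letters are replaced by letters from \<open>B\<close> starting with the innermost;
  the C_2-part of each letter falls into the filtration.\<close>

lemma good_word_decomposition:
  assumes "good w" "s \<in> S"
  shows "wact w s \<in> cspan (top_words S B (wwt w) \<union> E (wwt w))"
  using assms(1)
proof (induction w)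
  case Nil
  have "s \<in> top_words S B 0"
    using assms(2) by (auto simp: top_words_def intro!: exI[of _ "[]"])
  then show ?case by (auto intro: complex_vector.span_base)
next
  case (Cons x w)
  obtain k a n where x: "x = (k, a, n)" by (cases x) auto
  let ?G = "cspan (top_words S B (wwt (x # w)) \<union> E (wwt (x # w)))"
  have EG: "E (wwt w + k) \<subseteq> ?G"
    using complex_vector.span_superset[of "top_words S B (wwt (x # w)) \<union> E (wwt (x # w))"]
    by (simp add: x add.commute)
  have a: "0 < k" "a \<in> homs k" "good w" using Cons.prems by (simp_all add: x)
  have "mode M a n (wact w s) \<in> ?G"
  proof (rule clinear_on_span[OF clinear_on_mode mcar_subspace _ _ _ Cons.IH[OF a(3)]])
    show "top_words S B (wwt w) \<union> E (wwt w) \<subseteq> mcar M"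
      using E_mcar wact_in S unfolding top_words_def by blast
    fix y assume "y \<in> top_words S B (wwt w) \<union> E (wwt w)"
    then show "mode M a n y \<in> ?G"
    proof
      assume "y \<in> E (wwt w)"
      then show ?thesis using mode_E[OF a(2)] EG by blast
    next
      assume "y \<in> top_words S B (wwt w)"
      then obtain w' s' where y: "y = wact w' s'" "s' \<in> S" "Bword B w'" "wwt w' = wwt w"
        unfolding top_words_def by blast
      have yE: "y \<in> E (Suc (wwt w))"
        using y E_gen Bword_good by simp
      show ?thesis
      proof (rule mode_B_step[OF a(2) yE complex_vector.subspace_span EG])
        fix b assume "(k, b) \<in> B"
        then have "mode M b n y \<in> top_words S B (wwt (x # w))"
          unfolding top_words_def using y a(1)
          by (intro CollectI exI[of _ "(k, b, n) # w'"] exI[of _ s']) (simp add: x)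
        then show "mode M b n y \<in> ?G" by (auto intro: complex_vector.span_base)
      qed
    qed
  qed (rule complex_vector.subspace_span)
  then show ?case by (simp add: x)
qed

text \<open>Each transposition with a letter of \<open>p\<close> costs a commutator, which is at
  least one unit of weight below the word.\<close>

lemma move_to_front:
  assumes "good (p @ x # q)" "s \<in> S"
  shows "wact (p @ x # q) s - wact (x # p @ q) s \<in> E (wwt (p @ x # q))"
  using assms(1)
proof (induction p)
  case Nil
  then show ?case using csubspace_0[OF E_subspace] by simp
next
  case (Cons y p)
  obtain k a m where y: "y = (k, a, m)" by (cases y) auto
  obtain l b n where x: "x = (l, b, n)" by (cases x) auto
  let ?N = "wwt (y # p @ x # q)" and ?R = "wact (p @ q) s"
  have a: "a \<in> homs k" and b: "b \<in> homs l" using Cons.prems by (simp_all add: x y)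
  have sM: "s \<in> mcar M" using assms(2) S by blast
  have "mode M a m (wact (p @ x # q) s - wact (x # p @ q) s) \<in> E ?N"
    using mode_E[OF a Cons.IH] Cons.prems by (simp add: y add.commute)
  then have "mode M a m (wact (p @ x # q) s) - mode M a m (wact (x # p @ q) s) \<in> E ?N"
    by (simp only: clinear_on_diff[OF clinear_on_mode mcar_subspace wact_in[OF sM] wact_in[OF sM]])
  moreover have "?R \<in> E (Suc (wwt (p @ q)))"
    using Cons.prems assms(2) by (intro E_gen) (simp_all add: x y)
  from mode_commutator_E[OF a b this, of m n]
  have "mode M a m (mode M b n ?R) - mode M b n (mode M a m ?R) \<in> E ?N"
    by (simp add: x y algebra_simps)
  ultimately have "mode M a m (wact (p @ x # q) s) - mode M a m (wact (x # p @ q) s)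
    + (mode M a m (mode M b n ?R) - mode M b n (mode M a m ?R)) \<in> E ?N"
    by (rule csubspace_add[OF E_subspace])
  then show ?case by (simp add: x y)
qed

lemma move_two_to_front:
  assumes "good (p @ x # q @ y # r)" "s \<in> S"
  shows "wact (p @ x # q @ y # r) s - wact (x # y # p @ q @ r) s \<in> E (wwt (p @ x # q @ y # r))"
proof -
  let ?N = "wwt (p @ x # q @ y # r)"
  obtain k a m where x: "x = (k, a, m)" by (cases x) auto
  have a: "a \<in> homs k" using assms by (simp add: x)
  have sM: "s \<in> mcar M" using assms(2) S by blast
  have "good ((p @ q) @ y # r)" using assms(1) by (simp add: x)
  from mode_E[OF a move_to_front[OF this assms(2)], of m]
  have "mode M a m (wact ((p @ q) @ y # r) s - wact (y # (p @ q) @ r) s) \<in> E ?N"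
    by (simp add: x algebra_simps)
  then have "mode M a m (wact ((p @ q) @ y # r) s) - mode M a m (wact (y # (p @ q) @ r) s) \<in> E ?N"
    by (simp only: clinear_on_diff[OF clinear_on_mode mcar_subspace wact_in[OF sM] wact_in[OF sM]])
  from csubspace_add[OF E_subspace move_to_front[OF assms] this]
  show ?thesis by (simp add: x)
qed

lemma map_two_occurrences:
  assumes "map f w = p' @ n # q' @ n # r'"
  obtains p x q y r where "w = p @ x # q @ y # r" "f x = n" "f y = n"
proof -
  have split: "\<exists>p x q. v = p @ x # q \<and> f x = n \<and> map f q = t" if "map f v = p' @ n # t" for v p' t
  proof -
    have d: "map f (drop (length p') v) = n # t" using that by (simp add: drop_map[symmetric])
    then obtain x q where x: "drop (length p') v = x # q" by (cases "drop (length p') v") auto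
    then have "v = take (length p') v @ x # q" using append_take_drop_id[of "length p'" v] by simp
    moreover have "f x = n" "map f q = t" using d x by simp_all
    ultimately show ?thesis by (intro exI conjI)
  qed
  from split[OF assms] obtain p x v where v: "w = p @ x # v" "f x = n" "map f v = q' @ n # r'"
    by (elim exE conjE)
  from split[OF v(3)] obtain q y r where y: "v = q @ y # r" "f y = n"
    by (elim exE conjE)
  show ?thesis by (rule that[of p x q y r]) (simp_all add: v(1,2) y)
qed

lemma mode_bad_index:
  assumes "b \<in> homs k" "of_nat T * n \<notin> \<int>" "x \<in> mcar M"
  shows "mode M b n x = 0"
proof -
  obtain r where r: "r < T" "b \<in> sector g T r" using assms(1) by (auto simp: homs_def)
  have "n - of_nat r / of_nat T \<notin> \<int>"
  proof
    assume "n - of_nat r / of_nat T \<in> \<int>"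
    then have "of_nat T * (n - of_nat r / of_nat T) + of_nat r \<in> \<int>"
      by (intro Ints_add Ints_mult) auto
    also have "of_nat T * (n - of_nat r / of_nat T) + of_nat r = of_nat T * n"
      using T_pos by (simp add: right_diff_distrib)
    finally show False using assms(2) by simp
  qed
  then show ?thesis using mode_sector[OF r _ assms(3)] by simp
qed

text \<open>\<open>W\<close> stands for the span in the cofiniteness theorem. Kept abstract, it
  allows reduction modulo modes of index below -1 and short words to be phrased as
  membership.\<close>

context
  fixes L :: rat and W :: "'m set"
  assumes L: "\<And>k b s n. (k, b) \<in> B \<Longrightarrow> s \<in> S \<Longrightarrow> n \<ge> L \<Longrightarrow> mode M b n s = 0"
    and W: "csubspace W"
    and W_modes: "\<And>a n x. x \<in> mcar M \<Longrightarrow> n < -1 \<Longrightarrow> mode M a n x \<in> W"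
    and W_words: "\<And>w s. Bword B w \<Longrightarrow> s \<in> S \<Longrightarrow> (\<And>k b n. (k, b, n) \<in> set w \<Longrightarrow> n \<in> indices L) \<Longrightarrow>
      length w \<le> card (indices L) \<Longrightarrow> wact w s \<in> W"
begin

lemma W_diff: "x - y \<in> W \<Longrightarrow> y \<in> W \<Longrightarrow> x \<in> W"
  using csubspace_add[OF W, of "x - y" y] by simp

text \<open>Letters commute modulo lower weight, so the offending letter can be moved to the end of
  the word where it is decisive: to the front if its mode is 0 or has index below -1, next to the
  generator \<open>s\<close> if its index is at least \<open>L\<close>.\<close>

lemma word_bad_index_in:
  assumes "E (wwt w) \<subseteq> W" "Bword B w" "s \<in> S" "(k, b, n) \<in> set w" "n \<notin> indices L"
  shows "wact w s \<in> W"
proof -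
  obtain p q where w: "w = p @ (k, b, n) # q" using assms(4) by (meson split_list)
  have g: "good w" using assms(2) Bword_good by blast
  have sM: "s \<in> mcar M" using assms(3) S by blast
  have b: "(k, b) \<in> B" "b \<in> homs k" using assms(2) B_homs by (simp_all add: w)
  have diff: "wact w s - wact ((k, b, n) # p @ q) s \<in> W"
    using move_to_front[of p "(k, b, n)" q s] g assms(1,3) by (auto simp: w)
  have "wact ((k, b, n) # p @ q) s \<in> W"
  proof -
    consider "of_nat T * n \<notin> \<int>" | "n < -1" | "n \<ge> L"
      using assms(5) unfolding indices_def by force
    then show ?thesis
    proof cases
      case 1
      have "mode M b n (wact (p @ q) s) = 0"
        by (rule mode_bad_index[OF b(2) 1 wact_in[OF sM]])
      then show ?thesis using csubspace_0[OF W] by simp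
    next
      case 2
      then show ?thesis using W_modes[OF wact_in[OF sM, of "p @ q"]] by simp
    next
      case 3
      \<comment> \<open>Read backwards, this moves the letter from the front to the last place,
        where it kills \<open>s\<close>.\<close>
      have "wact ((p @ q) @ (k, b, n) # []) s - wact ((k, b, n) # (p @ q) @ []) s \<in> E (wwt w)"
        using move_to_front[of "p @ q" "(k, b, n)" "[]" s] g assms(3) by (simp add: w ac_simps)
      then have "- wact ((k, b, n) # p @ q) s \<in> W"
        using assms(1) L[OF b(1) assms(3) 3] by auto
      then show ?thesis using csubspace_minus_iff[OF W] by blast
    qed
  qed
  then show ?thesis using diff W_diff by blast
qed

text \<open>A word longer than the number of admissible indices repeats an index. The two letters,
  brought to the front, are replaced by a single letter or by two letters with indices further
  apart, so either the length drops or \<open>wsq\<close> grows at constant length. The constant L^2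
  + 2 exceeds the bound for \<open>wsq\<close> by one per letter. Thus the second measure is at
  least 1 before the indices are spread, and its cut-off at 0 by \<open>nat\<close> does not spoil
  the strict decrease. A word whose indices leave the range is absorbed by
  \<open>word_bad_index_in\<close>.\<close>

lemma Bword_in:
  assumes EW: "E N \<subseteq> W" and s: "s \<in> S" and "Bword B w" "wwt w = N"
  shows "wact w s \<in> W"
  using assms(3,4)
proof (induction w rule: wf_induct[OF wf_measures[of "[length,
    \<lambda>w. nat \<lfloor>of_nat (length w) * (L ^ 2 + 2) - wsq w\<rfloor>]"]])
  case (1 w)
  have IH: "wact w' s \<in> W" if "length w' < length w \<or> length w' = length w \<and>
      nat \<lfloor>of_nat (length w') * (L ^ 2 + 2) - wsq w'\<rfloor> < nat \<lfloor>of_nat (length w) * (L ^ 2 + 2) - wsq w\<rfloor>"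
    "Bword B w'" "wwt w' = N" for w'
    using 1(1)[rule_format, of w'] that by auto
  show ?case
  proof (cases "(\<forall>(k, b, n) \<in> set w. n \<in> indices L)")
    case False
    then show ?thesis
      using word_bad_index_in[of w s] EW s 1(2,3) by auto
  next
    case True
    then have ind: "n \<in> indices L" if "(k, b, n) \<in> set w" for k b n using that by auto
    show ?thesis
    proof (cases "length w \<le> card (indices L)")
      case True
      then show ?thesis using W_words[OF 1(2) s] ind by blast
    next
      case False
      define ns where "ns = map (\<lambda>(k, b, n). n) w"
      have "set ns \<subseteq> indices L" using ind by (auto simp: ns_def)
      then have "card (set ns) < length ns"
        using False card_mono[OF finite_indices, of "set ns" L] by (simp add: ns_def)
      then have "\<not> distinct ns" using distinct_card by fastforce
      then obtain n p' q' r' where "ns = p' @ [n] @ q' @ [n] @ r'"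
        using not_distinct_decomp by blast
      then obtain p k a q l b r where w: "w = p @ (k, a, n) # q @ (l, b, n) # r"
      proof -
        let ?f = "\<lambda>(k, b, n). n"
        have "map ?f w = p' @ n # q' @ n # r'"
          using \<open>ns = p' @ [n] @ q' @ [n] @ r'\<close> by (simp add: ns_def)
        then obtain p x q y r where "w = p @ x # q @ y # r" "?f x = n" "?f y = n"
          by (rule map_two_occurrences)
        then have "w = p @ (fst x, fst (snd x), n) # q @ (fst y, fst (snd y), n) # r"
          by (cases x; cases y) simp
        then show thesis by (rule that)
      qed
      let ?R = "p @ q @ r"
      have B: "(k, a) \<in> B" "(l, b) \<in> B" "0 < k" "0 < l" "Bword B ?R" using 1(2) by (simp_all add: w)
      have hom: "a \<in> homs k" "b \<in> homs l" "good ?R" using B B_homs Bword_good by auto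
      have N: "N = k + l + wwt ?R" using 1(3) by (simp add: w)
      have xE: "wact ?R s \<in> E (Suc (wwt ?R))" using hom s by (intro E_gen) auto
      have xM: "wact ?R s \<in> mcar M" using xE by (rule E_mcarD)
      have spread: "wact ((k1, b1, n - 1 - of_nat j) # (k2, b2, n + 1 + of_nat j) # ?R) s \<in> W"
        if "(k1, b1) \<in> B" "(k2, b2) \<in> B" "k1 + k2 = k + l" "0 < k1" "0 < k2" for j :: nat and k1 k2 b1 b2
      proof (rule IH)
        let ?w = "(k1, b1, n - 1 - of_nat j) # (k2, b2, n + 1 + of_nat j) # ?R"
        let ?c = "of_nat (length w) * (L ^ 2 + 2)"
        have len: "length ?w = length w" by (simp add: w)
        have "wsq ?w = wsq w + 2 * (1 + of_nat j) ^ 2"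
          by (simp add: w power2_eq_square algebra_simps)
        moreover have "(1 + of_nat j :: rat) ^ 2 \<ge> 1" by (simp add: one_le_power)
        ultimately have "wsq ?w \<ge> wsq w + 1" by linarith
        then have "\<lfloor>?c - wsq ?w\<rfloor> \<le> \<lfloor>?c - wsq w - 1\<rfloor>" by (intro floor_mono) linarith
        then have le: "\<lfloor>?c - wsq ?w\<rfloor> < \<lfloor>?c - wsq w\<rfloor>" by simp
        have "wsq w \<le> of_nat (length w) * (L ^ 2 + 1)" using ind by (rule wsq_bound)
        then have "of_nat (length w) \<le> ?c - wsq w" by (simp add: algebra_simps)
        moreover have "(1::rat) \<le> of_nat (length w)" by (simp add: w)
        ultimately have "1 \<le> ?c - wsq w" by linarith
        then have "1 \<le> \<lfloor>?c - wsq w\<rfloor>" by (simp add: le_floor_iff)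
        then have "nat \<lfloor>?c - wsq ?w\<rfloor> < nat \<lfloor>?c - wsq w\<rfloor>" using le by linarith
        then show "length ?w < length w \<or> length ?w = length w \<and>
          nat \<lfloor>of_nat (length ?w) * (L ^ 2 + 2) - wsq ?w\<rfloor> < nat \<lfloor>?c - wsq w\<rfloor>"
          unfolding len by blast
        show "Bword B ?w" using that B by simp
        show "wwt ?w = N" using that N by simp
      qed
      obtain r1 r2 where sec: "r1 < T" "a \<in> sector g T r1" "r2 < T" "b \<in> sector g T r2"
        using hom by (auto simp: homs_def)
      have "mode M a n (mode M b n (wact ?R s)) \<in> W"
      proof (rule mode_equal_index_in[OF sec xM W])
        show "mode M (VY V a (int j) b) m (wact ?R s) \<in> W" for j m
          using mode_product_E[OF hom(1,2) _ xE, of "int j" N m] EW N by auto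
        show "mode M a (n - 1 - of_nat j) (mode M b (n + 1 + of_nat j) (wact ?R s)) \<in> W" for j
          using spread[OF B(1,2)] B by simp
        show "mode M b (n - 1 - of_nat j) (mode M a (n + 1 + of_nat j) (wact ?R s)) \<in> W" for j
          using spread[OF B(2,1)] B by simp
        \<comment> \<open>This product has the full weight k + l, so nothing is gained in the
          filtration; the gain is in length, since one letter replaces two.\<close>
        have ab: "VY V a (-1) b \<in> homs (k + l)"
          using VY_homs[OF _ hom(1,2), of "-1" "k + l"] by simp
        show "mode M (VY V a (-1) b) (n + 1 + n) (wact ?R s) \<in> W"
        proof (rule mode_B_step[OF ab xE W])
          show "E (wwt ?R + (k + l)) \<subseteq> W" using EW N by (simp add: ac_simps)
          fix b' assume "(k + l, b') \<in> B"
          then show "mode M b' (n + 1 + n) (wact ?R s) \<in> W"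
            using IH[of "(k + l, b', n + 1 + n) # ?R"] B N by (simp add: w)
        qed
      qed
      moreover have "wact w s - wact ((k, a, n) # (l, b, n) # ?R) s \<in> W"
        using move_two_to_front[of p "(k, a, n)" q "(l, b, n)" r s] Bword_good[OF 1(2)] s EW 1(3)
        by (auto simp: w)
      ultimately show ?thesis using W_diff by simp
    qed
  qed
qed

lemma E_in: "E N \<subseteq> W"
proof (induction N)
  case 0
  have "E 0 = {0}" by (simp add: weight_filtration_def)
  then show ?case using csubspace_0[OF W] by simp
next
  case (Suc N)
  have "wact w s \<in> W" if w: "s \<in> S" "good w" "wwt w < Suc N" for w s
  proof (cases "wwt w < N")
    case True
    then show ?thesis using w Suc E_gen by blast
  next
    case False
    then have wN: "wwt w = N" using w by simp
    have "top_words S B N \<union> E N \<subseteq> W"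
      using Bword_in[OF Suc] Suc unfolding top_words_def by blast
    from complex_vector.span_minimal[OF this W] show ?thesis
      using good_word_decomposition[OF w(2,1)] unfolding wN by blast
  qed
  then show ?case
    unfolding weight_filtration_def by (intro complex_vector.span_minimal W) blast
qed

end

lemma union_E_subspace: "csubspace (\<Union>N. E N)"
  unfolding complex_vector.subspace_def
proof (intro conjI ballI allI)
  show "0 \<in> (\<Union>N. E N)" using csubspace_0[OF E_subspace] by blast
  fix x y assume "x \<in> (\<Union>N. E N)" "y \<in> (\<Union>N. E N)"
  then obtain N N' where "x \<in> E N" "y \<in> E N'" by blast
  then have "x \<in> E (max N N')" "y \<in> E (max N N')"
    using E_mono[of N "max N N'"] E_mono[of N' "max N N'"] by auto
  then show "x + y \<in> (\<Union>N. E N)" using csubspace_add[OF E_subspace] by blast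
next
  fix c x assume "x \<in> (\<Union>N. E N)"
  then show "c *\<^sub>C x \<in> (\<Union>N. E N)" using csubspace_scale[OF E_subspace] by blast
qed

lemma mode_union_E:
  assumes "x \<in> E N"
  shows "\<exists>N'. mode M a n x \<in> E N'"
proof -
  have xM: "x \<in> mcar M" using assms by (rule E_mcarD)
  have "mode M a n x \<in> (\<Union>N. E N)"
    by (rule homs_linear_induct[OF clinear_on_mode_left[OF xM] union_E_subspace]) (use mode_E[OF _ assms] in blast)
  then show ?thesis by blast
qed

end

text \<open>The counterpart for \<open>M\<close> of C_2-cofiniteness. As indices are fractional, all
  modes with index below -1 take the place of the index -2.\<close>

theorem finitely_generated_cofinite:
  assumes cft: "CFT_type V" and c2: "C2_cofinite V" and fg: "finitely_generated M"
  obtains F where "finite F" "F \<subseteq> mcar M"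
    "mcar M \<subseteq> cspan (F \<union> {mode M a n x | a n x. n < -1 \<and> x \<in> mcar M})"
proof -
  obtain B where B: "finite B" "\<And>k b. (k, b) \<in> B \<Longrightarrow> b \<in> homs k"
    "\<And>k a. a \<in> homs k \<Longrightarrow> a \<in> cspan ({b. (k, b) \<in> B} \<union> C2_gens k)"
  proof (rule homogeneous_C2_spanning[OF c2])
    fix B assume "finite B" "\<And>k b. (k, b) \<in> B \<Longrightarrow> b \<in> homs k"
      "\<And>k a. a \<in> homs k \<Longrightarrow> a \<in> cspan ({b. (k, b) \<in> B} \<union> C2_gens k)"
    then show thesis by (rule that)
  qed
  obtain S where S: "finite S" "S \<subseteq> mcar M"
    and gen: "\<And>N. csubspace N \<Longrightarrow> S \<subseteq> N \<Longrightarrow> N \<subseteq> mcar M \<Longrightarrow>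
      (\<And>a n u. u \<in> N \<Longrightarrow> mode M a n u \<in> N) \<Longrightarrow> N = mcar M"
    using fg unfolding finitely_generated_def by metis
  note ctx = S(2) cft B(2,3)
  have "\<forall>\<^sub>F n in at_top. \<forall>y\<in>B \<times> S. mode M (snd (fst y)) n (snd y) = 0"
  proof (rule eventually_ball_finite)
    show "finite (B \<times> S)" using B(1) S(1) by simp
    show "\<forall>y\<in>B \<times> S. \<forall>\<^sub>F n in at_top. mode M (snd (fst y)) n (snd y) = 0"
      unfolding eventually_at_top_linorder using mode_truncation S(2) by auto
  qed
  \<comment> \<open>A single truncation bound serves all letters and generators, \<open>B\<close>
    and \<open>S\<close> being finite.\<close>
  then obtain L where L': "\<And>n y. n \<ge> L \<Longrightarrow> y \<in> B \<times> S \<Longrightarrow> mode M (snd (fst y)) n (snd y) = 0"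
    unfolding eventually_at_top_linorder by blast
  have L: "mode M b n s = 0" if "(k, b) \<in> B" "s \<in> S" "n \<ge> L" for k b s n
    using L'[OF that(3), of "((k, b), s)"] that by simp
  define Ws where "Ws = {w. set w \<subseteq> (\<lambda>((k, b), n). (k, b, n)) ` (B \<times> indices L)
    \<and> length w \<le> card (indices L)}"
  define F where "F = (\<lambda>(w, s). wact w s) ` (Ws \<times> S)"
  have "finite Ws"
    unfolding Ws_def using B(1) finite_indices[of L] by (intro finite_lists_length_le finite_imageI finite_cartesian_product)
  then have "finite F"
    unfolding F_def using S(1) by simp
  moreover have "F \<subseteq> mcar M" using S(2) wact_in by (auto simp: F_def)
  moreover have "mcar M \<subseteq> cspan (F \<union> {mode M a n x | a n x. n < -1 \<and> x \<in> mcar M})" (is "_ \<subseteq> ?W")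
  proof -
    have E_W: "weight_filtration S N \<subseteq> ?W" for N
    proof (rule E_in[OF ctx, of L])
      fix w s assume w: "Bword B w" "s \<in> S" "\<And>k b n. (k, b, n) \<in> set w \<Longrightarrow> n \<in> indices L"
        "length w \<le> card (indices L)"
      have "set w \<subseteq> (\<lambda>((k, b), n). (k, b, n)) ` (B \<times> indices L)"
      proof
        fix x assume x: "x \<in> set w"
        obtain k b n where xe: "x = (k, b, n)" by (cases x) auto
        have "(k, b) \<in> B" using w(1) x by (auto simp: Bword_def list_all_iff xe)
        then show "x \<in> (\<lambda>((k, b), n). (k, b, n)) ` (B \<times> indices L)"
          using w(3) x by (force simp: xe)
      qed
      then have "w \<in> Ws" using w(4) by (simp add: Ws_def)
      then have "wact w s \<in> F" using w(2) unfolding F_def by force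
      then show "wact w s \<in> ?W" by (intro complex_vector.span_base UnI1)
    next
      fix a n x assume "x \<in> mcar M" "n < (-1::rat)"
      then show "mode M a n x \<in> ?W" by (intro complex_vector.span_base) blast
    next
      show "csubspace ?W" by (rule complex_vector.subspace_span)
      show "mode M b n s = 0" if "(k, b) \<in> B" "s \<in> S" "L \<le> n" for k b s n
        using that by (rule L)
    qed
    have "(\<Union>N. weight_filtration S N) = mcar M"
    proof (rule gen)
      show "csubspace (\<Union>N. weight_filtration S N)"
        by (rule union_E_subspace[OF S(2) cft]) (fact B(2), fact B(3))
      show "S \<subseteq> (\<Union>N. weight_filtration S N)"
      proof
        fix s assume "s \<in> S"
        then have "wact [] s \<in> weight_filtration S 1"
          unfolding weight_filtration_def by (intro complex_vector.span_base CollectI exI[of _ "[]"] exI[of _ s]) simp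
        then show "s \<in> (\<Union>N. weight_filtration S N)" by auto
      qed
      have "weight_filtration S N \<subseteq> mcar M" for N
        by (rule E_mcar[OF S(2) cft]) (fact B(2), fact B(3))
      then show "(\<Union>N. weight_filtration S N) \<subseteq> mcar M" by (rule UN_least)
      fix a n u assume "u \<in> (\<Union>N. weight_filtration S N)"
      then obtain N where u: "u \<in> weight_filtration S N" by blast
      have "\<exists>N'. mode M a n u \<in> weight_filtration S N'"
        by (rule mode_union_E[OF S(2) cft _ _ u]) (fact B(2), fact B(3))
      then show "mode M a n u \<in> (\<Union>N. weight_filtration S N)" by blast
    qed
    then show ?thesis using E_W by blast
  qed
  ultimately show ?thesis using that by blast
qed

end

section \<open>Admissible and lowest-weight modules\<close>

lemma graded_unique:
  assumes "direct_sum G W" "x \<in> G i" "x \<in> G j" "x \<noteq> 0"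
  shows "i = j"
  using hcomp_homogeneous[OF assms(1,2), of j] hcomp_homogeneous[OF assms(1,3), of j] assms(4)
  by (simp split: if_splits)

lemma finite_dim_spanning_subset:
  assumes "finite_dim U"
  obtains C where "finite C" "C \<subseteq> U" "U \<subseteq> cspan C"
proof -
  obtain C where C: "C \<subseteq> U" "complex_vector.independent C" "U \<subseteq> cspan C"
    using complex_vector.maximal_independent_subset[of U] by blast
  obtain B where B: "finite B" "U \<subseteq> cspan B"
    using assms unfolding finite_dim_def by blast
  have "finite C"
    using complex_vector.independent_span_bound[OF B(1) C(2)] C(1) B(2) by blast
  with C show ?thesis using that by blast
qed

lemma free_words_support:
  assumes "y \<in> free_words U" "y (w, u) \<noteq> 0"
  shows "u \<in> U"
proof -
  have "csubspace {y :: 'a word \<times> 'b \<Rightarrow> complex. \<forall>w u. u \<notin> U \<longrightarrow> y (w, u) = 0}"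
    by (auto simp: complex_vector.subspace_def scaleC_fun_def scaleC_complex_def)
  moreover have "{tens w u | w u. u \<in> U} \<subseteq> {y :: 'a word \<times> 'b \<Rightarrow> complex. \<forall>w u. u \<notin> U \<longrightarrow> y (w, u) = 0}"
    by (auto simp: tens_def)
  ultimately have "free_words U \<subseteq> {y :: 'a word \<times> 'b \<Rightarrow> complex. \<forall>w u. u \<notin> U \<longrightarrow> y (w, u) = 0}"
    unfolding free_words_def by (rule complex_vector.span_minimal[rotated])
  then show ?thesis using assms by blast
qed

text \<open>The image of the canonical map consists of combinations of words applied to
  \<open>U\<close>, so its surjectivity says that \<open>U\<close> generates the module.\<close>

lemma Verma_generated:
  fixes M :: "('a, 'b::complex_vector) vmod"
  assumes onto: "Verma_map M ` free_words U = mcar M" and N: "csubspace N" "U \<subseteq> N"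
    and closed: "\<And>a n u. u \<in> N \<Longrightarrow> mode M a n u \<in> N"
  shows "mcar M \<subseteq> N"
proof -
  have word: "word_act M w u \<in> N" if u: "u \<in> U" for w u
  proof (induction w)
    case Nil
    show ?case using u N(2) by (auto simp: word_act_def)
  next
    case (Cons x w)
    have "word_act M (x # w) u = mode M (fst x) (snd x) (word_act M w u)"
      by (simp add: word_act_def split_beta)
    also have "\<dots> \<in> N" by (rule closed[OF Cons])
    finally show ?case .
  qed
  have "Verma_map M y \<in> N" if y: "y \<in> free_words U" for y
    unfolding Verma_map_def
  proof (rule csubspace_Sum_any[OF N(1)])
    fix x :: "'a word \<times> 'b"
    obtain w u where x: "x = (w, u)" by (cases x) auto
    have "y (w, u) *\<^sub>C word_act M w u \<in> N"
    proof (cases "y (w, u) = 0")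
      case False
      then have "u \<in> U" by (rule free_words_support[OF y])
      from csubspace_scale[OF N(1) word[OF this]] show ?thesis .
    qed (simp add: csubspace_0[OF N(1)])
    then show "(case x of (w, u) \<Rightarrow> y (w, u) *\<^sub>C word_act M w u) \<in> N" by (simp add: x)
  qed
  then have "Verma_map M ` free_words U \<subseteq> N" by (rule image_subsetI)
  then show ?thesis by (simp only: onto)
qed

section \<open>Graded spanning sets, and finiteness of the bottom level\<close>

locale admissible_module = twisted_voa V g T
  for V :: "'v::complex_vector voa" and g T +
  fixes M :: "('v, 'm::complex_vector) vmod"
  assumes adm: "admissible_twisted_module V g T M"
begin

sublocale twisted_module V g T M
  using adm by unfold_locales (simp add: admissible_twisted_module_def)

lemma grading_M: "direct_sum (mgr M) (mcar M)"
  using adm by (simp add: admissible_twisted_module_def)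

lemma mgr_support: "n \<notin> {of_nat i / of_nat T | i :: nat. True} \<Longrightarrow> mgr M n = {0}"
  using adm by (simp add: admissible_twisted_module_def)

lemma mode_degree: "a \<in> VGr V k \<Longrightarrow> u \<in> mgr M n \<Longrightarrow> mode M a m u \<in> mgr M (of_nat k - m - 1 + n)"
  using adm by (simp add: admissible_twisted_module_def)

lemma mgr_mcar: "u \<in> mgr M n \<Longrightarrow> u \<in> mcar M"
  using graded_piece_subset[OF grading_M] by blast

lemma mgr_negative: "n < 0 \<Longrightarrow> mgr M n = {0}"
proof (rule mgr_support)
  assume "n < 0"
  moreover have "0 \<le> (of_nat i / of_nat T :: rat)" for i by simp
  ultimately show "n \<notin> {of_nat i / of_nat T | i :: nat. True}" by (auto simp: not_le[symmetric])
qed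

lemma mode_negative_degree:
  "a \<in> VGr V k \<Longrightarrow> u \<in> mgr M n \<Longrightarrow> of_nat k - m - 1 + n < 0 \<Longrightarrow> mode M a m u = 0"
  using mode_degree[of a k u n m] mgr_negative by auto

lemma mgr_subspace: "csubspace (mgr M n)"
  using graded_piece_subspace[OF grading_M] .

text \<open>The vectors \<open>A k\<close> are left open because \<open>M\<^sup>1\<close> is \<open>g\<^sub>1\<close>-twisted, whereas the residue identity
  wants eigenvectors of \<open>g\<^sub>2\<close>.\<close>

lemma homogeneous_cofinite:
  assumes cft: "CFT_type V" and c2: "C2_cofinite V" and fg: "finitely_generated M"
    and A: "\<And>k. A k \<subseteq> VGr V k" "\<And>k. VGr V k \<subseteq> cspan (A k)"
  obtains F where "finite F" "\<And>n v. (n, v) \<in> F \<Longrightarrow> v \<in> mgr M n"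
    "\<And>n. mgr M n \<subseteq> cspan ({v. (n, v) \<in> F} \<union> {mode M a m x | a m x k p.
      a \<in> A k \<and> m < -1 \<and> x \<in> mgr M p \<and> n = of_nat k - m - 1 + p})"
proof -
  obtain F0 where F0: "finite F0" "F0 \<subseteq> mcar M"
    "mcar M \<subseteq> cspan (F0 \<union> {mode M a n x | a n x. n < -1 \<and> x \<in> mcar M})"
    by (rule finitely_generated_cofinite[OF cft c2 fg])
  \<comment> \<open>Only nonzero components are kept: this makes \<open>F\<close> finite and the
    degree of each member unique.\<close>
  define F where "F = (\<Union>f\<in>F0. (\<lambda>n. (n, hcomp (mgr M) f n)) ` {n. hcomp (mgr M) f n \<noteq> 0})"
  define Y where "Y = {mode M a m x | a m x k p. a \<in> A k \<and> m < -1 \<and> x \<in> mgr M p}"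
  have finF: "finite F"
    unfolding F_def using F0(1,2) finite_hcomp[OF grading_M] by auto
  have F_mgr: "v \<in> mgr M n \<and> v \<noteq> 0" if "(n, v) \<in> F" for n v
    using that F0(2) hcomp_in[OF grading_M] by (auto simp: F_def)
  have F_nonzero: "n = n'" if "(n, v) \<in> F" "v \<in> mgr M n'" for n n' v
    by (rule graded_unique[OF grading_M _ that(2)]) (simp_all add: F_mgr[OF that(1)])
  let ?Y = "snd ` F \<union> Y"
  have span: "mcar M \<subseteq> cspan ?Y"
  proof -
    have "f \<in> cspan ?Y" if f: "f \<in> F0" for f
    proof -
      have fM: "f \<in> mcar M" using f F0(2) by blast
      have "hcomp (mgr M) f n \<in> cspan ?Y" for n
      proof (cases "hcomp (mgr M) f n = 0")
        case False
        then have "(n, hcomp (mgr M) f n) \<in> F" using f by (auto simp: F_def)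
        then have "hcomp (mgr M) f n \<in> ?Y" by force
        then show ?thesis by (rule complex_vector.span_base)
      qed (simp add: complex_vector.span_zero)
      then have "Sum_any (hcomp (mgr M) f) \<in> cspan ?Y"
        by (rule csubspace_Sum_any[OF complex_vector.subspace_span])
      then show ?thesis by (simp only: Sum_any_hcomp[OF grading_M fM])
    qed
    moreover have "mode M a n x \<in> cspan ?Y" if n: "n < -1" and x: "x \<in> mcar M" for a n x
    proof -
      have hom: "mode M a n (hcomp (mgr M) x p) \<in> cspan ?Y" for p
      proof -
        let ?x = "hcomp (mgr M) x p"
        have xp: "?x \<in> mgr M p" using hcomp_in[OF grading_M x] .
        have lin: "clinear_on UNIV (\<lambda>a. mode M a n ?x)"
          by (rule clinear_on_mode_left[OF mgr_mcar[OF xp]])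
        have "mode M (hcomp (VGr V) a k) n ?x \<in> cspan ?Y" for k
        proof (rule clinear_on_span[OF lin, where Y = "A k"])
          show "hcomp (VGr V) a k \<in> cspan (A k)" using A(2) hcomp_in[OF grading, of a k] by auto
          fix y assume "y \<in> A k"
          then have "mode M y n ?x \<in> Y" unfolding Y_def using n xp by blast
          then show "mode M y n ?x \<in> cspan ?Y" by (intro complex_vector.span_base UnI2)
        qed (simp_all add: complex_vector.subspace_span)
        from csubspace_Sum_any[OF complex_vector.subspace_span this]
        have "Sum_any (\<lambda>k. mode M (hcomp (VGr V) a k) n ?x) \<in> cspan ?Y" .
        moreover have "mode M (Sum_any (hcomp (VGr V) a)) n ?x = Sum_any (\<lambda>k. mode M (hcomp (VGr V) a k) n ?x)"
          by (rule clinear_on_Sum_any[OF lin]) (simp_all add: finite_hcomp[OF grading])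
        ultimately show ?thesis by (simp add: Sum_any_hcomp[OF grading])
      qed
      have "mode M a n (Sum_any (hcomp (mgr M) x)) = Sum_any (\<lambda>p. mode M a n (hcomp (mgr M) x p))"
        by (rule clinear_on_Sum_any[OF clinear_on_mode mcar_subspace])
          (use hcomp_in[OF grading_M x] mgr_mcar finite_hcomp[OF grading_M x] in auto)
      with csubspace_Sum_any[OF complex_vector.subspace_span hom] show ?thesis
        by (simp add: Sum_any_hcomp[OF grading_M x])
    qed
    ultimately have "F0 \<union> {mode M a n x | a n x. n < -1 \<and> x \<in> mcar M} \<subseteq> cspan ?Y" by blast
    from complex_vector.span_minimal[OF this complex_vector.subspace_span] F0(3) show ?thesis
      by blast
  qed
  have Y_deg: "mode M a m x \<in> mgr M (of_nat k - m - 1 + p)" if "a \<in> A k" "x \<in> mgr M p" for a m x k p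
    using mode_degree[of a k x p m] subsetD[OF A(1) that(1)] that(2) by simp
  have Y_hom: "?Y \<subseteq> (\<Union>n. mgr M n)"
  proof
    fix y assume "y \<in> ?Y"
    then show "y \<in> (\<Union>n. mgr M n)"
    proof
      assume "y \<in> snd ` F"
      then obtain n where "(n, y) \<in> F" by auto
      then show ?thesis using F_mgr[of n y] by blast
    next
      assume "y \<in> Y"
      then obtain a m x k p where y: "y = mode M a m x" "a \<in> A k" "x \<in> mgr M p"
        unfolding Y_def by blast
      from Y_deg[OF y(2,3)] show ?thesis unfolding y(1) by blast
    qed
  qed
  show ?thesis
  proof (rule that[OF finF])
    show "v \<in> mgr M n" if "(n, v) \<in> F" for n v using F_mgr[OF that] by blast
    fix n
    let ?Z = "{v. (n, v) \<in> F} \<union> {mode M a m x | a m x k p.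
      a \<in> A k \<and> m < -1 \<and> x \<in> mgr M p \<and> n = of_nat k - m - 1 + p}"
    have "?Y \<inter> mgr M n \<subseteq> insert 0 ?Z"
    proof
      fix y assume y: "y \<in> ?Y \<inter> mgr M n"
      show "y \<in> insert 0 ?Z"
      proof (cases "y = 0")
        case False
        have yn: "y \<in> mgr M n" and "y \<in> snd ` F \<or> y \<in> Y" using y by simp_all
        from this(2) show ?thesis
        proof
          assume "y \<in> snd ` F"
          then obtain n' where n': "(n', y) \<in> F" by auto
          with F_nonzero[OF n' yn] show ?thesis by simp
        next
          assume "y \<in> Y"
          then obtain a m x k p where 2: "y = mode M a m x" "a \<in> A k" "m < -1" "x \<in> mgr M p"
            unfolding Y_def by blast
          have "y \<in> mgr M (of_nat k - m - 1 + p)" unfolding 2(1) by (rule Y_deg[OF 2(2,4)])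
          then have "n = of_nat k - m - 1 + p"
            by (rule graded_unique[OF grading_M yn _ False])
          with 2 have "y \<in> ?Z" by (intro UnI2 CollectI exI conjI)
          then show ?thesis by simp
        qed
      qed simp
    qed
    then have sub: "cspan (?Y \<inter> mgr M n) \<subseteq> cspan ?Z"
      using complex_vector.span_mono[of "?Y \<inter> mgr M n" "insert 0 ?Z"]
      by (simp only: complex_vector.span_insert_0)
    show "mgr M n \<subseteq> cspan ?Z"
    proof
      fix x assume x: "x \<in> mgr M n"
      have "x \<in> cspan ?Y" using span mgr_mcar[OF x] by blast
      from hcomp_span[OF grading_M this Y_hom, of n]
      show "x \<in> cspan ?Z" using hcomp_homogeneous[OF grading_M x, of n] sub by auto
    qed
  qed
qed

lemma zero_mode_homogeneous:
  assumes "a \<in> VGr V k" "u \<in> mcar M"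
  shows "zero_mode V M a u = mode M a (of_nat k - 1) u"
  unfolding zero_mode_def
  by (subst Sum_any_single[of k]) (simp_all add: hcomp_homogeneous[OF grading assms(1)] assms(2))

text \<open>In Borcherds' identity at n = -2 all double products vanish on a bottom vector if m > wt
  c - 1 and k > wt d - 1. What remains expresses the zero mode of c_(-2) d through those of the
  c_(-1+j) d, which have lower weight.\<close>

lemma zero_mode_C2_vanishing:
  assumes c: "c \<in> homs i" and d: "d \<in> homs l" and u: "u \<in> mgr M 0" and W: "csubspace W"
    and lower: "\<And>j b. j < i + l + 1 \<Longrightarrow> b \<in> homs j \<Longrightarrow> mode M b (of_nat j - 1) u \<in> W"
  shows "mode M (VY V c (-2) d) (of_nat (i + l + 1) - 1) u \<in> W"
proof -
  have uM: "u \<in> mcar M" using mgr_mcar[OF u] .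
  obtain r s where rs: "r < T" "c \<in> sector g T r" "s < T" "d \<in> sector g T s"
    using c d by (auto simp: homs_def)
  let ?r = "of_nat r / of_nat T :: rat" and ?s = "of_nat s / of_nat T :: rat"
  have r1: "0 \<le> ?r" "?r < 1" "r \<noteq> 0 \<Longrightarrow> 0 < ?r" using rs(1) by simp_all
  show ?thesis
  proof (cases "?r + ?s \<in> \<int>")
    \<comment> \<open>Here c_(-2) d lies in a sector other than the fixed one, and integral indices
      give the mode 0.\<close>
    case False
    have "of_nat (r + s) / of_nat T
      = (of_nat ((r + s) div T) :: rat) + of_nat ((r + s) mod T) / of_nat T"
      using T_pos by (simp add: field_simps flip: of_nat_add of_nat_mult)
    then have eq: "?r + ?s = of_nat ((r + s) div T) + of_nat ((r + s) mod T) / of_nat T"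
      by (simp add: add_divide_distrib)
    have "of_nat (i + l + 1) - 1 - of_nat ((r + s) mod T) / of_nat T \<notin> (\<int> :: rat set)"
    proof
      assume *: "of_nat (i + l + 1) - 1 - of_nat ((r + s) mod T) / of_nat T \<in> (\<int> :: rat set)"
      have "of_nat (i + l) + of_nat ((r + s) div T)
        - (of_nat (i + l + 1) - 1 - of_nat ((r + s) mod T) / of_nat T) \<in> (\<int> :: rat set)"
        by (intro Ints_diff Ints_add *) simp_all
      then show False using False unfolding eq by simp
    qed
    then have "mode M (VY V c (-2) d) (of_nat (i + l + 1) - 1) u = 0"
      using mode_sector[OF _ VY_sector[OF rs(2,4)] _ uM] T_pos by simp
    then show ?thesis using csubspace_0[OF W] by simp
  next
    case True
    \<comment> \<open>The index m + k must be i + l, so \<open>m\<close> has to lie strictly between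
      i - 1 and i + 1. This is the representative of r/T + \<int> in the left half of that interval,
      closed at i.\<close>
    define m where "m = (if r = 0 then of_nat i else of_nat i - 1 + ?r)"
    define k where "k = of_nat (i + l) - m"
    have mZ: "m - ?r \<in> \<int>" by (simp add: m_def)
    have "of_nat (i + l) - (m - ?r) - (?r + ?s) \<in> \<int>"
      by (intro Ints_diff mZ True) simp
    also have "of_nat (i + l) - (m - ?r) - (?r + ?s) = k - ?s" by (simp add: k_def)
    finally have kZ: "k - ?s \<in> \<int>" .
    have mb: "m - of_nat i - 1 < 0" "of_nat i - m - 1 < 0"
      using r1 by (simp_all add: m_def)
    have d0: "mode M d (k + of_nat j) u = 0" for j
      by (rule mode_negative_degree[OF homs_VGr[OF d] u]) (use mb(1) in \<open>simp add: k_def\<close>)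
    have c0: "mode M c (m + of_nat j) u = 0" for j
      by (rule mode_negative_degree[OF homs_VGr[OF c] u]) (use mb(2) in simp)
    let ?f = "\<lambda>j. ((of_rat m :: complex) gchoose j) *\<^sub>C
           mode M (VY V c (-2 + int j) d) (m + k - of_nat j) u"
    have "Sum_any ?f = 0"
      using mode_Borcherds[OF rs uM mZ kZ, of "-2"] by (simp add: d0 c0)
    moreover obtain N where N: "\<And>j. j \<ge> N \<Longrightarrow> VY V c (-2 + int j) d = 0"
      using VY_truncation_nat by blast
    then have "Sum_any ?f = ?f 0 + Sum_any (\<lambda>j. ?f (Suc j))"
      by (intro Sum_any_nat_split[of N]) (simp add: uM)
    ultimately have f0: "?f 0 = - Sum_any (\<lambda>j. ?f (Suc j))"
      by (simp add: eq_neg_iff_add_eq_0)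
    have "mode M (VY V c (-2 + int (Suc j)) d) (m + k - of_nat (Suc j)) u \<in> W" for j
    proof (cases "j \<le> i + l")
      case True
      have h: "VY V c (-2 + int (Suc j)) d \<in> homs (i + l - j)"
        using True by (intro VY_homs[OF _ c d]) auto
      have eq: "m + k - of_nat (Suc j) = of_nat (i + l - j) - 1"
        using True by (simp add: k_def of_nat_diff)
      show ?thesis unfolding eq by (rule lower[OF _ h]) simp
    next
      case False
      then have "VY V c (-2 + int (Suc j)) d = 0"
        by (intro VY_negative_weight[OF homs_VGr[OF c] homs_VGr[OF d]]) simp
      then show ?thesis using uM csubspace_0[OF W] by simp
    qed
    then have "Sum_any (\<lambda>j. ?f (Suc j)) \<in> W"
      by (intro csubspace_Sum_any[OF W] csubspace_scale[OF W])
    then have "?f 0 \<in> W" unfolding f0 using csubspace_minus_iff[OF W] by blast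
    then show ?thesis by (simp add: k_def scaleC_one)
  qed
qed

text \<open>\<open>D\<close> is spanned by the zero modes of the finite set \<open>B\<close> applied
  to one vector \<open>u\<close>. By induction on the weight it contains every zero mode applied to
  \<open>u\<close>. It is invariant because a composite of two zero modes is the zero mode of their
  Zhu product, so by irreducibility it is the whole bottom level.\<close>

lemma bottom_finite_dim:
  assumes c2: "C2_cofinite V" and lw: "lowest_weight_module V g T M"
  shows "finite_dim (mgr M 0)"
proof -
  have irr: "irreducible_degree_zero V M (mgr M 0)" and quo: "quotient_of_Verma V g T M (mgr M 0)"
    using lw by (auto simp: lowest_weight_module_def Let_def)
  obtain B where B: "finite B" "\<And>k b. (k, b) \<in> B \<Longrightarrow> b \<in> homs k"
    "\<And>k a. a \<in> homs k \<Longrightarrow> a \<in> cspan ({b. (k, b) \<in> B} \<union> C2_gens k)"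
  proof (rule homogeneous_C2_spanning[OF c2])
    fix B assume "finite B" "\<And>k b. (k, b) \<in> B \<Longrightarrow> b \<in> homs k"
      "\<And>k a. a \<in> homs k \<Longrightarrow> a \<in> cspan ({b. (k, b) \<in> B} \<union> C2_gens k)"
    then show thesis by (rule that)
  qed
  have "mgr M 0 \<noteq> {0}" using irr by (simp add: irreducible_degree_zero_def)
  then obtain u where u: "u \<in> mgr M 0" "u \<noteq> 0"
    using csubspace_0[OF mgr_subspace, of 0] by blast
  have uM: "u \<in> mcar M" using mgr_mcar[OF u(1)] .
  define gens where "gens = (\<lambda>(k, b). mode M b (of_nat k - 1) u) ` B"
  define D where "D = cspan gens"
  have D: "csubspace D" by (simp add: D_def complex_vector.subspace_span)
  have bottom: "mode M a (of_nat k - 1) x \<in> mgr M 0" if "a \<in> VGr V k" "x \<in> mgr M 0" for a k x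
    using mode_degree[OF that, of "of_nat k - 1"] by simp
  have gens_bottom: "gens \<subseteq> mgr M 0"
    using bottom[OF homs_VGr[OF B(2)] u(1)] by (auto simp: gens_def)
  have D_bottom: "D \<subseteq> mgr M 0"
    unfolding D_def using gens_bottom mgr_subspace by (rule complex_vector.span_minimal)
  have homs_D: "a \<in> homs k \<Longrightarrow> mode M a (of_nat k - 1) u \<in> D" for a k
  proof (induction k arbitrary: a rule: less_induct)
    case (less k)
    show ?case
    proof (rule clinear_on_span[OF clinear_on_mode_left[OF uM] _ _ D _ B(3)[OF less.prems]])
      fix y assume "y \<in> {b. (k, b) \<in> B} \<union> C2_gens k"
      then show "mode M y (of_nat k - 1) u \<in> D"
      proof
        assume "y \<in> {b. (k, b) \<in> B}"
        then have "mode M y (of_nat k - 1) u \<in> gens" by (force simp: gens_def)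
        then show ?thesis unfolding D_def by (rule complex_vector.span_base)
      next
        assume "y \<in> C2_gens k"
        then obtain c d i l where y: "y = VY V c (-2) d" and c: "c \<in> homs i" and d: "d \<in> homs l"
          and k: "k = i + l + 1"
          unfolding C2_gens_def by blast
        show ?thesis unfolding y k
          by (rule zero_mode_C2_vanishing[OF c d u(1) D]) (rule less.IH, simp_all add: k)
      qed
    qed simp_all
  qed
  have VGr_D: "mode M a (of_nat k - 1) u \<in> D" if "a \<in> VGr V k" for a k
    by (rule clinear_on_span[OF clinear_on_mode_left[OF uM] _ _ D _ VGr_span_homs[OF that]])
      (simp_all add: homs_D)
  have zero_D: "zero_mode V M a u \<in> D" for a
    unfolding zero_mode_def using VGr_D hcomp_in[OF grading, of a]
    by (intro csubspace_Sum_any[OF D]) simp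
  have inv: "mode M a (of_nat k - 1) x \<in> D" if a: "a \<in> VGr V k" and x: "x \<in> D" for a k x
  proof -
    have "mode M a (of_nat k - 1) (mode M b (of_nat l - 1) u) \<in> D" if b: "b \<in> homs l" for b l
    proof -
      let ?v = "mode M b (of_nat l - 1) u"
      have v: "?v \<in> mgr M 0" using bottom[OF homs_VGr[OF b] u(1)] .
      show ?thesis
      proof (rule clinear_on_span[OF clinear_on_mode_left[OF mgr_mcar[OF v]] _ _ D _ VGr_span_homs[OF a]])
        fix y assume y: "y \<in> homs k"
        then obtain r where r: "r < T" "y \<in> sector g T r" by (auto simp: homs_def)
        show "mode M y (of_nat k - 1) ?v \<in> D"
        proof (cases "r = 0")
          case True
          then have y0: "y \<in> VGr V k \<inter> sector g T 0" using r homs_VGr[OF y] by simp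
          have "zero_mode V M (Zhu_prod V k y b) u = zero_mode V M y (zero_mode V M b u)"
            using quo u(1) y0 unfolding quotient_of_Verma_def Zhu_module_def by blast
          also have "\<dots> = mode M y (of_nat k - 1) ?v"
            unfolding zero_mode_homogeneous[OF homs_VGr[OF b] uM]
            by (rule zero_mode_homogeneous[OF homs_VGr[OF y] mgr_mcar[OF v]])
          finally show ?thesis using zero_D by metis
        next
          case False
          \<comment> \<open>Outside the fixed sector the zero mode vanishes, its index being an
            integer while r/T is not.\<close>
          have "of_nat k - 1 - of_nat r / of_nat T \<notin> (\<int> :: rat set)"
          proof
            assume *: "of_nat k - 1 - of_nat r / of_nat T \<in> (\<int> :: rat set)"
            have "of_nat k - 1 - (of_nat k - 1 - of_nat r / of_nat T) \<in> (\<int> :: rat set)"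
              by (intro Ints_diff *) simp_all
            then have "of_nat r / of_nat T \<in> (\<int> :: rat set)" by simp
            then obtain z where z: "of_nat r / of_nat T = (of_int z :: rat)" by (auto simp: Ints_def)
            have "0 < (of_nat r / of_nat T :: rat)" "of_nat r / of_nat T < (1 :: rat)"
              using False r(1) by simp_all
            then show False unfolding z by simp
          qed
          then have "mode M y (of_nat k - 1) ?v = 0"
            using mode_sector[OF r _ mgr_mcar[OF v]] by simp
          then show ?thesis using csubspace_0[OF D] by simp
        qed
      qed simp_all
    qed
    then have gens: "mode M a (of_nat k - 1) y \<in> D" if "y \<in> gens" for y
      using that B(2) by (auto simp: gens_def)
    show ?thesis
    proof (rule clinear_on_span[OF clinear_on_mode mcar_subspace _ D gens])
      show "gens \<subseteq> mcar M" using gens_bottom mgr_mcar by blast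
      show "x \<in> cspan gens" using x by (simp add: D_def)
    qed
  qed
  \<comment> \<open>The zero mode of the vacuum has index 0 - 1 and is the identity.\<close>
  have "u \<in> D"
    using VGr_D[OF vac_VGr] by (simp add: mode_vac[OF uM])
  then have "D \<noteq> {0}" using u(2) by blast
  moreover have "D = {0} \<or> D = mgr M 0"
    using irr D D_bottom inv unfolding irreducible_degree_zero_def by blast
  ultimately have "mgr M 0 \<subseteq> cspan gens" by (simp add: D_def)
  moreover have "finite gens" using B(1) by (simp add: gens_def)
  ultimately show ?thesis unfolding finite_dim_def by blast
qed

lemma generated_by_bottom:
  assumes "lowest_weight_module V g T M" "csubspace N" "mgr M 0 \<subseteq> N"
    "\<And>a n u. u \<in> N \<Longrightarrow> mode M a n u \<in> N"
  shows "mcar M \<subseteq> N"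
proof -
  have "quotient_of_Verma V g T M (mgr M 0)"
    using assms(1) by (auto simp: lowest_weight_module_def Let_def)
  then have "Verma_map M ` free_words (mgr M 0) = mcar M"
    by (simp add: quotient_of_Verma_def)
  from Verma_generated[OF this assms(2,3,4)] show ?thesis .
qed

text \<open>This reduces the second case of the theorem to a finitely generated
  \<open>M1\<close>.\<close>

lemma lowest_weight_finitely_generated:
  assumes c2: "C2_cofinite V" and lw: "lowest_weight_module V g T M"
  shows "finitely_generated M"
proof -
  obtain C where C: "finite C" "C \<subseteq> mgr M 0" "mgr M 0 \<subseteq> cspan C"
    using finite_dim_spanning_subset[OF bottom_finite_dim[OF c2 lw]] .
  show ?thesis
    unfolding finitely_generated_def
  proof (intro exI[of _ C] conjI allI impI)
    show "C \<subseteq> mcar M" using C(2) mgr_mcar by blast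
    fix N assume N: "csubspace N \<and> C \<subseteq> N \<and> N \<subseteq> mcar M \<and> (\<forall>a n. \<forall>u\<in>N. mode M a n u \<in> N)"
    then have "mgr M 0 \<subseteq> N" using complex_vector.span_minimal[of C N] C(3) by blast
    then have "mcar M \<subseteq> N" using generated_by_bottom[OF lw, of N] N by blast
    then show "N = mcar M" using N by blast
  qed (rule C(1))
qed

end

section \<open>Intertwining operators\<close>

context admissible_module
begin

text \<open>While such a word is built up, its degree never exceeds the final one. The induction on
  the degree in \<open>M2\<close> relies on this.\<close>

inductive nonneg_word :: "rat \<Rightarrow> 'm \<Rightarrow> bool" where
  bottom: "u \<in> mgr M 0 \<Longrightarrow> nonneg_word 0 u"
| letter: "nonneg_word e x \<Longrightarrow> a \<in> homs k \<Longrightarrow> of_nat k - m - 1 \<ge> 0 \<Longrightarrow>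
    nonneg_word (of_nat k - m - 1 + e) (mode M a m x)"

lemma nonneg_word_mgr: "nonneg_word e x \<Longrightarrow> x \<in> mgr M e \<and> 0 \<le> e"
proof (induction rule: nonneg_word.induct)
  case (letter e x a k m)
  then show ?case using mode_degree[OF homs_VGr[OF letter.hyps(2)], of x e m] by simp
qed simp

definition nonneg_span :: "'m set" where
  "nonneg_span = cspan {x. \<exists>e. nonneg_word e x}"

lemma nonneg_span_subspace: "csubspace nonneg_span"
  unfolding nonneg_span_def by (rule complex_vector.subspace_span)

lemma nonneg_word_span: "nonneg_word e x \<Longrightarrow> x \<in> nonneg_span"
  unfolding nonneg_span_def by (rule complex_vector.span_base) blast

lemma nonneg_words_mcar: "{x. \<exists>e. nonneg_word e x} \<subseteq> mcar M"
proof
  fix x assume "x \<in> {x. \<exists>e. nonneg_word e x}"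
  then obtain e where "nonneg_word e x" by blast
  then show "x \<in> mcar M" using nonneg_word_mgr[of e x] mgr_mcar[of x e] by simp
qed

lemma nonneg_mode_span:
  assumes "a \<in> homs k" "of_nat k - m - 1 \<ge> 0" "x \<in> nonneg_span"
  shows "mode M a m x \<in> nonneg_span"
proof (rule clinear_on_span[OF clinear_on_mode mcar_subspace nonneg_words_mcar nonneg_span_subspace])
  show "x \<in> cspan {x. \<exists>e. nonneg_word e x}" using assms(3) by (simp only: nonneg_span_def)
  fix y assume "y \<in> {x. \<exists>e. nonneg_word e x}"
  then obtain e where "nonneg_word e y" by blast
  from nonneg_word.letter[OF this assms(1,2)] show "mode M a m y \<in> nonneg_span"
    by (rule nonneg_word_span)
qed

text \<open>The new letter is commuted to the right. The commutator consists of modes acting on the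
  shorter word, and a lowering letter that arrives at the bottom level gives 0.\<close>

lemma mode_nonneg_word:
  "nonneg_word e x \<Longrightarrow> a \<in> homs k \<Longrightarrow> mode M a m x \<in> nonneg_span"
proof (induction arbitrary: a k m rule: nonneg_word.induct)
  case (bottom u)
  show ?case
  proof (cases "of_nat k - m - 1 \<ge> 0")
    case True
    from nonneg_word.letter[OF nonneg_word.bottom[OF bottom.hyps] bottom.prems True]
    show ?thesis by (rule nonneg_word_span)
  next
    case False
    then have "mode M a m u = 0"
      using mode_negative_degree[OF homs_VGr[OF bottom.prems] bottom.hyps, of m] by simp
    then show ?thesis using csubspace_0[OF nonneg_span_subspace] by simp
  qed
next
  case (letter e y b l q)
  have yM: "y \<in> mcar M"
    using nonneg_word_mgr[OF letter.hyps(1)] mgr_mcar[of y e] by simp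
  obtain r s where rs: "r < T" "a \<in> sector g T r" "s < T" "b \<in> sector g T s"
    using letter.prems letter.hyps(2) by (auto simp: homs_def)
  have "mode M a m (mode M b q y) - mode M b q (mode M a m y) \<in> nonneg_span"
  proof (rule mode_commutator_in[OF rs yM nonneg_span_subspace])
    fix j p
    show "mode M (VY V a (int j) b) p y \<in> nonneg_span"
    proof (cases "int k + int l - int j - 1 < 0")
      case True
      then have "VY V a (int j) b = 0"
        by (rule VY_negative_weight[OF homs_VGr[OF letter.prems] homs_VGr[OF letter.hyps(2)]])
      then show ?thesis using yM csubspace_0[OF nonneg_span_subspace] by simp
    next
      case False
      then have "VY V a (int j) b \<in> homs (nat (int k + int l - int j - 1))"
        by (intro VY_homs[OF _ letter.prems letter.hyps(2)]) simp_all
      then show ?thesis by (rule letter.IH)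
    qed
  qed
  moreover have "mode M b q (mode M a m y) \<in> nonneg_span"
    by (rule nonneg_mode_span[OF letter.hyps(2,3) letter.IH[OF letter.prems]])
  ultimately have "mode M a m (mode M b q y) - mode M b q (mode M a m y)
     + mode M b q (mode M a m y) \<in> nonneg_span"
    by (rule csubspace_add[OF nonneg_span_subspace])
  then show ?case by simp
qed

text \<open>The span of all these words is stable under all modes and contains the bottom level, so
  it is everything; projecting to degree \<open>e\<close> then selects the words of that
  degree.\<close>

lemma mgr_nonneg_span:
  assumes "lowest_weight_module V g T M"
  shows "mgr M e \<subseteq> cspan {x. nonneg_word e x}"
proof
  have closed: "mode M a n u \<in> nonneg_span" if u: "u \<in> nonneg_span" for a n u
  proof (rule clinear_on_span[OF clinear_on_mode mcar_subspace nonneg_words_mcar nonneg_span_subspace])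
    show "u \<in> cspan {x. \<exists>e. nonneg_word e x}" using u by (simp only: nonneg_span_def)
    fix y assume "y \<in> {x. \<exists>e. nonneg_word e x}"
    then obtain e where y: "nonneg_word e y" by blast
    then have yM: "y \<in> mcar M" using nonneg_word_mgr[OF y] mgr_mcar[of y e] by simp
    show "mode M a n y \<in> nonneg_span"
      by (rule homs_linear_induct[OF clinear_on_mode_left[OF yM] nonneg_span_subspace])
        (rule mode_nonneg_word[OF y])
  qed
  have "mgr M 0 \<subseteq> nonneg_span"
    using nonneg_word_span[OF nonneg_word.bottom] by (rule subsetI)
  from generated_by_bottom[OF assms nonneg_span_subspace this closed]
  have all: "mcar M \<subseteq> nonneg_span" .
  have hom: "{x. \<exists>e. nonneg_word e x} \<subseteq> (\<Union>n. mgr M n)"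
    using nonneg_word_mgr by fast
  fix x assume x: "x \<in> mgr M e"
  have "x \<in> cspan {x. \<exists>e. nonneg_word e x}"
    using subsetD[OF all mgr_mcar[OF x]] by (simp only: nonneg_span_def)
  from hcomp_span[OF grading_M this hom, of e]
  have "x \<in> cspan ({x. \<exists>e. nonneg_word e x} \<inter> mgr M e)"
    by (simp add: hcomp_homogeneous[OF grading_M x])
  moreover have "{x. \<exists>e. nonneg_word e x} \<inter> mgr M e \<subseteq> insert 0 {x. nonneg_word e x}"
  proof
    fix y assume "y \<in> {x. \<exists>e. nonneg_word e x} \<inter> mgr M e"
    then obtain e' where y: "nonneg_word e' y" "y \<in> mgr M e" by blast
    show "y \<in> insert 0 {x. nonneg_word e x}"
    proof (cases "y = 0")
      case False
      have "e' = e"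
        by (rule graded_unique[OF grading_M _ y(2) False]) (use nonneg_word_mgr[OF y(1)] in simp)
      then show ?thesis using y(1) by simp
    qed simp
  qed
  from complex_vector.span_mono[OF this]
  have "cspan ({x. \<exists>e. nonneg_word e x} \<inter> mgr M e) \<subseteq> cspan {x. nonneg_word e x}"
    by (simp only: complex_vector.span_insert_0)
  ultimately show "x \<in> cspan {x. nonneg_word e x}" by (rule subsetD[rotated])
qed

abbreviation bottom_part :: "'m \<Rightarrow> 'm" where
  "bottom_part x \<equiv> hcomp (mgr M) x 0"

lemma bottom_part_0 [simp]: "bottom_part 0 = 0"
  using clinear_on_0[OF clinear_on_hcomp[OF grading_M] mcar_subspace] .

lemma bottom_part_other: "x \<in> mgr M n \<Longrightarrow> n \<noteq> 0 \<Longrightarrow> bottom_part x = 0"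
  by (simp add: hcomp_homogeneous[OF grading_M])

text \<open>A mode that does not lower the degree reaches degree 0 only from degrees at most 0.
  Negative degrees are empty, and degree 0 contributes only if the mode preserves degrees.\<close>

lemma bottom_part_mode:
  assumes a: "a \<in> VGr V k" and x: "x \<in> mcar M" and deg: "of_nat k - m - 1 \<ge> 0"
    "of_nat k - m - 1 > 0 \<or> bottom_part x = 0"
  shows "bottom_part (mode M a m x) = 0"
proof -
  have xi: "hcomp (mgr M) x i \<in> mgr M i" for i by (rule hcomp_in[OF grading_M x])
  have fin: "finite {i. mode M a m (hcomp (mgr M) x i) \<noteq> 0}"
    by (rule finite_subset[OF _ finite_hcomp[OF grading_M x]]) auto
  have "mode M a m (Sum_any (hcomp (mgr M) x)) = Sum_any (\<lambda>i. mode M a m (hcomp (mgr M) x i))"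
    by (rule clinear_on_Sum_any[OF clinear_on_mode mcar_subspace mgr_mcar[OF xi] finite_hcomp[OF grading_M x]])
  then have "mode M a m x = Sum_any (\<lambda>i. mode M a m (hcomp (mgr M) x i))"
    by (simp only: Sum_any_hcomp[OF grading_M x])
  also have "bottom_part \<dots> = Sum_any (\<lambda>i. bottom_part (mode M a m (hcomp (mgr M) x i)))"
    by (rule clinear_on_Sum_any[OF clinear_on_hcomp[OF grading_M] mcar_subspace mode_in[OF mgr_mcar[OF xi]] fin])
  finally have eq: "bottom_part (mode M a m x) = Sum_any (\<lambda>i. bottom_part (mode M a m (hcomp (mgr M) x i)))" .
  have "bottom_part (mode M a m (hcomp (mgr M) x i)) = 0" for i
    proof (cases "of_nat k - m - 1 + i = 0")
      case False
      from bottom_part_other[OF mode_degree[OF a xi] False] show ?thesis .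
    next
      case True
      then have "i < 0 \<or> i = 0 \<and> bottom_part x = 0" using deg by auto
      then have "hcomp (mgr M) x i = 0" using xi[of i] mgr_negative[of i] by auto
      then show ?thesis by simp
    qed
  then show ?thesis unfolding eq by simp
qed

end

text \<open>The last assumptions encode g1 = g2^\<epsilon> and g3 = g2^(1+\<epsilon>) through
  eigenvalues. Exponents are reduced modulo \<open>T\<close> since the module axioms speak of
  sectors with index below \<open>T\<close>.\<close>

locale fusion_setting =
  m1: admissible_module V g1 T M1 + m2: admissible_module V g2 T M2 + m3: admissible_module V g3 T M3
  for V :: "'v::complex_vector voa" and g1 g2 g3 :: "'v \<Rightarrow> 'v" and T :: nat
    and M1 :: "('v, 'm1::complex_vector) vmod" and M2 :: "('v, 'm2::complex_vector) vmod"
    and M3 :: "('v, 'm3::complex_vector) vmod" +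
  fixes \<epsilon> :: int and \<zeta> h1 h2 h3 :: complex
  assumes sector1: "a \<in> sector g2 T r \<Longrightarrow> a \<in> sector g1 T (nat (\<epsilon> * int r mod int T))"
    and sector3: "a \<in> sector g2 T r \<Longrightarrow> a \<in> sector g3 T (nat ((1 + \<epsilon>) * int r mod int T))"
    and \<zeta>: "\<zeta> \<noteq> 0"
    and cw1: "conformal_weight V M1 h1" and cw2: "conformal_weight V M2 h2"
    and cw3: "conformal_weight V M3 h3"
begin

abbreviation "IO \<equiv> intertwining_operators V g2 T \<epsilon> \<zeta> (h1 + h2 - h3) M1 M2 M3"

lemmas IO_conjs = intertwining_operators_def[of V g2 T \<epsilon> \<zeta> "h1 + h2 - h3" M1 M2 M3,
  THEN equalityD1, THEN subsetD, unfolded mem_Collect_eq]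

lemma IO_outside: "I \<in> IO \<Longrightarrow> v \<notin> mcar M1 \<or> u \<notin> mcar M2 \<Longrightarrow> I v n u = 0"
  using IO_conjs[of I, THEN conjunct1] by simp

lemma IO_in: "I \<in> IO \<Longrightarrow> v \<in> mcar M1 \<Longrightarrow> u \<in> mcar M2 \<Longrightarrow> I v n u \<in> mcar M3"
  using IO_conjs[of I, THEN conjunct2, THEN conjunct1] by simp

lemma IO_linear_left:
  assumes "I \<in> IO" "u \<in> mcar M2"
  shows "clinear_on (mcar M1) (\<lambda>v. I v n u)"
  using IO_conjs[OF assms(1), THEN conjunct2, THEN conjunct2, THEN conjunct1]
    IO_conjs[OF assms(1), THEN conjunct2, THEN conjunct2, THEN conjunct2, THEN conjunct1] assms(2)
  unfolding clinear_on_def by simp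

lemma IO_linear_right:
  assumes "I \<in> IO" "v \<in> mcar M1"
  shows "clinear_on (mcar M2) (I v n)"
  using IO_conjs[OF assms(1), THEN conjunct2, THEN conjunct2, THEN conjunct2, THEN conjunct2, THEN conjunct1]
    IO_conjs[OF assms(1), THEN conjunct2, THEN conjunct2, THEN conjunct2, THEN conjunct2, THEN conjunct2, THEN conjunct1]
    assms(2)
  unfolding clinear_on_def by simp

lemma IO_truncation:
  assumes "I \<in> IO" "v \<in> mcar M1" "u \<in> mcar M2"
  shows "\<exists>N. \<forall>n\<ge>N. I v n u = 0"
  using IO_conjs[OF assms(1), THEN conjunct2, THEN conjunct2, THEN conjunct2, THEN conjunct2, THEN conjunct2,
      THEN conjunct2, THEN conjunct1] assms(2,3) by blast

text \<open>The residue identity is split into three sums, each named after the module on which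
  \<open>a\<close> acts.\<close>

definition Jacobi_M3 where
  "Jacobi_M3 I a v u \<alpha> \<beta> k = Sum_any (\<lambda>j. ((-1) ^ j * ((of_rat \<beta> :: complex) gchoose j)) *\<^sub>C
          mode M3 a (\<alpha> + \<beta> - of_nat j) (I v (k + of_nat j) u))"

definition Jacobi_M2 where
  "Jacobi_M2 I a v u \<alpha> \<beta> k = Sum_any (\<lambda>j. (\<zeta> powi \<lfloor>of_nat T * (\<beta> - of_nat j)\<rfloor> * ((of_rat \<beta> :: complex) gchoose j)) *\<^sub>C
          (I v (k + \<beta> - of_nat j) (mode M2 a (\<alpha> + of_nat j) u) :: 'm3))"

definition Jacobi_M1 where
  "Jacobi_M1 I a v u \<alpha> \<beta> k = Sum_any (\<lambda>j. ((of_rat \<alpha> :: complex) gchoose j) *\<^sub>C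
          (I (mode M1 a (\<beta> + of_nat j) v) (k + \<alpha> - of_nat j) u :: 'm3))"

lemma IO_Jacobi:
  assumes "I \<in> IO" "r < T" "a \<in> sector g2 T r" "v \<in> mcar M1" "u \<in> mcar M2"
    "\<alpha> - of_nat r / of_nat T \<in> \<int>" "\<beta> - of_int \<epsilon> * of_nat r / of_nat T \<in> \<int>"
  shows "Jacobi_M3 I a v u \<alpha> \<beta> k - Jacobi_M2 I a v u \<alpha> \<beta> k = Jacobi_M1 I a v u \<alpha> \<beta> k"
  unfolding Jacobi_M1_def Jacobi_M2_def Jacobi_M3_def
  by (rule IO_conjs[OF assms(1), THEN conjunct2, THEN conjunct2, THEN conjunct2, THEN conjunct2, THEN conjunct2,
      THEN conjunct2, THEN conjunct2, THEN conjunct1, rule_format, OF assms(2-)])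

lemma IO_derivative:
  assumes "I \<in> IO" "v \<in> mcar M1" "u \<in> mcar M2"
  shows "I (mode M1 (conf V) 0 v) n u = (- of_rat n - (h1 + h2 - h3)) *\<^sub>C I v (n - 1) u"
  by (rule IO_conjs[OF assms(1), THEN conjunct2, THEN conjunct2, THEN conjunct2, THEN conjunct2, THEN conjunct2,
      THEN conjunct2, THEN conjunct2, THEN conjunct2, rule_format, OF assms(2-)])

lemma IO_0_left: "I \<in> IO \<Longrightarrow> u \<in> mcar M2 \<Longrightarrow> I 0 n u = 0"
  using clinear_on_0[OF IO_linear_left m1.mcar_subspace] .

lemma IO_0_right: "I \<in> IO \<Longrightarrow> v \<in> mcar M1 \<Longrightarrow> I v n 0 = 0"
  using clinear_on_0[OF IO_linear_right m2.mcar_subspace] .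

context
  fixes a :: 'v and v :: 'm1 and u :: 'm2 and \<alpha> \<beta> k :: rat
  assumes v: "v \<in> mcar M1" and u: "u \<in> mcar M2"
begin

lemma Jacobi_M3_support:
  assumes "I \<in> IO"
  shows "\<exists>N::nat. \<forall>j\<ge>N. I v (k + of_nat j) u = 0"
proof -
  obtain N where N: "\<And>n. n \<ge> N \<Longrightarrow> I v n u = 0" using IO_truncation[OF assms v u] by blast
  obtain j0 :: nat where j0: "N - k \<le> of_nat j0" using real_arch_simple by blast
  have "I v (k + of_nat j) u = 0" if "j \<ge> j0" for j
  proof (rule N)
    have "(of_nat j0 :: rat) \<le> of_nat j" using that by simp
    then show "N \<le> k + of_nat j" using j0 by linarith
  qed
  then show ?thesis by blast
qed

text \<open>\<open>Sum_any\<close> is 0 on infinite support by convention, so linearity of the three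
  sums in \<open>I\<close> depends on finiteness facts like this one.\<close>

lemma Jacobi_M3_terms_finite:
  assumes "I \<in> IO"
  shows "finite {j. c j *\<^sub>C mode M3 a (\<alpha> + \<beta> - of_nat j) (I v (k + of_nat j) u) \<noteq> 0}"
proof -
  obtain N :: nat where N: "\<And>j. j \<ge> N \<Longrightarrow> I v (k + of_nat j) u = 0" using Jacobi_M3_support[OF assms] by blast
  show ?thesis by (rule finite_nat_support[of N]) (simp add: N)
qed

lemma Jacobi_M2_terms_finite:
  assumes "I \<in> IO"
  shows "finite {j. c j *\<^sub>C I v (k + \<beta> - of_nat j) (mode M2 a (\<alpha> + of_nat j) u) \<noteq> 0}"
proof -
  obtain N :: nat where N: "\<And>j. j \<ge> N \<Longrightarrow> mode M2 a (\<alpha> + of_nat j) u = 0"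
    using m2.mode_truncation_nat[OF u] by blast
  show ?thesis by (rule finite_nat_support[of N]) (simp add: N IO_0_right[OF assms v])
qed

lemma Jacobi_M1_terms_finite:
  assumes "I \<in> IO"
  shows "finite {j. c j *\<^sub>C I (mode M1 a (\<beta> + of_nat j) v) (k + \<alpha> - of_nat j) u \<noteq> 0}"
proof -
  obtain N :: nat where N: "\<And>j. j \<ge> N \<Longrightarrow> mode M1 a (\<beta> + of_nat j) v = 0"
    using m1.mode_truncation_nat[OF v] by blast
  show ?thesis by (rule finite_nat_support[of N]) (simp add: N IO_0_left[OF assms u])
qed

end

lemma Sum_any_add:
  fixes f f' :: "nat \<Rightarrow> 'a::complex_vector"
  assumes "finite {j. c j *\<^sub>C f j \<noteq> 0}" "finite {j. c j *\<^sub>C f' j \<noteq> 0}"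
  shows "Sum_any (\<lambda>j. c j *\<^sub>C (f j + f' j)) = Sum_any (\<lambda>j. c j *\<^sub>C f j) + Sum_any (\<lambda>j. c j *\<^sub>C f' j)"
  unfolding scaleC_add_right by (rule Sum_any.distrib[OF assms])

lemma Sum_any_scaleC:
  fixes f :: "nat \<Rightarrow> 'a::complex_vector"
  assumes "finite {j. c j *\<^sub>C f j \<noteq> 0}"
  shows "Sum_any (\<lambda>j. c j *\<^sub>C (d *\<^sub>C f j)) = d *\<^sub>C Sum_any (\<lambda>j. c j *\<^sub>C f j)"
proof -
  have "clinear_on UNIV (\<lambda>x::'a. d *\<^sub>C x)"
    by (simp add: clinear_on_def scaleC_add_right scaleC_scaleC mult.commute)
  from clinear_on_Sum_any[OF this _ _ assms]
  have "d *\<^sub>C Sum_any (\<lambda>j. c j *\<^sub>C f j) = Sum_any (\<lambda>j. d *\<^sub>C c j *\<^sub>C f j)" by simp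
  then show ?thesis by (simp add: scaleC_scaleC mult.commute)
qed

section \<open>Linear structure, degrees and cosets of intertwining operators\<close>

lemma IO_subspace: "csubspace IO"
  unfolding complex_vector.subspace_def
proof (intro conjI ballI allI)
  show "0 \<in> IO"
    unfolding intertwining_operators_def by (simp add: csubspace_0[OF m3.mcar_subspace])
next
  fix I J assume I: "I \<in> IO" and J: "J \<in> IO"
  have mode3: "mode M3 a n (I v m u + J v m u) = mode M3 a n (I v m u) + mode M3 a n (J v m u)"
    if "v \<in> mcar M1" "u \<in> mcar M2" for a n v m u
    by (rule clinear_on_add[OF m3.clinear_on_mode IO_in[OF I that] IO_in[OF J that]])
  have Jac: "Jacobi_M3 (I + J) a v u \<alpha> \<beta> k - Jacobi_M2 (I + J) a v u \<alpha> \<beta> k = Jacobi_M1 (I + J) a v u \<alpha> \<beta> k"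
    if h: "r < T" "a \<in> sector g2 T r" "v \<in> mcar M1" "u \<in> mcar M2"
    "\<alpha> - of_nat r / of_nat T \<in> \<int>" "\<beta> - of_int \<epsilon> * of_nat r / of_nat T \<in> \<int>" for r a v u \<alpha> \<beta> k
  proof -
    have "Jacobi_M3 (I + J) a v u \<alpha> \<beta> k = Jacobi_M3 I a v u \<alpha> \<beta> k + Jacobi_M3 J a v u \<alpha> \<beta> k"
      unfolding Jacobi_M3_def plus_fun_def mode3[OF h(3,4)]
      by (rule Sum_any_add[OF Jacobi_M3_terms_finite[OF h(3,4) I] Jacobi_M3_terms_finite[OF h(3,4) J]])
    moreover have "Jacobi_M2 (I + J) a v u \<alpha> \<beta> k = Jacobi_M2 I a v u \<alpha> \<beta> k + Jacobi_M2 J a v u \<alpha> \<beta> k"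
      unfolding Jacobi_M2_def plus_fun_def
      by (rule Sum_any_add[OF Jacobi_M2_terms_finite[OF h(3,4) I] Jacobi_M2_terms_finite[OF h(3,4) J]])
    moreover have "Jacobi_M1 (I + J) a v u \<alpha> \<beta> k = Jacobi_M1 I a v u \<alpha> \<beta> k + Jacobi_M1 J a v u \<alpha> \<beta> k"
      unfolding Jacobi_M1_def plus_fun_def
      by (rule Sum_any_add[OF Jacobi_M1_terms_finite[OF h(3,4) I] Jacobi_M1_terms_finite[OF h(3,4) J]])
    ultimately show ?thesis
      using IO_Jacobi[OF I h, of k] IO_Jacobi[OF J h, of k] by (simp add: algebra_simps)
  qed
  show "I + J \<in> IO"
    unfolding intertwining_operators_def mem_Collect_eq
  proof (intro conjI)
    show "\<forall>v n u. v \<notin> mcar M1 \<or> of_nat T * n \<notin> \<int> \<or> u \<notin> mcar M2 \<longrightarrow> (I + J) v n u = 0"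
      using IO_conjs[OF I, THEN conjunct1] IO_conjs[OF J, THEN conjunct1] by simp
    show "\<forall>v\<in>mcar M1. \<forall>n. \<forall>u\<in>mcar M2. (I + J) v n u \<in> mcar M3"
      using IO_in[OF I] IO_in[OF J] csubspace_add[OF m3.mcar_subspace] by simp
    show "\<forall>v\<in>mcar M1. \<forall>v'\<in>mcar M1. \<forall>n. \<forall>u\<in>mcar M2. (I + J) (v + v') n u = (I + J) v n u + (I + J) v' n u"
      using clinear_on_add[OF IO_linear_left[OF I]] clinear_on_add[OF IO_linear_left[OF J]] by simp
    show "\<forall>c. \<forall>v\<in>mcar M1. \<forall>n. \<forall>u\<in>mcar M2. (I + J) (c *\<^sub>C v) n u = c *\<^sub>C (I + J) v n u"
      using clinear_on_scale[OF IO_linear_left[OF I]] clinear_on_scale[OF IO_linear_left[OF J]]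
      by (simp add: scaleC_add_right)
    show "\<forall>v\<in>mcar M1. \<forall>n. \<forall>u\<in>mcar M2. \<forall>u'\<in>mcar M2. (I + J) v n (u + u') = (I + J) v n u + (I + J) v n u'"
      using clinear_on_add[OF IO_linear_right[OF I]] clinear_on_add[OF IO_linear_right[OF J]] by simp
    show "\<forall>c. \<forall>v\<in>mcar M1. \<forall>n. \<forall>u\<in>mcar M2. (I + J) v n (c *\<^sub>C u) = c *\<^sub>C (I + J) v n u"
      using clinear_on_scale[OF IO_linear_right[OF I]] clinear_on_scale[OF IO_linear_right[OF J]]
      by (simp add: scaleC_add_right)
    show "\<forall>v\<in>mcar M1. \<forall>u\<in>mcar M2. \<exists>N. \<forall>n\<ge>N. (I + J) v n u = 0"
    proof (intro ballI)
      fix v u assume vu: "v \<in> mcar M1" "u \<in> mcar M2"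
      obtain N where "\<And>n. n \<ge> N \<Longrightarrow> I v n u = 0" using IO_truncation[OF I vu] by blast
      moreover obtain N' where "\<And>n. n \<ge> N' \<Longrightarrow> J v n u = 0" using IO_truncation[OF J vu] by blast
      ultimately show "\<exists>N. \<forall>n\<ge>N. (I + J) v n u = 0" by (intro exI[of _ "max N N'"]) simp
    qed
    show "\<forall>v\<in>mcar M1. \<forall>n. \<forall>u\<in>mcar M2.
        (I + J) (mode M1 (conf V) 0 v) n u = (- of_rat n - (h1 + h2 - h3)) *\<^sub>C (I + J) v (n - 1) u"
      using IO_derivative[OF I] IO_derivative[OF J] by (simp add: scaleC_add_right)
  qed (use Jac[unfolded Jacobi_M1_def Jacobi_M2_def Jacobi_M3_def] in blast)
next
  fix c I assume I: "I \<in> IO"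
  have mode3: "mode M3 a n (c *\<^sub>C I v m u) = c *\<^sub>C mode M3 a n (I v m u)"
    if "v \<in> mcar M1" "u \<in> mcar M2" for a n v m u
    by (rule clinear_on_scale[OF m3.clinear_on_mode IO_in[OF I that]])
  have Jac: "Jacobi_M3 (c *\<^sub>C I) a v u \<alpha> \<beta> k - Jacobi_M2 (c *\<^sub>C I) a v u \<alpha> \<beta> k = Jacobi_M1 (c *\<^sub>C I) a v u \<alpha> \<beta> k"
    if h: "r < T" "a \<in> sector g2 T r" "v \<in> mcar M1" "u \<in> mcar M2"
    "\<alpha> - of_nat r / of_nat T \<in> \<int>" "\<beta> - of_int \<epsilon> * of_nat r / of_nat T \<in> \<int>" for r a v u \<alpha> \<beta> k
  proof -
    have "Jacobi_M3 (c *\<^sub>C I) a v u \<alpha> \<beta> k = c *\<^sub>C Jacobi_M3 I a v u \<alpha> \<beta> k"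
      unfolding Jacobi_M3_def scaleC_fun_def mode3[OF h(3,4)]
      by (rule Sum_any_scaleC[OF Jacobi_M3_terms_finite[OF h(3,4) I]])
    moreover have "Jacobi_M2 (c *\<^sub>C I) a v u \<alpha> \<beta> k = c *\<^sub>C Jacobi_M2 I a v u \<alpha> \<beta> k"
      unfolding Jacobi_M2_def scaleC_fun_def by (rule Sum_any_scaleC[OF Jacobi_M2_terms_finite[OF h(3,4) I]])
    moreover have "Jacobi_M1 (c *\<^sub>C I) a v u \<alpha> \<beta> k = c *\<^sub>C Jacobi_M1 I a v u \<alpha> \<beta> k"
      unfolding Jacobi_M1_def scaleC_fun_def by (rule Sum_any_scaleC[OF Jacobi_M1_terms_finite[OF h(3,4) I]])
    ultimately show ?thesis
      using IO_Jacobi[OF I h, of k] by (simp only: complex_vector.scale_right_diff_distrib[symmetric])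
  qed
  show "c *\<^sub>C I \<in> IO"
    unfolding intertwining_operators_def mem_Collect_eq
  proof (intro conjI)
    show "\<forall>v n u. v \<notin> mcar M1 \<or> of_nat T * n \<notin> \<int> \<or> u \<notin> mcar M2 \<longrightarrow> (c *\<^sub>C I) v n u = 0"
      using IO_conjs[OF I, THEN conjunct1] by (simp add: scaleC_fun_def)
    show "\<forall>v\<in>mcar M1. \<forall>n. \<forall>u\<in>mcar M2. (c *\<^sub>C I) v n u \<in> mcar M3"
      using IO_in[OF I] csubspace_scale[OF m3.mcar_subspace] by (simp add: scaleC_fun_def)
    show "\<forall>v\<in>mcar M1. \<forall>v'\<in>mcar M1. \<forall>n. \<forall>u\<in>mcar M2. (c *\<^sub>C I) (v + v') n u = (c *\<^sub>C I) v n u + (c *\<^sub>C I) v' n u"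
      using clinear_on_add[OF IO_linear_left[OF I]] by (simp add: scaleC_fun_def scaleC_add_right)
    show "\<forall>d. \<forall>v\<in>mcar M1. \<forall>n. \<forall>u\<in>mcar M2. (c *\<^sub>C I) (d *\<^sub>C v) n u = d *\<^sub>C (c *\<^sub>C I) v n u"
      using clinear_on_scale[OF IO_linear_left[OF I]]
      by (simp add: scaleC_fun_def scaleC_scaleC mult.commute)
    show "\<forall>v\<in>mcar M1. \<forall>n. \<forall>u\<in>mcar M2. \<forall>u'\<in>mcar M2. (c *\<^sub>C I) v n (u + u') = (c *\<^sub>C I) v n u + (c *\<^sub>C I) v n u'"
      using clinear_on_add[OF IO_linear_right[OF I]] by (simp add: scaleC_fun_def scaleC_add_right)
    show "\<forall>d. \<forall>v\<in>mcar M1. \<forall>n. \<forall>u\<in>mcar M2. (c *\<^sub>C I) v n (d *\<^sub>C u) = d *\<^sub>C (c *\<^sub>C I) v n u"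
      using clinear_on_scale[OF IO_linear_right[OF I]]
      by (simp add: scaleC_fun_def scaleC_scaleC mult.commute)
    show "\<forall>v\<in>mcar M1. \<forall>u\<in>mcar M2. \<exists>N. \<forall>n\<ge>N. (c *\<^sub>C I) v n u = 0"
    proof (intro ballI)
      fix v u assume vu: "v \<in> mcar M1" "u \<in> mcar M2"
      obtain N where "\<And>n. n \<ge> N \<Longrightarrow> I v n u = 0" using IO_truncation[OF I vu] by blast
      then show "\<exists>N. \<forall>n\<ge>N. (c *\<^sub>C I) v n u = 0" by (intro exI[of _ N]) (simp add: scaleC_fun_def)
    qed
    show "\<forall>v\<in>mcar M1. \<forall>n. \<forall>u\<in>mcar M2.
        (c *\<^sub>C I) (mode M1 (conf V) 0 v) n u = (- of_rat n - (h1 + h2 - h3)) *\<^sub>C (c *\<^sub>C I) v (n - 1) u"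
      using IO_derivative[OF I] by (simp add: scaleC_fun_def scaleC_scaleC mult.commute)
  qed (use Jac[unfolded Jacobi_M1_def Jacobi_M2_def Jacobi_M3_def] in blast)
qed

text \<open>For the conformal vector and F = z the residue identity is the commutator with L_0, and
  the derivative axiom evaluates its L_(-1)-term. The shift h1 + h2 - h3 cancels, leaving the
  eigenvalue h3 + n + d - k - 1, which determines the degree in \<open>M3\<close>.\<close>

lemma IO_degree:
  assumes I: "I \<in> IO" and v: "v \<in> mgr M1 n" and u: "u \<in> mgr M2 d"
  shows "I v k u \<in> mgr M3 (n + d - k - 1)"
proof -
  let ?c = "conf V" and ?x = "I v k u"
  have vM: "v \<in> mcar M1" and uM: "u \<in> mcar M2" using m1.mgr_mcar[OF v] m2.mgr_mcar[OF u] .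
  have xM: "?x \<in> mcar M3" using IO_in[OF I vM uM] .
  have c: "?c \<in> sector g2 T 0"
    by (simp add: sector_def m2.g_conf scaleC_one)
  have "Jacobi_M3 I ?c v u 1 0 k = mode M3 ?c 1 ?x"
    unfolding Jacobi_M3_def using Sum_any_zero_gchoose[of "\<lambda>j. mode M3 ?c (1 + 0 - of_nat j) (I v (k + of_nat j) u)"]
    by simp
  moreover have "Jacobi_M2 I ?c v u 1 0 k = I v k (mode M2 ?c 1 u)"
    unfolding Jacobi_M2_def by (subst Sum_any_single[of 0]) (auto simp: zero_gchoose scaleC_one)
  moreover have "Jacobi_M1 I ?c v u 1 0 k = I (mode M1 ?c 0 v) (k + 1) u + I (mode M1 ?c 1 v) k u"
    unfolding Jacobi_M1_def using Sum_any_one_gchoose[of "\<lambda>j. I (mode M1 ?c (0 + of_nat j) v) (k + 1 - of_nat j) u"]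
    by simp
  ultimately have "mode M3 ?c 1 ?x
      = I v k (mode M2 ?c 1 u) + (I (mode M1 ?c 0 v) (k + 1) u + I (mode M1 ?c 1 v) k u)"
    using IO_Jacobi[OF I m1.T_pos c vM uM, of 1 0 k] by (simp add: algebra_simps)
  also have "mode M2 ?c 1 u = (h2 + of_rat d) *\<^sub>C u"
    using cw2 u unfolding conformal_weight_def by blast
  also have "mode M1 ?c 1 v = (h1 + of_rat n) *\<^sub>C v"
    using cw1 v unfolding conformal_weight_def by blast
  also have "I v k ((h2 + of_rat d) *\<^sub>C u) + (I (mode M1 ?c 0 v) (k + 1) u + I ((h1 + of_rat n) *\<^sub>C v) k u)
    = (h2 + of_rat d) *\<^sub>C ?x + ((- of_rat (k + 1) - (h1 + h2 - h3)) *\<^sub>C ?x + (h1 + of_rat n) *\<^sub>C ?x)"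
    by (simp add: IO_derivative[OF I vM uM] clinear_on_scale[OF IO_linear_left[OF I uM] vM]
        clinear_on_scale[OF IO_linear_right[OF I vM] uM])
  also have "\<dots> = ((h2 + of_rat d) + ((- of_rat (k + 1) - (h1 + h2 - h3)) + (h1 + of_rat n))) *\<^sub>C ?x"
    by (simp only: scaleC_add_left)
  also have "(h2 + of_rat d) + ((- of_rat (k + 1) - (h1 + h2 - h3)) + (h1 + of_rat n))
     = h3 + of_rat (n + d - k - 1)"
    by (simp add: of_rat_add of_rat_diff)
  finally have eig: "mode M3 ?c 1 ?x = (h3 + of_rat (n + d - k - 1)) *\<^sub>C ?x" .
  have "hcomp (mgr M3) ?x i = 0" if "i \<noteq> n + d - k - 1" for i
  proof (rule hcomp_eigenvector[OF m3.grading_M m3.clinear_on_mode _ xM eig])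
    show "mode M3 ?c 1 y = (h3 + of_rat j) *\<^sub>C y" if "y \<in> mgr M3 j" for j y
      using cw3 that unfolding conformal_weight_def by blast
    show "h3 + of_rat i \<noteq> h3 + of_rat (n + d - k - 1)" using that by simp
  qed
  then have "?x = hcomp (mgr M3) ?x (n + d - k - 1)"
    by (intro hcomp_concentrated[OF m3.grading_M xM])
  then show ?thesis using hcomp_in[OF m3.grading_M xM] by metis
qed

lemma bottom_part_terms:
  assumes "\<And>j. f j \<in> mcar M3" "finite {j. f j \<noteq> 0}" "\<And>j. m3.bottom_part (f j) = 0"
  shows "m3.bottom_part (Sum_any f) = 0"
  unfolding clinear_on_Sum_any[OF clinear_on_hcomp[OF m3.grading_M] m3.mcar_subspace assms(1,2)]
  by (simp add: assms(3))

lemma bottom_part_scale: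
  "x \<in> mcar M3 \<Longrightarrow> m3.bottom_part x = 0 \<Longrightarrow> m3.bottom_part (c *\<^sub>C x) = 0"
  by (simp add: clinear_on_scale[OF clinear_on_hcomp[OF m3.grading_M]])

lemma scale_in_M3: "x \<in> mcar M3 \<Longrightarrow> c *\<^sub>C x \<in> mcar M3"
  by (rule csubspace_scale[OF m3.mcar_subspace])

lemma bottom_part_S3:
  assumes I: "I \<in> IO" and v: "v \<in> mcar M1" and u: "u \<in> mcar M2"
    and "\<And>j::nat. m3.bottom_part (mode M3 a (\<alpha> + \<beta> - of_nat j) (I v (k + of_nat j) u)) = 0"
  shows "m3.bottom_part (Jacobi_M3 I a v u \<alpha> \<beta> k) = 0"
  unfolding Jacobi_M3_def
proof (rule bottom_part_terms[OF _ Jacobi_M3_terms_finite[OF v u I]])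
  fix j :: nat
  have x: "mode M3 a (\<alpha> + \<beta> - of_nat j) (I v (k + of_nat j) u) \<in> mcar M3"
    by (rule m3.mode_in[OF IO_in[OF I v u]])
  show "c *\<^sub>C mode M3 a (\<alpha> + \<beta> - of_nat j) (I v (k + of_nat j) u) \<in> mcar M3" for c
    by (rule scale_in_M3[OF x])
  show "m3.bottom_part (c *\<^sub>C mode M3 a (\<alpha> + \<beta> - of_nat j) (I v (k + of_nat j) u)) = 0" for c
    by (rule bottom_part_scale[OF x assms(4)])
qed

lemma bottom_part_S1:
  assumes I: "I \<in> IO" and v: "v \<in> mcar M1" and u: "u \<in> mcar M2"
    and "\<And>j::nat. m3.bottom_part (I (mode M1 a (\<beta> + of_nat j) v) (k + \<alpha> - of_nat j) u) = 0"
  shows "m3.bottom_part (Jacobi_M1 I a v u \<alpha> \<beta> k) = 0"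
  unfolding Jacobi_M1_def
proof (rule bottom_part_terms[OF _ Jacobi_M1_terms_finite[OF v u I]])
  fix j :: nat
  have x: "I (mode M1 a (\<beta> + of_nat j) v) (k + \<alpha> - of_nat j) u \<in> mcar M3"
    by (rule IO_in[OF I m1.mode_in[OF v] u])
  show "c *\<^sub>C I (mode M1 a (\<beta> + of_nat j) v) (k + \<alpha> - of_nat j) u \<in> mcar M3" for c
    by (rule scale_in_M3[OF x])
  show "m3.bottom_part (c *\<^sub>C I (mode M1 a (\<beta> + of_nat j) v) (k + \<alpha> - of_nat j) u) = 0" for c
    by (rule bottom_part_scale[OF x assms(4)])
qed

lemma Jacobi_M1_in: "I \<in> IO \<Longrightarrow> v \<in> mcar M1 \<Longrightarrow> u \<in> mcar M2 \<Longrightarrow> Jacobi_M1 I a v u \<alpha> \<beta> k \<in> mcar M3"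
  unfolding Jacobi_M1_def by (intro csubspace_Sum_any[OF m3.mcar_subspace] scale_in_M3 IO_in m1.mode_in)

lemma clinear_on_bottom_left:
  assumes "I \<in> IO" "u \<in> mcar M2"
  shows "clinear_on (mcar M1) (\<lambda>v. m3.bottom_part (I v k u))"
  using clinear_on_add[OF IO_linear_left[OF assms]] clinear_on_scale[OF IO_linear_left[OF assms]]
    clinear_on_add[OF clinear_on_hcomp[OF m3.grading_M]] clinear_on_scale[OF clinear_on_hcomp[OF m3.grading_M]]
    IO_in[OF assms(1) _ assms(2)]
  by (simp add: clinear_on_def)

lemma clinear_on_bottom_right:
  assumes "I \<in> IO" "v \<in> mcar M1"
  shows "clinear_on (mcar M2) (\<lambda>u. m3.bottom_part (I v k u))"
  using clinear_on_add[OF IO_linear_right[OF assms]] clinear_on_scale[OF IO_linear_right[OF assms]]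
    clinear_on_add[OF clinear_on_hcomp[OF m3.grading_M]] clinear_on_scale[OF clinear_on_hcomp[OF m3.grading_M]]
    IO_in[OF assms(1) assms(2)]
  by (simp add: clinear_on_def)

text \<open>A vector in the sector \<open>r\<close> of g2 lies in the sector \<epsilon> r mod T of
  g1, so its modes on \<open>M1\<close> have indices in \<epsilon> r/T + \<int>.\<close>

lemma mode1_wrong_coset:
  assumes a: "r < T" "a \<in> sector g2 T r" and v: "v \<in> mcar M1" and \<beta>: "\<beta> - of_int \<epsilon> * of_nat r / of_nat T \<notin> \<int>"
  shows "mode M1 a \<beta> v = 0"
proof (rule m1.mode_sector[OF _ sector1[OF a(2)] _ v])
  let ?z = "\<epsilon> * int r"
  have T: "0 < int T" using m1.T_pos by simp
  have z: "0 \<le> ?z mod int T" "?z mod int T < int T" using T by simp_all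
  then show "nat (?z mod int T) < T" by (simp add: nat_less_iff)
  have "(of_int ?z :: rat) = of_int (?z div int T) * of_nat T + of_int (?z mod int T)"
    by (metis div_mult_mod_eq of_int_add of_int_mult of_int_of_nat_eq)
  then have "of_int ?z / of_nat T = (of_int (?z div int T) :: rat) + of_nat (nat (?z mod int T)) / of_nat T"
    using T z(1) by (simp add: field_simps)
  then have eq: "of_int \<epsilon> * of_nat r / of_nat T = (of_int (?z div int T) :: rat) + of_nat (nat (?z mod int T)) / of_nat T"
    by simp
  show "\<beta> - of_nat (nat (?z mod int T)) / of_nat T \<notin> \<int>"
  proof
    assume "\<beta> - of_nat (nat (?z mod int T)) / of_nat T \<in> \<int>"
    then have "\<beta> - of_nat (nat (?z mod int T)) / of_nat T - of_int (?z div int T) \<in> \<int>"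
      by (rule Ints_diff) simp
    then show False using \<beta> unfolding eq by (simp add: algebra_simps)
  qed
qed

lemma mode3_wrong_coset:
  assumes a: "r < T" "a \<in> sector g2 T r" and x: "x \<in> mcar M3"
    and m: "m - of_nat r / of_nat T - of_int \<epsilon> * of_nat r / of_nat T \<notin> \<int>"
  shows "mode M3 a m x = 0"
proof (rule m3.mode_sector[OF _ sector3[OF a(2)] _ x])
  let ?z = "(1 + \<epsilon>) * int r"
  have T: "0 < int T" using m1.T_pos by simp
  have z: "0 \<le> ?z mod int T" "?z mod int T < int T" using T by simp_all
  then show "nat (?z mod int T) < T" by (simp add: nat_less_iff)
  have "(of_int ?z :: rat) = of_int (?z div int T) * of_nat T + of_int (?z mod int T)"
    by (metis div_mult_mod_eq of_int_add of_int_mult of_int_of_nat_eq)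
  then have "of_int ?z / of_nat T = (of_int (?z div int T) :: rat) + of_nat (nat (?z mod int T)) / of_nat T"
    using T z(1) by (simp add: field_simps)
  then have eq: "of_nat r / of_nat T + of_int \<epsilon> * of_nat r / of_nat T
      = (of_int (?z div int T) :: rat) + of_nat (nat (?z mod int T)) / of_nat T"
    by (simp add: distrib_right add_divide_distrib)
  show "m - of_nat (nat (?z mod int T)) / of_nat T \<notin> \<int>"
  proof
    assume "m - of_nat (nat (?z mod int T)) / of_nat T \<in> \<int>"
    then have "m - of_nat (nat (?z mod int T)) / of_nat T - of_int (?z div int T) \<in> \<int>"
      by (rule Ints_diff) simp
    also have "m - of_nat (nat (?z mod int T)) / of_nat T - of_int (?z div int T)
      = m - (of_nat r / of_nat T + of_int \<epsilon> * of_nat r / of_nat T)" unfolding eq by simp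
    finally show False using m by (simp add: diff_diff_eq)
  qed
qed

text \<open>For \<open>\<beta> < -1\<close> there is \<open>\<alpha> \<in> r/T + \<int>\<close> strictly between \<open>wt a - 1\<close> and \<open>wt a - 1 - \<beta>\<close>. The
  residue identity for \<open>z\<^sup>\<alpha> (z - w)\<^sup>\<beta>\<close> then has no terms with \<open>Y(a, z)\<close> acting on \<open>M\<^sup>2(0)\<close> or
  into \<open>M\<^sup>3(0)\<close>, so \<open>a\<^sub>(\<^sub>\<beta>\<^sub>) x\<close> is determined by vectors of lower degree.\<close>

lemma bottom_vanishing_step:
  assumes I: "I \<in> IO" and a: "a \<in> m2.homs l" and \<beta>: "\<beta> < -1" and x: "x \<in> mgr M1 p" and u: "u \<in> mgr M2 0"
    and lower: "\<And>q y k. q \<le> of_nat l - \<beta> - 1 + p - 1 \<Longrightarrow> y \<in> mgr M1 q \<Longrightarrow> m3.bottom_part (I y k u) = 0"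
  shows "m3.bottom_part (I (mode M1 a \<beta> x) k u) = 0"
proof -
  have xM: "x \<in> mcar M1" and uM: "u \<in> mcar M2" using m1.mgr_mcar[OF x] m2.mgr_mcar[OF u] .
  obtain r where r: "r < T" "a \<in> sector g2 T r" using a by (auto simp: m2.homs_def)
  have aV: "a \<in> VGr V l" using m2.homs_VGr[OF a] .
  show ?thesis
  proof (cases "\<beta> - of_int \<epsilon> * of_nat r / of_nat T \<in> \<int>")
    case False
    then show ?thesis using mode1_wrong_coset[OF r xM] IO_0_left[OF I uM] by simp
  next
    case True
    \<comment> \<open>The representative of r/T + \<int> above l - 1 and at most l. Then \<beta> <
      -1 pushes \<alpha> + \<beta> below l - 1.\<close>
    define \<alpha> :: rat where "\<alpha> = (if r = 0 then of_nat l else of_nat l - 1 + of_nat r / of_nat T)"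
    have \<alpha>: "\<alpha> - of_nat r / of_nat T \<in> \<int>" by (simp add: \<alpha>_def)
    have "0 \<le> (of_nat r / of_nat T :: rat)" "of_nat r / of_nat T < (1::rat)"
      "r \<noteq> 0 \<Longrightarrow> 0 < (of_nat r / of_nat T :: rat)" using r(1) by simp_all
    then have \<alpha>_bounds: "of_nat l - 1 < \<alpha>" "\<alpha> \<le> of_nat l" by (auto simp: \<alpha>_def)
    \<comment> \<open>With k' + \<alpha> = k, the term j = 0 on the \<open>M1\<close> side is the
      wanted one.\<close>
    define k' where "k' = k - \<alpha>"
    have s3: "m3.bottom_part (Jacobi_M3 I a x u \<alpha> \<beta> k') = 0"
    proof (rule bottom_part_S3[OF I xM uM])
      fix j :: nat
      show "m3.bottom_part (mode M3 a (\<alpha> + \<beta> - of_nat j) (I x (k' + of_nat j) u)) = 0"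
      proof (rule m3.bottom_part_mode[OF aV IO_in[OF I xM uM]])
        have "of_nat l - (\<alpha> + \<beta> - of_nat j) - 1 > 0"
          using \<alpha>_bounds \<beta> of_nat_0_le_iff[of j, where 'a=rat] by linarith
        then show "0 \<le> of_nat l - (\<alpha> + \<beta> - of_nat j) - 1"
          "0 < of_nat l - (\<alpha> + \<beta> - of_nat j) - 1 \<or> m3.bottom_part (I x (k' + of_nat j) u) = 0"
          by simp_all
      qed
    qed
    have "mode M2 a (\<alpha> + of_nat j) u = 0" for j
    proof (rule m2.mode_negative_degree[OF aV u])
      show "of_nat l - (\<alpha> + of_nat j) - 1 + 0 < 0"
        using \<alpha>_bounds of_nat_0_le_iff[of j, where 'a=rat] by linarith
    qed
    then have s2: "Jacobi_M2 I a x u \<alpha> \<beta> k' = 0"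
      unfolding Jacobi_M2_def by (simp add: IO_0_right[OF I xM])
    let ?f = "\<lambda>j. ((of_rat \<alpha> :: complex) gchoose j) *\<^sub>C
          I (mode M1 a (\<beta> + of_nat j) x) (k' + \<alpha> - of_nat j) u"
    obtain N where N: "\<And>j. j \<ge> N \<Longrightarrow> mode M1 a (\<beta> + of_nat j) x = 0"
      using m1.mode_truncation_nat[OF xM] by blast
    have f0: "?f j = 0" if "j \<ge> N" for j
      by (simp add: N[OF that] IO_0_left[OF I uM])
    have fM: "?f j \<in> mcar M3" for j
      by (intro scale_in_M3 IO_in[OF I _ uM] m1.mode_in xM)
    have "m3.bottom_part (Sum_any (\<lambda>j. ?f (Suc j))) = 0"
    proof (rule bottom_part_terms[OF fM])
      show "finite {j. ?f (Suc j) \<noteq> 0}"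
        by (rule finite_nat_support[of N]) (rule f0, simp)
      fix j
      have "of_nat l - (\<beta> + of_nat (Suc j)) - 1 + p \<le> of_nat l - \<beta> - 1 + p - 1" by simp
      from lower[OF this m1.mode_degree[OF aV x]]
      show "m3.bottom_part (?f (Suc j)) = 0"
        by (intro bottom_part_scale IO_in[OF I m1.mode_in[OF xM] uM])
    qed
    moreover have "m3.bottom_part (Jacobi_M1 I a x u \<alpha> \<beta> k') = 0"
      using IO_Jacobi[OF I r xM uM \<alpha> True, of k', symmetric] s2 s3 by simp
    moreover have "Jacobi_M1 I a x u \<alpha> \<beta> k' = ?f 0 + Sum_any (\<lambda>j. ?f (Suc j))"
      unfolding Jacobi_M1_def using f0 by (rule Sum_any_nat_split)
    moreover have "m3.bottom_part (?f 0 + Sum_any (\<lambda>j. ?f (Suc j)))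
      = m3.bottom_part (?f 0) + m3.bottom_part (Sum_any (\<lambda>j. ?f (Suc j)))"
      by (rule clinear_on_add[OF clinear_on_hcomp[OF m3.grading_M] fM csubspace_Sum_any[OF m3.mcar_subspace fM]])
    ultimately have "m3.bottom_part (?f 0) = 0" by simp
    then show ?thesis by (simp add: k'_def scaleC_one)
  qed
qed

end

text \<open>The rationals are not well-ordered, but each step descends by at least 1 and the claim
  is known below 0. Induction on a natural upper bound therefore works for every rational
  argument.\<close>

lemma rat_degree_induct:
  fixes n :: rat
  assumes neg: "\<And>n. n < 0 \<Longrightarrow> P n" and step: "\<And>n. (\<And>q. q \<le> n - 1 \<Longrightarrow> P q) \<Longrightarrow> P n"
  shows "P n"
proof -
  have "\<forall>n < of_nat i. P n" for i :: nat
  proof (induction i)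
    case 0
    then show ?case using neg by simp
  next
    case (Suc i)
    show ?case
    proof (intro allI impI)
      fix n :: rat assume n: "n < of_nat (Suc i)"
      show "P n"
      proof (rule step)
        fix q assume "q \<le> n - 1"
        then have "q < of_nat i" using n by simp
        then show "P q" using Suc by blast
      qed
    qed
  qed
  moreover obtain i :: nat where "n < of_nat i" using reals_Archimedean2 by blast
  ultimately show ?thesis by blast
qed

section \<open>Propagation of vanishing bottom parts, and the image of an intertwining
  operator\<close>

context fusion_setting
begin

text \<open>Only the index n - 1 is tested in \<open>zero\<close>: by \<open>IO_degree\<close>,
  v_(k) u has degree n - k - 1 for \<open>u\<close> in the bottom level, so every other mode has no
  bottom part.\<close>

lemma bottom_vanishing_M1:
  assumes I: "I \<in> IO" and u: "u \<in> mgr M2 0"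
    and F: "\<And>n v. (n, v) \<in> F \<Longrightarrow> v \<in> mgr M1 n"
    and span: "\<And>n. mgr M1 n \<subseteq> cspan ({v. (n, v) \<in> F} \<union> {mode M1 a m x | a m x k p.
      a \<in> m2.homs k \<and> m < -1 \<and> x \<in> mgr M1 p \<and> n = of_nat k - m - 1 + p})"
    and zero: "\<And>n v. (n, v) \<in> F \<Longrightarrow> m3.bottom_part (I v (n - 1) u) = 0"
  shows "\<forall>v\<in>mgr M1 n. \<forall>k. m3.bottom_part (I v k u) = 0"
proof (induction n rule: rat_degree_induct)
  case (1 n)
  then show ?case using m1.mgr_negative IO_0_left[OF I m2.mgr_mcar[OF u]] by simp
next
  case (2 n)
  show ?case
  proof (intro ballI allI)
    fix v k assume v: "v \<in> mgr M1 n"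
    let ?G = "{mode M1 a m x | a m x k p.
      a \<in> m2.homs k \<and> m < -1 \<and> x \<in> mgr M1 p \<and> n = of_nat k - m - 1 + p}"
    have uM: "u \<in> mcar M2" using m2.mgr_mcar[OF u] .
    have "m3.bottom_part (I v k u) \<in> {0}"
    proof (rule clinear_on_span[OF clinear_on_bottom_left[OF I uM] m1.mcar_subspace])
      show "v \<in> cspan ({v. (n, v) \<in> F} \<union> ?G)" using span v by blast
      show "csubspace {0::'m3}" by (simp add: complex_vector.subspace_def)
      show "{v. (n, v) \<in> F} \<union> ?G \<subseteq> mcar M1"
      proof
        fix y assume "y \<in> {v. (n, v) \<in> F} \<union> ?G"
        then show "y \<in> mcar M1"
        proof
          assume "y \<in> {v. (n, v) \<in> F}"
          then show ?thesis using m1.mgr_mcar[OF F] by simp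
        next
          assume "y \<in> ?G"
          then obtain a m x p where "y = mode M1 a m x" "x \<in> mgr M1 p" by blast
          then show ?thesis using m1.mode_in[OF m1.mgr_mcar] by simp
        qed
      qed
      fix y assume "y \<in> {v. (n, v) \<in> F} \<union> ?G"
      then show "m3.bottom_part (I y k u) \<in> {0}"
      proof
        assume "y \<in> {v. (n, v) \<in> F}"
        then have y: "(n, y) \<in> F" by simp
        show ?thesis
        proof (cases "k = n - 1")
          case True
          then show ?thesis using zero[OF y] by simp
        next
          case False
          then have "n + 0 - k - 1 \<noteq> 0" by simp
          from m3.bottom_part_other[OF IO_degree[OF I F[OF y] u] this] show ?thesis by simp
        qed
      next
        assume "y \<in> ?G"
        then obtain a m x l p where y: "y = mode M1 a m x" "a \<in> m2.homs l" "m < -1" "x \<in> mgr M1 p"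
          "n = of_nat l - m - 1 + p" by blast
        have "m3.bottom_part (I (mode M1 a m x) k u) = 0"
        proof (rule bottom_vanishing_step[OF I y(2-4) u])
          fix q y' k' assume q: "q \<le> of_nat l - m - 1 + p - 1" and y': "y' \<in> mgr M1 q"
          have "q \<le> n - 1" using q y(5) by simp
          from 2[OF this] y' show "m3.bottom_part (I y' k' u) = 0" by blast
        qed
        then show ?thesis by (simp add: y(1))
      qed
    qed
    then show "m3.bottom_part (I v k u) = 0" by simp
  qed
qed

lemma bottom_vanishing_mcar1:
  assumes I: "I \<in> IO" and u: "u \<in> mcar M2"
    and zero: "\<And>n v k. v \<in> mgr M1 n \<Longrightarrow> m3.bottom_part (I v k u) = 0" and v: "v \<in> mcar M1"
  shows "m3.bottom_part (I v k u) = 0"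
proof -
  have "m3.bottom_part (I (Sum_any (hcomp (mgr M1) v)) k u)
    = Sum_any (\<lambda>n. m3.bottom_part (I (hcomp (mgr M1) v n) k u))"
    by (rule clinear_on_Sum_any[OF clinear_on_bottom_left[OF I u] m1.mcar_subspace
        m1.mgr_mcar[OF hcomp_in[OF m1.grading_M v]] finite_hcomp[OF m1.grading_M v]])
  then show ?thesis
    by (simp add: zero[OF hcomp_in[OF m1.grading_M v]] Sum_any_hcomp[OF m1.grading_M v])
qed

text \<open>Here \<open>\<beta> \<le> 0\<close>, so the modes of \<open>a\<close> on \<open>M\<^sup>3\<close> in the residue identity do not lower the degree.\<close>

lemma bottom_vanishing_letter:
  assumes I: "I \<in> IO" and a: "a \<in> m2.homs l" and deg: "of_nat l - \<alpha> - 1 \<ge> 0" and u: "u \<in> mgr M2 e"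
    and u0: "\<And>v k. v \<in> mcar M1 \<Longrightarrow> m3.bottom_part (I v k u) = 0"
    and lower: "\<And>q y v k. q \<le> of_nat l - \<alpha> - 1 + e - 1 \<Longrightarrow> y \<in> mgr M2 q \<Longrightarrow> v \<in> mcar M1 \<Longrightarrow>
      m3.bottom_part (I v k y) = 0"
    and v: "v \<in> mcar M1"
  shows "m3.bottom_part (I v k (mode M2 a \<alpha> u)) = 0"
proof -
  have uM: "u \<in> mcar M2" using m2.mgr_mcar[OF u] .
  obtain r where r: "r < T" "a \<in> sector g2 T r" using a by (auto simp: m2.homs_def)
  have aV: "a \<in> VGr V l" using m2.homs_VGr[OF a] .
  show ?thesis
  proof (cases "\<alpha> - of_nat r / of_nat T \<in> \<int>")
    case False
    then show ?thesis using m2.mode_sector[OF r _ uM] IO_0_right[OF I v] by simp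
  next
    case True
    let ?b = "of_int \<epsilon> * of_nat r / of_nat T :: rat"
    \<comment> \<open>Subtracting the ceiling gives the representative of the coset in (-1,
      0].\<close>
    define \<beta> where "\<beta> = ?b - of_int \<lceil>?b\<rceil>"
    have \<beta>: "\<beta> - ?b \<in> \<int>" "\<beta> \<le> 0" by (simp_all add: \<beta>_def)
    define k' where "k' = k - \<beta>"
    have s3: "m3.bottom_part (Jacobi_M3 I a v u \<alpha> \<beta> k') = 0"
    proof (rule bottom_part_S3[OF I v uM])
      fix j :: nat
      show "m3.bottom_part (mode M3 a (\<alpha> + \<beta> - of_nat j) (I v (k' + of_nat j) u)) = 0"
      proof (rule m3.bottom_part_mode[OF aV IO_in[OF I v uM]])
        show "0 \<le> of_nat l - (\<alpha> + \<beta> - of_nat j) - 1"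
          using deg \<beta>(2) of_nat_0_le_iff[of j, where 'a=rat] by linarith
        show "0 < of_nat l - (\<alpha> + \<beta> - of_nat j) - 1 \<or> m3.bottom_part (I v (k' + of_nat j) u) = 0"
          using u0[OF v] by simp
      qed
    qed
    have s1: "m3.bottom_part (Jacobi_M1 I a v u \<alpha> \<beta> k') = 0"
      by (rule bottom_part_S1[OF I v uM]) (rule u0[OF m1.mode_in[OF v]])
    let ?c = "\<lambda>j. \<zeta> powi \<lfloor>of_nat T * (\<beta> - of_nat j)\<rfloor> * ((of_rat \<beta> :: complex) gchoose j)"
    let ?f = "\<lambda>j. ?c j *\<^sub>C I v (k' + \<beta> - of_nat j) (mode M2 a (\<alpha> + of_nat j) u)"
    obtain N where N: "\<And>j. j \<ge> N \<Longrightarrow> mode M2 a (\<alpha> + of_nat j) u = 0"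
      using m2.mode_truncation_nat[OF uM] by blast
    have f0: "?f j = 0" if "j \<ge> N" for j
      by (simp add: N[OF that] IO_0_right[OF I v])
    have xM: "I v (k' + \<beta> - of_nat j) (mode M2 a (\<alpha> + of_nat j) u) \<in> mcar M3" for j
      by (rule IO_in[OF I v m2.mode_in[OF uM]])
    have fM: "?f j \<in> mcar M3" for j by (rule scale_in_M3[OF xM])
    have "m3.bottom_part (Sum_any (\<lambda>j. ?f (Suc j))) = 0"
    proof (rule bottom_part_terms[OF fM])
      show "finite {j. ?f (Suc j) \<noteq> 0}"
        by (rule finite_nat_support[of N]) (rule f0, simp)
      fix j
      have "of_nat l - (\<alpha> + of_nat (Suc j)) - 1 + e \<le> of_nat l - \<alpha> - 1 + e - 1" by simp
      from lower[OF this m2.mode_degree[OF aV u] v]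
      show "m3.bottom_part (?f (Suc j)) = 0"
        by (rule bottom_part_scale[OF xM])
    qed
    moreover have "m3.bottom_part (Jacobi_M2 I a v u \<alpha> \<beta> k') = 0"
    proof -
      have "Jacobi_M2 I a v u \<alpha> \<beta> k' = Jacobi_M3 I a v u \<alpha> \<beta> k' - Jacobi_M1 I a v u \<alpha> \<beta> k'"
        using IO_Jacobi[OF I r v uM True \<beta>(1), of k'] by (simp add: algebra_simps)
      moreover have "Jacobi_M3 I a v u \<alpha> \<beta> k' \<in> mcar M3"
        unfolding Jacobi_M3_def
        by (rule csubspace_Sum_any[OF m3.mcar_subspace]) (rule scale_in_M3[OF m3.mode_in[OF IO_in[OF I v uM]]])
      ultimately show ?thesis
        using clinear_on_diff[OF clinear_on_hcomp[OF m3.grading_M] m3.mcar_subspace _ Jacobi_M1_in[OF I v uM]] s1 s3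
        by simp
    qed
    moreover have "Jacobi_M2 I a v u \<alpha> \<beta> k' = ?f 0 + Sum_any (\<lambda>j. ?f (Suc j))"
      unfolding Jacobi_M2_def using f0 by (rule Sum_any_nat_split)
    moreover have "m3.bottom_part (?f 0 + Sum_any (\<lambda>j. ?f (Suc j)))
      = m3.bottom_part (?f 0) + m3.bottom_part (Sum_any (\<lambda>j. ?f (Suc j)))"
      by (rule clinear_on_add[OF clinear_on_hcomp[OF m3.grading_M] fM csubspace_Sum_any[OF m3.mcar_subspace fM]])
    ultimately have "m3.bottom_part (?f 0) = 0" by simp
    moreover have "?f 0 = ?c 0 *\<^sub>C I v k (mode M2 a \<alpha> u)" by (simp add: k'_def)
    moreover have "m3.bottom_part (?c 0 *\<^sub>C I v k (mode M2 a \<alpha> u)) = ?c 0 *\<^sub>C m3.bottom_part (I v k (mode M2 a \<alpha> u))"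
      by (rule clinear_on_scale[OF clinear_on_hcomp[OF m3.grading_M] IO_in[OF I v m2.mode_in[OF uM]]])
    \<comment> \<open>The factor is a power of \<zeta>, as the binomial coefficient at j = 0 is 1,
      so it can be cancelled.\<close>
    moreover have "?c 0 \<noteq> 0" using \<zeta> by simp
    ultimately show ?thesis by (metis complex_vector.scale_eq_0_iff)
  qed
qed

text \<open>Two inductions are nested. The outer one, on the degree, covers the vectors of degree at
  most d - 1 that the residue identity produces; the inner one, along a word, covers the vector to
  which the last letter is applied.\<close>

lemma bottom_vanishing_M2:
  assumes I: "I \<in> IO" and lw: "lowest_weight_module V g2 T M2"
    and zero: "\<And>u v k. u \<in> mgr M2 0 \<Longrightarrow> v \<in> mcar M1 \<Longrightarrow> m3.bottom_part (I v k u) = 0"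
  shows "\<forall>u\<in>mgr M2 d. \<forall>v\<in>mcar M1. \<forall>k. m3.bottom_part (I v k u) = 0"
proof (induction d rule: rat_degree_induct)
  case (1 d)
  then show ?case using m2.mgr_negative IO_0_right[OF I] by simp
next
  case (2 d)
  have word: "m2.nonneg_word e x \<Longrightarrow> e \<le> d \<longrightarrow> (\<forall>v\<in>mcar M1. \<forall>k. m3.bottom_part (I v k x) = 0)" for e x
  proof (induction rule: m2.nonneg_word.induct)
    case (bottom u)
    then show ?case using zero by blast
  next
    case (letter e x a l m)
    show ?case
    proof (intro impI ballI allI)
      fix v k assume le: "of_nat l - m - 1 + e \<le> d" and v: "v \<in> mcar M1"
      have x: "x \<in> mgr M2 e" using m2.nonneg_word_mgr[OF letter.hyps(1)] by blast
      have "e \<le> d" using le letter.hyps(3) by linarith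
      then have x0: "m3.bottom_part (I v k x) = 0" if "v \<in> mcar M1" for v k
        using letter.IH that by blast
      show "m3.bottom_part (I v k (mode M2 a m x)) = 0"
      proof (rule bottom_vanishing_letter[OF I letter.hyps(2,3) x x0 _ v])
        fix q y v k assume "q \<le> of_nat l - m - 1 + e - 1" and y: "y \<in> mgr M2 q" "v \<in> mcar M1"
        then have "q \<le> d - 1" using le by linarith
        from 2[OF this] y show "m3.bottom_part (I v k y) = 0" by blast
      qed
    qed
  qed
  show ?case
  proof (intro ballI allI)
    fix u v k assume u: "u \<in> mgr M2 d" and v: "v \<in> mcar M1"
    have "m3.bottom_part (I v k u) \<in> {0}"
    proof (rule clinear_on_span[OF clinear_on_bottom_right[OF I v] m2.mcar_subspace])
      show "u \<in> cspan {x. m2.nonneg_word d x}" using m2.mgr_nonneg_span[OF lw] u by blast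
      show "csubspace {0::'m3}" by (simp add: complex_vector.subspace_def)
      show "{x. m2.nonneg_word d x} \<subseteq> mcar M2" using m2.nonneg_words_mcar by blast
      fix y assume "y \<in> {x. m2.nonneg_word d x}"
      then show "m3.bottom_part (I v k y) \<in> {0}" using word[of d y] v by simp
    qed
    then show "m3.bottom_part (I v k u) = 0" by simp
  qed
qed

definition image_span :: "('m1 \<Rightarrow> rat \<Rightarrow> 'm2 \<Rightarrow> 'm3) \<Rightarrow> 'm3 set" where
  "image_span I = cspan {I v k u | v k u. v \<in> mcar M1 \<and> u \<in> mcar M2}"

lemma image_span_subspace: "csubspace (image_span I)"
  unfolding image_span_def by (rule complex_vector.subspace_span)

lemma image_span_base: "v \<in> mcar M1 \<Longrightarrow> u \<in> mcar M2 \<Longrightarrow> I v k u \<in> image_span I"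
  unfolding image_span_def by (rule complex_vector.span_base) blast

lemma image_span_mcar:
  assumes "I \<in> IO"
  shows "image_span I \<subseteq> mcar M3"
proof -
  have "{I v k u | v k u. v \<in> mcar M1 \<and> u \<in> mcar M2} \<subseteq> mcar M3"
    using IO_in[OF assms] by blast
  then show ?thesis
    unfolding image_span_def using m3.mcar_subspace by (rule complex_vector.span_minimal)
qed

text \<open>With \<open>\<alpha> + \<beta> = m\<close> the residue identity expresses \<open>a\<^sub>(\<^sub>m\<^sub>) v\<^sub>(\<^sub>k\<^sub>) u\<close> through
  \<open>a\<^sub>(\<^sub>m\<^sub>-\<^sub>j\<^sub>) v\<^sub>(\<^sub>k\<^sub>+\<^sub>j\<^sub>) u\<close> with \<open>j > 0\<close>, and these vanish for large \<open>j\<close>.\<close>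

lemma mode_image_generator:
  assumes I: "I \<in> IO" and v: "v \<in> mcar M1" and u: "u \<in> mcar M2" and a: "a \<in> m2.homs l"
  shows "mode M3 a m (I v k u) \<in> image_span I"
proof -
  obtain r where r: "r < T" "a \<in> sector g2 T r" using a by (auto simp: m2.homs_def)
  let ?b = "of_int \<epsilon> * of_nat r / of_nat T :: rat"
  obtain N where N: "\<And>n. n \<ge> N \<Longrightarrow> I v n u = 0" using IO_truncation[OF I v u] by blast
  \<comment> \<open>The induction variable is the distance N - k to the truncation bound: when it is
    negative, v_(k) u is 0, and each j > 0 reduces it.\<close>
  have main: "\<forall>m. mode M3 a m (I v (N - n) u) \<in> image_span I" for n
  proof (induction n rule: rat_degree_induct)
    case (1 n)
    then have "I v (N - n) u = 0" by (intro N) simp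
    then show ?case using csubspace_0[OF image_span_subspace] by simp
  next
    case (2 n)
    show ?case
    proof
      fix m
      let ?k = "N - n"
      have xM: "I v k u \<in> mcar M3" for k by (rule IO_in[OF I v u])
      show "mode M3 a m (I v ?k u) \<in> image_span I"
      proof (cases "m - of_nat r / of_nat T - ?b \<in> \<int>")
        case False
        then show ?thesis
          using mode3_wrong_coset[OF r xM] csubspace_0[OF image_span_subspace] by simp
      next
        case True
        define \<alpha> where "\<alpha> = m - ?b"
        have \<alpha>: "\<alpha> - of_nat r / of_nat T \<in> \<int>" using True by (simp add: \<alpha>_def algebra_simps)
        have \<beta>: "?b - ?b \<in> \<int>" by simp
        let ?f = "\<lambda>j. ((-1) ^ j * ((of_rat ?b :: complex) gchoose j)) *\<^sub>C
          mode M3 a (\<alpha> + ?b - of_nat j) (I v (?k + of_nat j) u)"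
        obtain J :: nat where J: "\<And>j. j \<ge> J \<Longrightarrow> I v (?k + of_nat j) u = 0"
          using Jacobi_M3_support[OF v u I] by blast
        have f0: "?f j = 0" if "j \<ge> J" for j by (simp add: J[OF that])
        have "Jacobi_M3 I a v u \<alpha> ?b ?k = Jacobi_M2 I a v u \<alpha> ?b ?k + Jacobi_M1 I a v u \<alpha> ?b ?k"
          using IO_Jacobi[OF I r v u \<alpha> \<beta>, of ?k] by (simp add: algebra_simps)
        moreover have "Jacobi_M2 I a v u \<alpha> ?b ?k \<in> image_span I"
          unfolding Jacobi_M2_def
          by (intro csubspace_Sum_any[OF image_span_subspace] csubspace_scale[OF image_span_subspace]
              image_span_base v m2.mode_in u)
        moreover have "Jacobi_M1 I a v u \<alpha> ?b ?k \<in> image_span I"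
          unfolding Jacobi_M1_def
          by (intro csubspace_Sum_any[OF image_span_subspace] csubspace_scale[OF image_span_subspace]
              image_span_base m1.mode_in v u)
        ultimately have "Jacobi_M3 I a v u \<alpha> ?b ?k \<in> image_span I"
          using csubspace_add[OF image_span_subspace] by simp
        moreover have "Jacobi_M3 I a v u \<alpha> ?b ?k = ?f 0 + Sum_any (\<lambda>j. ?f (Suc j))"
          unfolding Jacobi_M3_def using f0 by (rule Sum_any_nat_split)
        moreover have "Sum_any (\<lambda>j. ?f (Suc j)) \<in> image_span I"
        proof (rule csubspace_Sum_any[OF image_span_subspace], rule csubspace_scale[OF image_span_subspace])
          fix j
          have "n - of_nat (Suc j) \<le> n - 1" by simp
          from 2[OF this, rule_format, of "\<alpha> + ?b - of_nat (Suc j)"]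
          show "mode M3 a (\<alpha> + ?b - of_nat (Suc j)) (I v (?k + of_nat (Suc j)) u) \<in> image_span I"
            by (simp add: algebra_simps)
        qed
        ultimately have "?f 0 \<in> image_span I"
          using csubspace_diff[OF image_span_subspace[of I], of "?f 0 + Sum_any (\<lambda>j. ?f (Suc j))" "Sum_any (\<lambda>j. ?f (Suc j))"]
          by simp
        then show ?thesis by (simp add: \<alpha>_def scaleC_one)
      qed
    qed
  qed
  from main[of "N - k"] show ?thesis by simp
qed

lemma mode_image_span:
  assumes I: "I \<in> IO" and x: "x \<in> image_span I"
  shows "mode M3 a m x \<in> image_span I"
proof (rule clinear_on_span[OF m3.clinear_on_mode m3.mcar_subspace _ image_span_subspace])
  show "x \<in> cspan {I v k u | v k u. v \<in> mcar M1 \<and> u \<in> mcar M2}"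
    using x by (simp only: image_span_def)
  show "{I v k u | v k u. v \<in> mcar M1 \<and> u \<in> mcar M2} \<subseteq> mcar M3"
    using IO_in[OF I] by blast
  fix y assume "y \<in> {I v k u | v k u. v \<in> mcar M1 \<and> u \<in> mcar M2}"
  then obtain v k u where y: "y = I v k u" "v \<in> mcar M1" "u \<in> mcar M2" by blast
  have yM: "y \<in> mcar M3" unfolding y(1) by (rule IO_in[OF I y(2,3)])
  show "mode M3 a m y \<in> image_span I"
    by (rule m2.homs_linear_induct[OF m3.clinear_on_mode_left[OF yM] image_span_subspace])
      (unfold y(1), rule mode_image_generator[OF I y(2,3)])
qed

text \<open>The annihilator \<open>N\<close> of \<open>R\<close> is stable under the contragredient
  action, since that action is defined by modes of \<open>M3\<close> and these preserve
  \<open>R\<close>. It contains the bottom level, whose functionals see only bottom parts. So it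
  contains the whole graded dual, which separates points.\<close>

lemma contragredient_separates:
  assumes gen: "Verma_map (contragredient V M3) ` free_words (mgr (contragredient V M3) 0) = mcar (contragredient V M3)"
    and R: "R \<subseteq> mcar M3" "csubspace R" "\<And>a m x. x \<in> R \<Longrightarrow> mode M3 a m x \<in> R"
    and zero: "\<And>x. x \<in> R \<Longrightarrow> m3.bottom_part x = 0"
  shows "R \<subseteq> {0}"
proof -
  let ?M = "contragredient V M3"
  define N where "N = {f :: 'm3 \<Rightarrow> complex. \<forall>x\<in>R. f x = 0}"
  have N: "csubspace N"
    by (simp add: N_def complex_vector.subspace_def scaleC_fun_def scaleC_complex_def)
  have linear: "clinear_on (mcar M3) f" if "f \<in> mcar ?M" for f
    using that by (simp add: contragredient_def Let_def clinear_on_def scaleC_complex_def)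
  have bottom: "mgr ?M 0 \<subseteq> N"
  proof
    fix f assume f: "f \<in> mgr ?M 0"
    then have fM: "f \<in> mcar ?M" and f0: "\<And>k u. k \<noteq> 0 \<Longrightarrow> u \<in> mgr M3 k \<Longrightarrow> f u = 0"
      by (simp_all add: contragredient_def Let_def)
    have "f x = 0" if x: "x \<in> R" for x
    proof -
      have xM: "x \<in> mcar M3" using x R(1) by blast
      have h: "hcomp (mgr M3) x i \<in> mgr M3 i" for i by (rule hcomp_in[OF m3.grading_M xM])
      have "f (Sum_any (hcomp (mgr M3) x)) = Sum_any (\<lambda>i. f (hcomp (mgr M3) x i))"
        by (rule clinear_on_Sum_any[OF linear[OF fM] m3.mcar_subspace m3.mgr_mcar[OF h] finite_hcomp[OF m3.grading_M xM]])
      moreover have "f (hcomp (mgr M3) x i) = 0" for i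
        using f0[OF _ h, of i] zero[OF x] clinear_on_0[OF linear[OF fM] m3.mcar_subspace]
        by (cases "i = 0") simp_all
      ultimately show ?thesis by (simp add: Sum_any_hcomp[OF m3.grading_M xM])
    qed
    then show "f \<in> N" by (simp add: N_def)
  qed
  have closed: "mode ?M a n f \<in> N" if f: "f \<in> N" for a n f
    unfolding N_def
  proof (intro CollectI ballI)
    fix x assume x: "x \<in> R"
    have "Sum_any (\<lambda>j. ((-1) ^ k / fact j) *\<^sub>C mode M3 ((Vir V 1 ^^ j) (hcomp (VGr V) a k))
                (2 * of_nat k - n - of_nat j - 2) x) \<in> R" for k :: nat
      by (intro csubspace_Sum_any[OF R(2)] csubspace_scale[OF R(2)] R(3)[OF x])
    then have "f (Sum_any (\<lambda>j. ((-1) ^ k / fact j) *\<^sub>C mode M3 ((Vir V 1 ^^ j) (hcomp (VGr V) a k))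
                (2 * of_nat k - n - of_nat j - 2) x)) = 0" for k :: nat
      using f unfolding N_def by blast
    then show "mode ?M a n f x = 0" by (simp add: contragredient_def Let_def)
  qed
  have all: "mcar ?M \<subseteq> N" by (rule Verma_generated[OF gen N bottom closed])
  show ?thesis
  proof
    fix x assume x: "x \<in> R"
    have xM: "x \<in> mcar M3" using x R(1) by blast
    have "hcomp (mgr M3) x i = 0" for i
    proof (rule ccontr)
      assume nz: "hcomp (mgr M3) x i \<noteq> 0"
      obtain \<phi> :: "'m3 \<Rightarrow> complex" where \<phi>: "\<And>y z. \<phi> (y + z) = \<phi> y + \<phi> z"
        "\<And>c y. \<phi> (c *\<^sub>C y) = c * \<phi> y" "\<phi> (hcomp (mgr M3) x i) = 1"
        using nonzero_functional[OF nz] by metis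
      have \<phi>0: "\<phi> 0 = 0" using \<phi>(2)[of 0 0] by simp
      \<comment> \<open>A functional on one graded piece, extended by 0 to the others, lies in the
        contragredient module and detects \<open>x\<close>.\<close>
      define f where "f y = (if y \<in> mcar M3 then \<phi> (hcomp (mgr M3) y i) else 0)" for y
      have "{n. \<exists>u\<in>mgr M3 n. f u \<noteq> 0} \<subseteq> {i}"
      proof
        fix n assume "n \<in> {n. \<exists>u\<in>mgr M3 n. f u \<noteq> 0}"
        then obtain u where u: "u \<in> mgr M3 n" "f u \<noteq> 0" by blast
        then show "n \<in> {i}"
          using hcomp_homogeneous[OF m3.grading_M u(1), of i] \<phi>0 by (auto simp: f_def split: if_splits)
      qed
      then have "finite {n. \<exists>u\<in>mgr M3 n. f u \<noteq> 0}" using finite_subset by blast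
      then have "f \<in> mcar ?M"
        using \<phi>(1,2) csubspace_add[OF m3.mcar_subspace] csubspace_scale[OF m3.mcar_subspace]
        by (simp add: contragredient_def Let_def f_def hcomp_add[OF m3.grading_M] hcomp_scale[OF m3.grading_M])
      then have "f x = 0" using all x unfolding N_def by blast
      then show False using \<phi>(3) xM by (simp add: f_def)
    qed
    then have "Sum_any (hcomp (mgr M3) x) = 0" by simp
    then show "x \<in> {0}" by (simp add: Sum_any_hcomp[OF m3.grading_M xM])
  qed
qed

theorem IO_finite_dim:
  assumes cft: "CFT_type V" and c2: "C2_cofinite V" and fg: "finitely_generated M1"
    and lw2: "lowest_weight_module V g2 T M2" and lw3: "lowest_weight_module V g3 T M3"
    and gen: "Verma_map (contragredient V M3) ` free_words (mgr (contragredient V M3) 0) = mcar (contragredient V M3)"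
  shows "finite_dim IO"
proof -
  have A: "\<And>k. m2.homs k \<subseteq> VGr V k" "\<And>k. VGr V k \<subseteq> cspan (m2.homs k)"
    using m2.homs_VGr m2.VGr_span_homs by blast+
  obtain F where F: "finite F" "\<And>n v. (n, v) \<in> F \<Longrightarrow> v \<in> mgr M1 n"
    "\<And>n. mgr M1 n \<subseteq> cspan ({v. (n, v) \<in> F} \<union> {mode M1 a m x | a m x k p.
      a \<in> m2.homs k \<and> m < -1 \<and> x \<in> mgr M1 p \<and> n = of_nat k - m - 1 + p})"
  proof (rule m1.homogeneous_cofinite[OF cft c2 fg A])
    fix F assume "finite F" "\<And>n v. (n, v) \<in> F \<Longrightarrow> v \<in> mgr M1 n"
      "\<And>n. mgr M1 n \<subseteq> cspan ({v. (n, v) \<in> F} \<union> {mode M1 a m x | a m x k p.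
      a \<in> m2.homs k \<and> m < -1 \<and> x \<in> mgr M1 p \<and> n = of_nat k - m - 1 + p})"
    then show thesis by (rule that)
  qed
  obtain U where U: "finite U" "U \<subseteq> mgr M2 0" "mgr M2 0 \<subseteq> cspan U"
    using finite_dim_spanning_subset[OF m2.bottom_finite_dim[OF c2 lw2]] .
  define f :: "(rat \<times> 'm1) \<times> 'm2 \<Rightarrow> ('m1 \<Rightarrow> rat \<Rightarrow> 'm2 \<Rightarrow> 'm3) \<Rightarrow> 'm3"
    where "f = (\<lambda>((n, v), u) I. m3.bottom_part (I v (n - 1) u))"
  show ?thesis
  proof (rule finite_dim_of_maps[of "F \<times> U" _ f])
    show "finite (F \<times> U)" using F(1) U(1) by simp
    show "csubspace IO" by (rule IO_subspace)
  next
    fix p assume "p \<in> F \<times> U"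
    then obtain n v u where p: "p = ((n, v), u)" "(n, v) \<in> F" "u \<in> U" by auto
    have v: "v \<in> mcar M1" using m1.mgr_mcar[OF F(2)[OF p(2)]] .
    have u: "u \<in> mcar M2" using m2.mgr_mcar U(2) p(3) by blast
    show "clinear_on IO (f p)"
      unfolding f_def p(1) clinear_on_def
      by (simp add: scaleC_fun_def hcomp_add[OF m3.grading_M] hcomp_scale[OF m3.grading_M] IO_in[OF _ v u])
    have "f p ` IO \<subseteq> mgr M3 0"
      unfolding f_def p(1) using hcomp_in[OF m3.grading_M IO_in[OF _ v u]] by auto
    with m3.bottom_finite_dim[OF c2 lw3] show "finite_dim (f p ` IO)"
      by (rule finite_dim_mono)
  next
    fix I assume I: "I \<in> IO" and zero: "\<And>p. p \<in> F \<times> U \<Longrightarrow> f p I = 0"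
    have F0: "m3.bottom_part (I v (n - 1) u) = 0" if nv: "(n, v) \<in> F" and u: "u \<in> mgr M2 0" for n v u
    proof -
      have v: "v \<in> mcar M1" using m1.mgr_mcar[OF F(2)[OF nv]] .
      have "m3.bottom_part (I v (n - 1) u) \<in> {0}"
      proof (rule clinear_on_span[OF clinear_on_bottom_right[OF I v] m2.mcar_subspace])
        show "u \<in> cspan U" using U(3) u by blast
        show "U \<subseteq> mcar M2" using U(2) m2.mgr_mcar by blast
        show "csubspace {0::'m3}" by (simp add: complex_vector.subspace_def)
        fix y assume "y \<in> U"
        then show "m3.bottom_part (I v (n - 1) y) \<in> {0}"
          using zero[of "((n, v), y)"] nv by (simp add: f_def)
      qed
      then show ?thesis by simp
    qed
    have M1: "m3.bottom_part (I v k u) = 0" if u: "u \<in> mgr M2 0" and v: "v \<in> mcar M1" for u v k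
    proof (rule bottom_vanishing_mcar1[OF I m2.mgr_mcar[OF u] _ v])
      fix n v' k' assume "v' \<in> mgr M1 n"
      then show "m3.bottom_part (I v' k' u) = 0"
        using bottom_vanishing_M1[OF I u F(2,3) F0[OF _ u], of n] by blast
    qed
    have M2: "m3.bottom_part (I v k u) = 0" if v: "v \<in> mcar M1" and u: "u \<in> mcar M2" for u v k
    proof -
      have h: "hcomp (mgr M2) u d \<in> mgr M2 d" for d by (rule hcomp_in[OF m2.grading_M u])
      have "m3.bottom_part (I v k (hcomp (mgr M2) u d)) = 0" for d
        using bottom_vanishing_M2[OF I lw2 M1, of d] h[of d] v by blast
      moreover have "m3.bottom_part (I v k (Sum_any (hcomp (mgr M2) u)))
        = Sum_any (\<lambda>d. m3.bottom_part (I v k (hcomp (mgr M2) u d)))"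
        by (rule clinear_on_Sum_any[OF clinear_on_bottom_right[OF I v] m2.mcar_subspace
            m2.mgr_mcar[OF h] finite_hcomp[OF m2.grading_M u]])
      ultimately show ?thesis by (simp add: Sum_any_hcomp[OF m2.grading_M u])
    qed
    have "m3.bottom_part x = 0" if x: "x \<in> image_span I" for x
    proof -
      have "m3.bottom_part x \<in> {0}"
      proof (rule clinear_on_span[OF clinear_on_hcomp[OF m3.grading_M] m3.mcar_subspace])
        show "x \<in> cspan {I v k u | v k u. v \<in> mcar M1 \<and> u \<in> mcar M2}"
          using x by (simp only: image_span_def)
        show "{I v k u | v k u. v \<in> mcar M1 \<and> u \<in> mcar M2} \<subseteq> mcar M3"
          using IO_in[OF I] by blast
        show "csubspace {0::'m3}" by (simp add: complex_vector.subspace_def)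
        fix y assume "y \<in> {I v k u | v k u. v \<in> mcar M1 \<and> u \<in> mcar M2}"
        then show "m3.bottom_part y \<in> {0}" using M2 by blast
      qed
      then show ?thesis by simp
    qed
    from contragredient_separates[OF gen image_span_mcar[OF I] image_span_subspace mode_image_span[OF I] this]
    have "image_span I \<subseteq> {0}" .
    then have "I v k u = 0" for v k u
      using image_span_base[of v u I k] IO_outside[OF I, of v u k] by blast
    then show "I = 0" by (simp add: fun_eq_iff)
  qed
qed

end

section \<open>Finiteness of fusion rules\<close>

lemma aut_group_pow: "g [^]\<^bsub>aut_group V\<^esub> (n::nat) = g ^^ n"
proof (induction n)
  case 0
  then show ?case by (simp add: aut_group_def id_def)
next
  case (Suc n)
  have "g [^]\<^bsub>aut_group V\<^esub> Suc n = g [^]\<^bsub>aut_group V\<^esub> n \<otimes>\<^bsub>aut_group V\<^esub> g" by simp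
  also have "\<dots> = g ^^ n \<circ> g" unfolding Suc.IH by (simp add: aut_group_def)
  also have "\<dots> = g ^^ Suc n" by (simp only: funpow_Suc_right)
  finally show ?case .
qed

text \<open>This is Lagrange's theorem. It makes \<open>T\<close> a common period of the three
  automorphisms.\<close>

lemma subgroup_generated_period:
  assumes "group G" "S \<subseteq> carrier G" "x \<in> S"
  shows "x [^]\<^bsub>G\<^esub> order (subgroup_generated G S) = \<one>\<^bsub>G\<^esub>"
proof -
  interpret group G by fact
  interpret H: group "subgroup_generated G S" by simp
  have "x \<in> carrier (subgroup_generated G S)"
    using assms(2,3) by (auto simp: carrier_subgroup_generated intro: generate.incl)
  from H.pow_order_eq_1[OF this] show ?thesis
    by (simp add: pow_subgroup_generated)
qed

lemma sector_pow:
  assumes "voa_automorphism V g" "a \<in> sector g T r"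
  shows "(g ^^ m) a = root_exp T (m * r) *\<^sub>C a"
proof (induction m)
  case 0
  then show ?case by (simp add: root_exp_def scaleC_one)
next
  case (Suc m)
  have lin: "g (c *\<^sub>C x) = c *\<^sub>C g x" for c x
    using assms(1) by (simp add: voa_automorphism_def Vector_Spaces.linear_iff)
  have "(g ^^ Suc m) a = root_exp T (m * r) *\<^sub>C g a" by (simp add: Suc.IH lin)
  also have "\<dots> = root_exp T (Suc m * r) *\<^sub>C a"
    using assms(2) by (simp add: sector_root_exp scaleC_scaleC root_exp_add mult.commute)
  finally show ?case .
qed

lemma root_exp_cong: "int m mod int T = int n mod int T \<Longrightarrow> root_exp T m = root_exp T n"
  by (metis of_nat_mod nat_int root_exp_mod)

theorem corollary6p20:
  fixes V :: "'v::complex_vector voa"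
    and g\<^sub>1 g\<^sub>2 g\<^sub>3 :: "'v \<Rightarrow> 'v"
    and M1 :: "('v, 'm1::complex_vector) vmod"
    and M2 :: "('v, 'm2::complex_vector) vmod"
    and M3 :: "('v, 'm3::complex_vector) vmod"
    and h\<^sub>1 h\<^sub>2 h\<^sub>3 \<zeta> :: complex
    and T :: nat and \<epsilon> :: int
  assumes "vertex_operator_algebra V" and "CFT_type V" and "C2_cofinite V"
    and "{g\<^sub>1, g\<^sub>2, g\<^sub>3} \<subseteq> carrier (aut_group V)"
    and "g\<^sub>1 \<otimes>\<^bsub>aut_group V\<^esub> g\<^sub>2 = g\<^sub>3"
    and "cyclic_group (subgroup_generated (aut_group V) {g\<^sub>1, g\<^sub>2, g\<^sub>3})"
    and "order (subgroup_generated (aut_group V) {g\<^sub>1, g\<^sub>2, g\<^sub>3}) = T" and "0 < T"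
    and "admissible_twisted_module V g\<^sub>1 T M1"
    and "admissible_twisted_module V g\<^sub>2 T M2"
    and "admissible_twisted_module V g\<^sub>3 T M3"
    and "conformal_weight V M1 h\<^sub>1"
    and "conformal_weight V M2 h\<^sub>2"
    and "conformal_weight V M3 h\<^sub>3"
    and "lowest_weight_module V g\<^sub>2 T M2" and "lowest_weight_module V g\<^sub>3 T M3"
    and "Verma_of_bottom_level V g\<^sub>2 T M2"
    and "Verma_of_bottom_level V (inv\<^bsub>aut_group V\<^esub> g\<^sub>3) T (contragredient V M3)"
    and "(g\<^sub>1 = \<one>\<^bsub>aut_group V\<^esub> \<and> \<epsilon> = 0 \<and> finitely_generated M1)
       \<or> (group.ord (aut_group V) g\<^sub>1 = T \<and> group.ord (aut_group V) g\<^sub>2 = T \<and>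
          group.ord (aut_group V) g\<^sub>3 = T \<and>
          g\<^sub>1 = g\<^sub>2 [^]\<^bsub>aut_group V\<^esub> \<epsilon> \<and>
          lowest_weight_module V g\<^sub>1 T M1 \<and> Verma_of_bottom_level V g\<^sub>1 T M1)"
    and "\<zeta> ^ T = -1"
  shows "fusion_rule V g\<^sub>2 T \<epsilon> \<zeta> (h\<^sub>1 + h\<^sub>2 - h\<^sub>3) M1 M2 M3 < \<infinity>"
proof -
  let ?A = "aut_group V"
  let ?H = "subgroup_generated ?A {g\<^sub>1, g\<^sub>2, g\<^sub>3}"
  note voa = assms(1) and cft = assms(2) and c2 = assms(3) and carrier = assms(4) and prod = assms(5)
  interpret A: group ?A by (rule group_aut_group)
  have aut: "voa_automorphism V g\<^sub>1" "voa_automorphism V g\<^sub>2" "voa_automorphism V g\<^sub>3"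
    using carrier by (simp_all add: aut_group_def)
  have period: "g ^^ T = id" if "g \<in> {g\<^sub>1, g\<^sub>2, g\<^sub>3}" for g
    using subgroup_generated_period[OF group_aut_group carrier that] assms(7)
    by (simp add: aut_group_pow) (simp add: aut_group_def)
  have lw2: "lowest_weight_module V g\<^sub>2 T M2" and lw3: "lowest_weight_module V g\<^sub>3 T M3" by fact+
  interpret m1: admissible_module V g\<^sub>1 T M1
    by (intro admissible_module.intro twisted_voa.intro twisted_voa_axioms.intro admissible_module_axioms.intro
        voa aut assms period) simp
  have eps: "g\<^sub>1 = g\<^sub>2 [^]\<^bsub>?A\<^esub> \<epsilon>"
    using assms(19) by auto
  have fg: "finitely_generated M1"
    using assms(19) m1.lowest_weight_finitely_generated[OF c2] by blast
  \<comment> \<open>Modulo the period the exponent \<epsilon> becomes a natural number, so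
    eigenvalues of g1 are found by iterating g2.\<close>
  define m where "m = nat (\<epsilon> mod int T)"
  have m: "int m = \<epsilon> mod int T" using \<open>0 < T\<close> by (simp add: m_def)
  have g2: "g\<^sub>2 \<in> carrier ?A" using carrier by simp
  have "\<epsilon> = int T * (\<epsilon> div int T) + int m" by (simp add: m)
  then have "g\<^sub>1 = g\<^sub>2 [^]\<^bsub>?A\<^esub> (int T * (\<epsilon> div int T)) \<otimes>\<^bsub>?A\<^esub> g\<^sub>2 [^]\<^bsub>?A\<^esub> int m"
    using eps A.int_pow_mult[OF g2] by metis
  also have "g\<^sub>2 [^]\<^bsub>?A\<^esub> (int T * (\<epsilon> div int T)) = (g\<^sub>2 [^]\<^bsub>?A\<^esub> int T) [^]\<^bsub>?A\<^esub> (\<epsilon> div int T)"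
    using A.int_pow_pow[OF g2] by simp
  also have "g\<^sub>2 [^]\<^bsub>?A\<^esub> int T = \<one>\<^bsub>?A\<^esub>"
    using period[of g\<^sub>2] by (simp add: int_pow_int aut_group_pow) (simp add: aut_group_def)
  finally have g1: "g\<^sub>1 = g\<^sub>2 ^^ m"
    using A.nat_pow_closed[OF g2, of m] by (simp add: int_pow_int aut_group_pow)
  have sec1: "g\<^sub>1 a = root_exp T (nat (\<epsilon> * int r mod int T)) *\<^sub>C a" if a: "a \<in> sector g\<^sub>2 T r" for a r
  proof -
    have "root_exp T (m * r) = root_exp T (nat (\<epsilon> * int r mod int T))"
      by (rule root_exp_cong) (use \<open>0 < T\<close> in \<open>simp add: m mod_mult_left_eq\<close>)
    then show ?thesis using sector_pow[OF aut(2) a, of m] by (simp add: g1)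
  qed
  interpret fusion_setting V g\<^sub>1 g\<^sub>2 g\<^sub>3 T M1 M2 M3 \<epsilon> \<zeta> h\<^sub>1 h\<^sub>2 h\<^sub>3
  proof (intro fusion_setting.intro fusion_setting_axioms.intro admissible_module.intro twisted_voa.intro
      twisted_voa_axioms.intro admissible_module_axioms.intro)
    fix a r assume a: "a \<in> sector g\<^sub>2 T r"
    show "a \<in> sector g\<^sub>1 T (nat (\<epsilon> * int r mod int T))"
      using sec1[OF a] by (simp add: sector_root_exp)
    have "g\<^sub>3 a = g\<^sub>1 (g\<^sub>2 a)" using prod by (auto simp: aut_group_def)
    also have "\<dots> = root_exp T r *\<^sub>C g\<^sub>1 a"
      using a m1.g_scale by (simp add: sector_root_exp)
    also have "\<dots> = root_exp T (r + nat (\<epsilon> * int r mod int T)) *\<^sub>C a"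
      by (simp add: sec1[OF a] scaleC_scaleC root_exp_add)
    also have "root_exp T (r + nat (\<epsilon> * int r mod int T)) = root_exp T (nat ((1 + \<epsilon>) * int r mod int T))"
      by (rule root_exp_cong) (use \<open>0 < T\<close> in \<open>simp add: mod_add_right_eq distrib_right\<close>)
    finally show "a \<in> sector g\<^sub>3 T (nat ((1 + \<epsilon>) * int r mod int T))"
      by (simp add: sector_root_exp)
  next
    show "\<zeta> \<noteq> 0" using assms(20) \<open>0 < T\<close> by (auto simp: power_0_left)
  qed (use voa aut period assms in simp_all)
  have "quotient_of_Verma V (inv\<^bsub>?A\<^esub> g\<^sub>3) T (contragredient V M3) (mgr (contragredient V M3) 0)"
    using assms(18) by (simp add: Verma_of_bottom_level_def is_Verma_of_def)
  then have "Verma_map (contragredient V M3) ` free_words (mgr (contragredient V M3) 0) = mcar (contragredient V M3)"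
    by (simp add: quotient_of_Verma_def)
  from IO_finite_dim[OF cft c2 fg lw2 lw3 this] show ?thesis
    by (simp add: fusion_rule_def edim_def)
qed

end
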